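(* Let $k$ be a commutative ring. For an essentially small $k$-linear category $A$ the following are equivalent. (1) $A$ is semisimple abelian with objects of finite length. (2) $A$ is equivalent to $\operatorname{Fin}(X)$ for some category $X$ that is a coproduct, in the category of small $k$-linear categories, of division $k$-algebras. In this case, $X$ is (a skeleton of) the full subcategory of simple objects of $A$.
   Context: All categories and functors are $k$-linear, i.e. enriched in $V=k\text{-}\mathrm{Mod}$. A $k$-algebra is regarded as a one-object $k$-linear category; a division $k$-algebra is a $k$-algebra that is a division ring. Thus a coproduct of division $k$-algebras is a small $k$-linear category in which every endomorphism algebra is a division algebra and the homs between distinct objects are $0$. For a small $k$-linear category $X$, $[X^{\mathrm{op}},V]$ is the category of $k$-linear functors $X^{\mathrm{op}}\to V$, and $\operatorname{Fin}(X)$ is the smallest full subcategory of $[X^{\mathrm{op}},V]$ that is closed under isomorphisms, contains the representable functors and is closed under finite colimits (it is the free completion of $X$ under finite colimits). Via the Yoneda embedding $X$ is regarded as a full subcategory of $\operatorname{Fin}(X)$. An abelian category with objects of finite length is semisimple if every object is a finite direct sum of simple objects. *)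

theory Defs
  imports "HOL-Algebra.Module" "HOL-Library.FuncSet"
begin

section \<open>Categories and linear categories\<close>

text \<open>
  Hom sets are indexed by source and target and need not be disjoint; therefore composition and
  the action of functors on arrows carry the objects as explicit arguments.
  \<open>Cmp C x y z g f\<close> is the composite of \<open>f : x \<rightarrow> y\<close> and \<open>g : y \<rightarrow> z\<close>.
\<close>

record ('o, 'a) cat =
  Ob :: "'o set"
  Hom :: "'o \<Rightarrow> 'o \<Rightarrow> 'a set"
  Cmp :: "'o \<Rightarrow> 'o \<Rightarrow> 'o \<Rightarrow> 'a \<Rightarrow> 'a \<Rightarrow> 'a"
  Idn :: "'o \<Rightarrow> 'a"

text \<open>
  \<open>HMod C x y\<close> is the hom set \<open>Hom C x y\<close> with its module structure. (Module records of
  HOL-Algebra extend ring records; the fields \<open>mult\<close> and \<open>one\<close> play no role in a module.)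
\<close>

record ('k, 'o, 'a) lcat = "('o, 'a) cat" +
  HMod :: "'o \<Rightarrow> 'o \<Rightarrow> ('k, 'a) module"

locale category =
  fixes C :: "('o, 'a, 'z) cat_scheme"
  assumes Idn_in_Hom: "x \<in> Ob C \<Longrightarrow> Idn C x \<in> Hom C x x"
    and Cmp_in_Hom: "\<lbrakk>x \<in> Ob C; y \<in> Ob C; z \<in> Ob C; f \<in> Hom C x y; g \<in> Hom C y z\<rbrakk>
      \<Longrightarrow> Cmp C x y z g f \<in> Hom C x z"
    and Cmp_Idn_left: "\<lbrakk>x \<in> Ob C; y \<in> Ob C; f \<in> Hom C x y\<rbrakk> \<Longrightarrow> Cmp C x y y (Idn C y) f = f"
    and Cmp_Idn_right: "\<lbrakk>x \<in> Ob C; y \<in> Ob C; f \<in> Hom C x y\<rbrakk> \<Longrightarrow> Cmp C x x y f (Idn C x) = f"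
    and Cmp_assoc: "\<lbrakk>w \<in> Ob C; x \<in> Ob C; y \<in> Ob C; z \<in> Ob C;
        f \<in> Hom C w x; g \<in> Hom C x y; h \<in> Hom C y z\<rbrakk>
      \<Longrightarrow> Cmp C w y z h (Cmp C w x y g f) = Cmp C w x z (Cmp C x y z h g) f"

definition linear_map ::
  "('k, 'r) ring_scheme \<Rightarrow> ('k, 'a, 'y) module_scheme \<Rightarrow> ('k, 'b, 'z) module_scheme \<Rightarrow> ('a \<Rightarrow> 'b) \<Rightarrow> bool"
  where "linear_map K M N f \<longleftrightarrow>
    f \<in> carrier M \<rightarrow> carrier N \<and>
    (\<forall>u\<in>carrier M. \<forall>v\<in>carrier M. f (u \<oplus>\<^bsub>M\<^esub> v) = f u \<oplus>\<^bsub>N\<^esub> f v) \<and>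
    (\<forall>a\<in>carrier K. \<forall>u\<in>carrier M. f (a \<odot>\<^bsub>M\<^esub> u) = a \<odot>\<^bsub>N\<^esub> f u)"

locale k_linear_category = K: cring K + category C
  for K :: "('k, 'r) ring_scheme" and C :: "('k, 'o, 'a) lcat" +
  assumes HMod_module: "\<lbrakk>x \<in> Ob C; y \<in> Ob C\<rbrakk> \<Longrightarrow> module K (HMod C x y)"
    and carrier_HMod: "\<lbrakk>x \<in> Ob C; y \<in> Ob C\<rbrakk> \<Longrightarrow> carrier (HMod C x y) = Hom C x y"
    and Cmp_linear_left: "\<lbrakk>x \<in> Ob C; y \<in> Ob C; z \<in> Ob C; f \<in> Hom C x y\<rbrakk>
      \<Longrightarrow> linear_map K (HMod C y z) (HMod C x z) (\<lambda>g. Cmp C x y z g f)"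
    and Cmp_linear_right: "\<lbrakk>x \<in> Ob C; y \<in> Ob C; z \<in> Ob C; g \<in> Hom C y z\<rbrakk>
      \<Longrightarrow> linear_map K (HMod C x y) (HMod C x z) (\<lambda>f. Cmp C x y z g f)"

abbreviation zero_arr :: "('k, 'o, 'a) lcat \<Rightarrow> 'o \<Rightarrow> 'o \<Rightarrow> 'a"
  where "zero_arr C x y \<equiv> \<zero>\<^bsub>HMod C x y\<^esub>"

definition opcat :: "('k, 'o, 'a) lcat \<Rightarrow> ('k, 'o, 'a) lcat"
  where "opcat C = \<lparr>Ob = Ob C, Hom = (\<lambda>x y. Hom C y x),
    Cmp = (\<lambda>x y z g f. Cmp C z y x f g), Idn = Idn C, HMod = (\<lambda>x y. HMod C y x)\<rparr>"

definition full_subcat :: "('k, 'o, 'a) lcat \<Rightarrow> 'o set \<Rightarrow> ('k, 'o, 'a) lcat"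
  where "full_subcat C S = C\<lparr>Ob := S\<rparr>"

section \<open>Functors, natural transformations, equivalences\<close>

record ('o, 'a, 'p, 'b) fnctr =
  OMap :: "'o \<Rightarrow> 'p"
  AMap :: "'o \<Rightarrow> 'o \<Rightarrow> 'a \<Rightarrow> 'b"

definition is_functor ::
  "('o, 'a, 'y) cat_scheme \<Rightarrow> ('p, 'b, 'z) cat_scheme \<Rightarrow> ('o, 'a, 'p, 'b) fnctr \<Rightarrow> bool"
  where "is_functor C D F \<longleftrightarrow>
    (\<forall>x\<in>Ob C. OMap F x \<in> Ob D) \<and>
    (\<forall>x\<in>Ob C. \<forall>y\<in>Ob C. \<forall>f\<in>Hom C x y. AMap F x y f \<in> Hom D (OMap F x) (OMap F y)) \<and>
    (\<forall>x\<in>Ob C. AMap F x x (Idn C x) = Idn D (OMap F x)) \<and>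
    (\<forall>x\<in>Ob C. \<forall>y\<in>Ob C. \<forall>z\<in>Ob C. \<forall>f\<in>Hom C x y. \<forall>g\<in>Hom C y z.
      AMap F x z (Cmp C x y z g f) =
        Cmp D (OMap F x) (OMap F y) (OMap F z) (AMap F y z g) (AMap F x y f))"

definition linear_functor ::
  "('k, 'r) ring_scheme \<Rightarrow> ('k, 'o, 'a) lcat \<Rightarrow> ('k, 'p, 'b) lcat \<Rightarrow> ('o, 'a, 'p, 'b) fnctr \<Rightarrow> bool"
  where "linear_functor K C D F \<longleftrightarrow> is_functor C D F \<and>
    (\<forall>x\<in>Ob C. \<forall>y\<in>Ob C. linear_map K (HMod C x y) (HMod D (OMap F x) (OMap F y)) (AMap F x y))"

definition id_functor :: "('o, 'a, 'o, 'a) fnctr"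
  where "id_functor = \<lparr>OMap = (\<lambda>x. x), AMap = (\<lambda>x y f. f)\<rparr>"

definition comp_functor ::
  "('p, 'b, 'q, 'c) fnctr \<Rightarrow> ('o, 'a, 'p, 'b) fnctr \<Rightarrow> ('o, 'a, 'q, 'c) fnctr"
  where "comp_functor G F = \<lparr>OMap = (\<lambda>x. OMap G (OMap F x)),
    AMap = (\<lambda>x y f. AMap G (OMap F x) (OMap F y) (AMap F x y f))\<rparr>"

text \<open>The values of the two maps outside the objects and arrows of the domain are irrelevant.\<close>

definition functor_eq ::
  "('o, 'a, 'y) cat_scheme \<Rightarrow> ('o, 'a, 'p, 'b) fnctr \<Rightarrow> ('o, 'a, 'p, 'b) fnctr \<Rightarrow> bool"
  where "functor_eq C F G \<longleftrightarrow>
    (\<forall>x\<in>Ob C. OMap F x = OMap G x) \<and>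
    (\<forall>x\<in>Ob C. \<forall>y\<in>Ob C. \<forall>f\<in>Hom C x y. AMap F x y f = AMap G x y f)"

definition nat_trans ::
  "('o, 'a, 'y) cat_scheme \<Rightarrow> ('p, 'b, 'z) cat_scheme \<Rightarrow>
   ('o, 'a, 'p, 'b) fnctr \<Rightarrow> ('o, 'a, 'p, 'b) fnctr \<Rightarrow> ('o \<Rightarrow> 'b) \<Rightarrow> bool"
  where "nat_trans C D F G t \<longleftrightarrow>
    (\<forall>x\<in>Ob C. t x \<in> Hom D (OMap F x) (OMap G x)) \<and>
    (\<forall>x\<in>Ob C. \<forall>y\<in>Ob C. \<forall>f\<in>Hom C x y.
      Cmp D (OMap F x) (OMap F y) (OMap G y) (t y) (AMap F x y f) =
      Cmp D (OMap F x) (OMap G x) (OMap G y) (AMap G x y f) (t x))"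

definition is_iso :: "('o, 'a, 'z) cat_scheme \<Rightarrow> 'o \<Rightarrow> 'o \<Rightarrow> 'a \<Rightarrow> bool"
  where "is_iso C x y f \<longleftrightarrow> f \<in> Hom C x y \<and>
    (\<exists>g\<in>Hom C y x. Cmp C x y x g f = Idn C x \<and> Cmp C y x y f g = Idn C y)"

definition isomorphic :: "('o, 'a, 'z) cat_scheme \<Rightarrow> 'o \<Rightarrow> 'o \<Rightarrow> bool"
  where "isomorphic C x y \<longleftrightarrow> (\<exists>f. is_iso C x y f)"

definition nat_iso ::
  "('o, 'a, 'y) cat_scheme \<Rightarrow> ('p, 'b, 'z) cat_scheme \<Rightarrow>
   ('o, 'a, 'p, 'b) fnctr \<Rightarrow> ('o, 'a, 'p, 'b) fnctr \<Rightarrow> ('o \<Rightarrow> 'b) \<Rightarrow> bool"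
  where "nat_iso C D F G t \<longleftrightarrow> nat_trans C D F G t \<and>
    (\<forall>x\<in>Ob C. is_iso D (OMap F x) (OMap G x) (t x))"

definition is_equivalence ::
  "('k, 'r) ring_scheme \<Rightarrow> ('k, 'o, 'a) lcat \<Rightarrow> ('k, 'p, 'b) lcat \<Rightarrow> ('o, 'a, 'p, 'b) fnctr \<Rightarrow> bool"
  where "is_equivalence K C D F \<longleftrightarrow> linear_functor K C D F \<and>
    (\<exists>G. linear_functor K D C G \<and>
      (\<exists>s. nat_iso C C id_functor (comp_functor G F) s) \<and>
      (\<exists>t. nat_iso D D (comp_functor F G) id_functor t))"

definition equivalent_cats ::
  "('k, 'r) ring_scheme \<Rightarrow> ('k, 'o, 'a) lcat \<Rightarrow> ('k, 'p, 'b) lcat \<Rightarrow> bool"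
  where "equivalent_cats K C D \<longleftrightarrow> (\<exists>F. is_equivalence K C D F)"

definition is_isomorphism ::
  "('k, 'r) ring_scheme \<Rightarrow> ('k, 'o, 'a) lcat \<Rightarrow> ('k, 'p, 'b) lcat \<Rightarrow> ('o, 'a, 'p, 'b) fnctr \<Rightarrow> bool"
  where "is_isomorphism K C D F \<longleftrightarrow> linear_functor K C D F \<and>
    (\<exists>G. linear_functor K D C G \<and>
      functor_eq C (comp_functor G F) id_functor \<and> functor_eq D (comp_functor F G) id_functor)"

text \<open>
  A type \<open>'u\<close> serves as the universe: a category is small if its objects and its arrows are
  elements of \<open>'u\<close>, and a module is small if its carrier is a subset of \<open>'u\<close>. The type argument
  is only a carrier for \<open>'u\<close>.
\<close>

definition essentially_small ::
  "'u itself \<Rightarrow> ('k, 'r) ring_scheme \<Rightarrow> ('k, 'o, 'a) lcat \<Rightarrow> bool"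
  where "essentially_small U K A \<longleftrightarrow>
    (\<exists>S :: ('k, 'u, 'u) lcat. k_linear_category K S \<and> equivalent_cats K A S)"

definition is_skeleton :: "('k, 'o, 'a) lcat \<Rightarrow> 'o set \<Rightarrow> bool"
  where "is_skeleton C S \<longleftrightarrow> S \<subseteq> Ob C \<and> (\<forall>x\<in>Ob C. \<exists>!s. s \<in> S \<and> isomorphic C s x)"

section \<open>Presheaves and the free completion under finite colimits\<close>

text \<open>Arrows are extensional functions, so that equal linear maps are equal arrows.\<close>

definition kMod :: "('k, 'r) ring_scheme \<Rightarrow> ('k, ('k, 'u) module, 'u \<Rightarrow> 'u) lcat"
  where "kMod K = \<lparr>
    Ob = {M. module K M},
    Hom = (\<lambda>M N. {f \<in> extensional (carrier M). linear_map K M N f}),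
    Cmp = (\<lambda>M N P g f. compose (carrier M) g f),
    Idn = (\<lambda>M. \<lambda>u\<in>carrier M. u),
    HMod = (\<lambda>M N. \<lparr>
      carrier = {f \<in> extensional (carrier M). linear_map K M N f},
      mult = undefined, one = undefined,
      zero = (\<lambda>u\<in>carrier M. \<zero>\<^bsub>N\<^esub>),
      add = (\<lambda>f g. \<lambda>u\<in>carrier M. f u \<oplus>\<^bsub>N\<^esub> g u),
      smult = (\<lambda>a f. \<lambda>u\<in>carrier M. a \<odot>\<^bsub>N\<^esub> f u)\<rparr>)\<rparr>"

definition functor_cat ::
  "('k, 'r) ring_scheme \<Rightarrow> ('k, 'o, 'a) lcat \<Rightarrow> ('k, 'p, 'b) lcat \<Rightarrow>
   ('k, ('o, 'a, 'p, 'b) fnctr, 'o \<Rightarrow> 'b) lcat"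
  where "functor_cat K C D = \<lparr>
    Ob = {F. linear_functor K C D F},
    Hom = (\<lambda>F G. {t \<in> extensional (Ob C). nat_trans C D F G t}),
    Cmp = (\<lambda>F G H s t. \<lambda>x\<in>Ob C. Cmp D (OMap F x) (OMap G x) (OMap H x) (s x) (t x)),
    Idn = (\<lambda>F. \<lambda>x\<in>Ob C. Idn D (OMap F x)),
    HMod = (\<lambda>F G. \<lparr>
      carrier = {t \<in> extensional (Ob C). nat_trans C D F G t},
      mult = undefined, one = undefined,
      zero = (\<lambda>x\<in>Ob C. zero_arr D (OMap F x) (OMap G x)),
      add = (\<lambda>s t. \<lambda>x\<in>Ob C. s x \<oplus>\<^bsub>HMod D (OMap F x) (OMap G x)\<^esub> t x),
      smult = (\<lambda>a t. \<lambda>x\<in>Ob C. a \<odot>\<^bsub>HMod D (OMap F x) (OMap G x)\<^esub> t x)\<rparr>)\<rparr>"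

type_synonym ('k, 'u) presheaf = "('u, 'u, ('k, 'u) module, 'u \<Rightarrow> 'u) fnctr"

definition Psh ::
  "('k, 'r) ring_scheme \<Rightarrow> ('k, 'u, 'u) lcat \<Rightarrow> ('k, ('k, 'u) presheaf, 'u \<Rightarrow> 'u \<Rightarrow> 'u) lcat"
  where "Psh K X = functor_cat K (opcat X) (kMod K)"

text \<open>On arrows, \<open>X(-,x)\<close> sends \<open>f : z \<rightarrow> y\<close> of \<open>X\<close>, an arrow from \<open>y\<close> to \<open>z\<close> of the opposite
  category, to precomposition with \<open>f\<close>.\<close>

definition representable :: "('k, 'u, 'u) lcat \<Rightarrow> 'u \<Rightarrow> ('k, 'u) presheaf"
  where "representable X x = \<lparr>
    OMap = (\<lambda>y. HMod X y x),
    AMap = (\<lambda>y z f. \<lambda>g\<in>Hom X y x. Cmp X z y x g f)\<rparr>"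

definition yoneda :: "('k, 'u, 'u) lcat \<Rightarrow> ('u, 'u, ('k, 'u) presheaf, 'u \<Rightarrow> 'u \<Rightarrow> 'u) fnctr"
  where "yoneda X = \<lparr>
    OMap = representable X,
    AMap = (\<lambda>x x' f. \<lambda>y\<in>Ob X. \<lambda>g\<in>Hom X y x. Cmp X y x x' f g)\<rparr>"

definition is_cocone ::
  "('i, 'j, 'y) cat_scheme \<Rightarrow> ('o, 'a, 'z) cat_scheme \<Rightarrow> ('i, 'j, 'o, 'a) fnctr \<Rightarrow>
   'o \<Rightarrow> ('i \<Rightarrow> 'a) \<Rightarrow> bool"
  where "is_cocone J C D c t \<longleftrightarrow> c \<in> Ob C \<and>
    (\<forall>i\<in>Ob J. t i \<in> Hom C (OMap D i) c) \<and>
    (\<forall>i\<in>Ob J. \<forall>j\<in>Ob J. \<forall>f\<in>Hom J i j.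
      Cmp C (OMap D i) (OMap D j) c (t j) (AMap D i j f) = t i)"

definition is_colimit ::
  "('i, 'j, 'y) cat_scheme \<Rightarrow> ('o, 'a, 'z) cat_scheme \<Rightarrow> ('i, 'j, 'o, 'a) fnctr \<Rightarrow>
   'o \<Rightarrow> ('i \<Rightarrow> 'a) \<Rightarrow> bool"
  where "is_colimit J C D c t \<longleftrightarrow> is_cocone J C D c t \<and>
    (\<forall>c' t'. is_cocone J C D c' t' \<longrightarrow>
      (\<exists>!u. u \<in> Hom C c c' \<and> (\<forall>i\<in>Ob J. Cmp C (OMap D i) c c' u (t i) = t' i)))"

definition finite_category :: "('i, 'j, 'y) cat_scheme \<Rightarrow> bool"
  where "finite_category J \<longleftrightarrow> category J \<and> finite (Ob J) \<and>
    (\<forall>i\<in>Ob J. \<forall>j\<in>Ob J. finite (Hom J i j))"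

text \<open>Every finite category is isomorphic to one whose objects and arrows are natural numbers.\<close>

definition closed_finite_colimits :: "('k, 'o, 'a) lcat \<Rightarrow> 'o set \<Rightarrow> bool"
  where "closed_finite_colimits C S \<longleftrightarrow>
    (\<forall>(J :: (nat, nat) cat) D c t. finite_category J \<longrightarrow> is_functor J (full_subcat C S) D \<longrightarrow>
      is_colimit J C D c t \<longrightarrow> c \<in> S)"

definition closed_iso :: "('k, 'o, 'a) lcat \<Rightarrow> 'o set \<Rightarrow> bool"
  where "closed_iso C S \<longleftrightarrow> (\<forall>x\<in>S. \<forall>y\<in>Ob C. isomorphic C x y \<longrightarrow> y \<in> S)"

definition Fin ::
  "('k, 'r) ring_scheme \<Rightarrow> ('k, 'u, 'u) lcat \<Rightarrow> ('k, ('k, 'u) presheaf, 'u \<Rightarrow> 'u \<Rightarrow> 'u) lcat"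
  where "Fin K X = full_subcat (Psh K X) (\<Inter>{S. S \<subseteq> Ob (Psh K X) \<and> closed_iso (Psh K X) S \<and>
    representable X ` Ob X \<subseteq> S \<and> closed_finite_colimits (Psh K X) S})"

section \<open>Coproducts of division algebras\<close>

definition is_algebra :: "('k, 'r) ring_scheme \<Rightarrow> ('k, 'o, 'a) lcat \<Rightarrow> bool"
  where "is_algebra K D \<longleftrightarrow> k_linear_category K D \<and> (\<exists>x. Ob D = {x})"

definition end_ring :: "('k, 'o, 'a) lcat \<Rightarrow> 'o \<Rightarrow> 'a ring"
  where "end_ring C x = \<lparr>carrier = Hom C x x, mult = Cmp C x x x, one = Idn C x,
    zero = zero_arr C x x, add = add (HMod C x x)\<rparr>"

definition division_ring :: "('a, 'r) ring_scheme \<Rightarrow> bool"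
  where "division_ring R \<longleftrightarrow> ring R \<and> \<one>\<^bsub>R\<^esub> \<noteq> \<zero>\<^bsub>R\<^esub> \<and> Units R = carrier R - {\<zero>\<^bsub>R\<^esub>}"

definition is_division_algebra :: "('k, 'r) ring_scheme \<Rightarrow> ('k, 'o, 'a) lcat \<Rightarrow> bool"
  where "is_division_algebra K D \<longleftrightarrow> is_algebra K D \<and> (\<forall>x\<in>Ob D. division_ring (end_ring D x))"

text \<open>Coproducts in the category of small \<open>k\<close>-linear categories and \<open>k\<close>-linear functors.\<close>

definition is_coproduct ::
  "('k, 'r) ring_scheme \<Rightarrow> 'u set \<Rightarrow> ('u \<Rightarrow> ('k, 'u, 'u) lcat) \<Rightarrow>
   ('k, 'u, 'u) lcat \<Rightarrow> ('u \<Rightarrow> ('u, 'u, 'u, 'u) fnctr) \<Rightarrow> bool"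
  where "is_coproduct K I D X \<iota> \<longleftrightarrow>
    (\<forall>i\<in>I. k_linear_category K (D i)) \<and> k_linear_category K X \<and>
    (\<forall>i\<in>I. linear_functor K (D i) X (\<iota> i)) \<and>
    (\<forall>(Y :: ('k, 'u, 'u) lcat) G.
      k_linear_category K Y \<and> (\<forall>i\<in>I. linear_functor K (D i) Y (G i)) \<longrightarrow>
      (\<exists>H. linear_functor K X Y H \<and> (\<forall>i\<in>I. functor_eq (D i) (comp_functor H (\<iota> i)) (G i)) \<and>
        (\<forall>H'. linear_functor K X Y H' \<and> (\<forall>i\<in>I. functor_eq (D i) (comp_functor H' (\<iota> i)) (G i))
          \<longrightarrow> functor_eq X H' H)))"

definition coproduct_of_division_algebras ::
  "('k, 'r) ring_scheme \<Rightarrow> ('k, 'u, 'u) lcat \<Rightarrow> bool"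
  where "coproduct_of_division_algebras K X \<longleftrightarrow>
    (\<exists>I D \<iota>. (\<forall>i\<in>I. is_division_algebra K (D i)) \<and> is_coproduct K I D X \<iota>)"

section \<open>Semisimple abelian categories\<close>

definition is_zero_obj :: "('o, 'a, 'z) cat_scheme \<Rightarrow> 'o \<Rightarrow> bool"
  where "is_zero_obj C z \<longleftrightarrow> z \<in> Ob C \<and>
    (\<forall>x\<in>Ob C. (\<exists>!f. f \<in> Hom C z x) \<and> (\<exists>!f. f \<in> Hom C x z))"

definition is_mono :: "('k, 'o, 'a) lcat \<Rightarrow> 'o \<Rightarrow> 'o \<Rightarrow> 'a \<Rightarrow> bool"
  where "is_mono C x y f \<longleftrightarrow> f \<in> Hom C x y \<and>
    (\<forall>w\<in>Ob C. \<forall>g\<in>Hom C w x. \<forall>h\<in>Hom C w x. Cmp C w x y f g = Cmp C w x y f h \<longrightarrow> g = h)"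

definition is_epi :: "('k, 'o, 'a) lcat \<Rightarrow> 'o \<Rightarrow> 'o \<Rightarrow> 'a \<Rightarrow> bool"
  where "is_epi C x y f \<longleftrightarrow> is_mono (opcat C) y x f"

text \<open>\<open>k : z \<rightarrow> x\<close> is a kernel of \<open>f : x \<rightarrow> y\<close>; dually, \<open>q : y \<rightarrow> z\<close> is a cokernel of \<open>f : x \<rightarrow> y\<close>.\<close>

definition is_kernel :: "('k, 'o, 'a) lcat \<Rightarrow> 'o \<Rightarrow> 'o \<Rightarrow> 'a \<Rightarrow> 'o \<Rightarrow> 'a \<Rightarrow> bool"
  where "is_kernel C x y f z k \<longleftrightarrow>
    z \<in> Ob C \<and> k \<in> Hom C z x \<and> Cmp C z x y f k = zero_arr C z y \<and>
    (\<forall>w\<in>Ob C. \<forall>h\<in>Hom C w x. Cmp C w x y f h = zero_arr C w y \<longrightarrow>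
      (\<exists>!u. u \<in> Hom C w z \<and> Cmp C w z x k u = h))"

definition is_cokernel :: "('k, 'o, 'a) lcat \<Rightarrow> 'o \<Rightarrow> 'o \<Rightarrow> 'a \<Rightarrow> 'o \<Rightarrow> 'a \<Rightarrow> bool"
  where "is_cokernel C x y f z q \<longleftrightarrow> is_kernel (opcat C) y x f z q"

text \<open>Biproduct of \<open>s 0, \<dots>, s (n - 1)\<close>; for \<open>n = 0\<close> it is a zero object.\<close>

definition is_direct_sum :: "('k, 'o, 'a) lcat \<Rightarrow> nat \<Rightarrow> (nat \<Rightarrow> 'o) \<Rightarrow> 'o \<Rightarrow> bool"
  where "is_direct_sum C n s x \<longleftrightarrow> x \<in> Ob C \<and>
    (\<exists>\<iota> \<pi>. (\<forall>i<n. \<iota> i \<in> Hom C (s i) x \<and> \<pi> i \<in> Hom C x (s i)) \<and>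
      (\<forall>i<n. \<forall>j<n. Cmp C (s i) x (s j) (\<pi> j) (\<iota> i) =
        (if i = j then Idn C (s i) else zero_arr C (s i) (s j))) \<and>
      (\<Oplus>\<^bsub>HMod C x x\<^esub>i\<in>{..<n}. Cmp C x (s i) x (\<iota> i) (\<pi> i)) = Idn C x)"

definition abelian_category :: "('k, 'r) ring_scheme \<Rightarrow> ('k, 'o, 'a) lcat \<Rightarrow> bool"
  where "abelian_category K C \<longleftrightarrow> k_linear_category K C \<and>
    (\<exists>z. is_zero_obj C z) \<and>
    (\<forall>n s. (\<forall>i<n. s i \<in> Ob C) \<longrightarrow> (\<exists>x. is_direct_sum C n s x)) \<and>
    (\<forall>x\<in>Ob C. \<forall>y\<in>Ob C. \<forall>f\<in>Hom C x y.
      (\<exists>z k. is_kernel C x y f z k) \<and> (\<exists>z q. is_cokernel C x y f z q)) \<and>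
    (\<forall>x\<in>Ob C. \<forall>y\<in>Ob C. \<forall>f. is_mono C x y f \<longrightarrow> (\<exists>z\<in>Ob C. \<exists>g\<in>Hom C y z. is_kernel C y z g x f)) \<and>
    (\<forall>x\<in>Ob C. \<forall>y\<in>Ob C. \<forall>f. is_epi C x y f \<longrightarrow> (\<exists>z\<in>Ob C. \<exists>g\<in>Hom C z x. is_cokernel C z x g y f))"

definition is_simple :: "('k, 'o, 'a) lcat \<Rightarrow> 'o \<Rightarrow> bool"
  where "is_simple C x \<longleftrightarrow> x \<in> Ob C \<and> \<not> is_zero_obj C x \<and>
    (\<forall>y\<in>Ob C. \<forall>m. is_mono C y x m \<longrightarrow> is_zero_obj C y \<or> is_iso C y x m)"

text \<open>Existence of a composition series.\<close>

definition has_finite_length :: "('k, 'o, 'a) lcat \<Rightarrow> 'o \<Rightarrow> bool"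
  where "has_finite_length C x \<longleftrightarrow>
    (\<exists>n c m. (\<forall>i\<le>n. c i \<in> Ob C) \<and> is_zero_obj C (c 0) \<and> c n = x \<and>
      (\<forall>i<n. is_mono C (c i) (c (Suc i)) (m i) \<and>
        (\<exists>z q. is_cokernel C (c i) (c (Suc i)) (m i) z q \<and> is_simple C z)))"

definition semisimple_abelian_finite_length :: "('k, 'r) ring_scheme \<Rightarrow> ('k, 'o, 'a) lcat \<Rightarrow> bool"
  where "semisimple_abelian_finite_length K C \<longleftrightarrow> abelian_category K C \<and>
    (\<forall>x\<in>Ob C. has_finite_length C x) \<and>
    (\<forall>x\<in>Ob C. \<exists>n s. (\<forall>i<n. is_simple C (s i)) \<and> is_direct_sum C n s x)"

definition simples :: "('k, 'o, 'a) lcat \<Rightarrow> ('k, 'o, 'a) lcat"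
  where "simples C = full_subcat C {x. is_simple C x}"

end

theory Submission
  imports Defs
begin

text \<open>
  Both sides of the equivalence are compared with a structure that mentions neither kernels nor
  presheaves. In a linear category with a zero object and binary biproducts, a \<^emph>\<open>simple system\<close> is a
  set of objects with nonzero identities such that every nonzero map between two members is an
  isomorphism from a member to itself, and such that every object is a finite biproduct of members.

  A semisimple abelian category has a simple system, namely a skeleton of its simple objects, by
  Schur's lemma (\<open>semisimple_simple_system\<close>). Conversely, given a simple system, Gaussian
  elimination with one simple summand at a time factors every map into a split epimorphism followed
  by a split monomorphism (\<open>fsums_split_factor\<close>). Hence kernels and cokernels are images of
  idempotents, every monomorphism is a kernel and every epimorphism a cokernel, and the category is
  semisimple abelian of finite length (\<open>simple_system_semisimple\<close>). The members of the simple
  system then represent every isomorphism class of simple objects exactly once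
  (\<open>simple_system_skeleton\<close>).

  A simple system determines its category: a linear functor that is fully faithful on the simple
  system, and whose values there generate the target under finite biproducts, is an equivalence
  (\<open>equivalence_of_ff_on_simples\<close>). By the Yoneda lemma this applies to the functor that sends an
  object to the presheaf it represents on the simple system, so a small category with a simple
  system \<open>X\<close> is equivalent to the category of finite biproducts of representable presheaves on \<open>X\<close>.
  This category is \<open>Fin X\<close>. Finite biproducts are finite colimits, so only closure under finite
  colimits is at issue. A finite colimit is a cokernel of a map between finite biproducts. Such a
  cokernel is split, so that its universal property is a consequence of equations; it therefore has
  the universal property among all presheaves, and the colimit is again a finite biproduct
  (\<open>fsums_closed_finite_colimits\<close>).

  Finally, the coproducts of division algebras are the small linear categories in which the set of
  all objects satisfies the conditions on maps between members of a simple system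
  (\<open>coproduct_of_division_algebras_iff\<close>), because a disjoint union of algebras has the universal
  property of the coproduct.
\<close>

section \<open>Composition and addition of arrows\<close>

context k_linear_category
begin

lemma hmod_group: "\<lbrakk>x \<in> Ob C; y \<in> Ob C\<rbrakk> \<Longrightarrow> abelian_group (HMod C x y)"
  using HMod_module module.axioms by blast

declare Idn_in_Hom [simp] Cmp_in_Hom [simp] Cmp_Idn_left [simp] Cmp_Idn_right [simp]

lemma hom_group_facts:
  assumes "x \<in> Ob C" "y \<in> Ob C"
  shows zero_in_Hom [simp]: "zero_arr C x y \<in> Hom C x y"
    and add_in_Hom [simp]: "\<And>f g. \<lbrakk>f \<in> Hom C x y; g \<in> Hom C x y\<rbrakk> \<Longrightarrow> f \<oplus>\<^bsub>HMod C x y\<^esub> g \<in> Hom C x y"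
    and neg_in_Hom [simp]: "\<And>f. f \<in> Hom C x y \<Longrightarrow> \<ominus>\<^bsub>HMod C x y\<^esub> f \<in> Hom C x y"
    and add_zero_left [simp]: "\<And>f. f \<in> Hom C x y \<Longrightarrow> zero_arr C x y \<oplus>\<^bsub>HMod C x y\<^esub> f = f"
    and add_zero_right [simp]: "\<And>f. f \<in> Hom C x y \<Longrightarrow> f \<oplus>\<^bsub>HMod C x y\<^esub> zero_arr C x y = f"
    and add_neg_left [simp]: "\<And>f. f \<in> Hom C x y \<Longrightarrow> (\<ominus>\<^bsub>HMod C x y\<^esub> f) \<oplus>\<^bsub>HMod C x y\<^esub> f = zero_arr C x y"
    and add_neg_right [simp]: "\<And>f. f \<in> Hom C x y \<Longrightarrow> f \<oplus>\<^bsub>HMod C x y\<^esub> (\<ominus>\<^bsub>HMod C x y\<^esub> f) = zero_arr C x y"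
    and neg_neg [simp]: "\<And>f. f \<in> Hom C x y \<Longrightarrow> \<ominus>\<^bsub>HMod C x y\<^esub> (\<ominus>\<^bsub>HMod C x y\<^esub> f) = f"
    and add_neg_cancel1 [simp]: "\<And>f g. \<lbrakk>f \<in> Hom C x y; g \<in> Hom C x y\<rbrakk>
      \<Longrightarrow> f \<oplus>\<^bsub>HMod C x y\<^esub> ((\<ominus>\<^bsub>HMod C x y\<^esub> f) \<oplus>\<^bsub>HMod C x y\<^esub> g) = g"
    and add_neg_cancel2 [simp]: "\<And>f g. \<lbrakk>f \<in> Hom C x y; g \<in> Hom C x y\<rbrakk>
      \<Longrightarrow> (\<ominus>\<^bsub>HMod C x y\<^esub> f) \<oplus>\<^bsub>HMod C x y\<^esub> (f \<oplus>\<^bsub>HMod C x y\<^esub> g) = g"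
  using hmod_group[OF assms] abelian_group.axioms(1)[OF hmod_group[OF assms]]
    carrier_HMod[OF assms, symmetric]
  by (simp_all add: abelian_monoid.zero_closed abelian_monoid.a_closed abelian_group.a_inv_closed
      abelian_monoid.l_zero abelian_monoid.r_zero abelian_group.l_neg abelian_group.r_neg
      abelian_group.minus_minus abelian_group.r_neg1 abelian_group.r_neg2)

lemma neg_zero [simp]:
  assumes "x \<in> Ob C" "y \<in> Ob C"
  shows "\<ominus>\<^bsub>HMod C x y\<^esub> zero_arr C x y = zero_arr C x y"
  using assms add_zero_left[of x y "\<ominus>\<^bsub>HMod C x y\<^esub> zero_arr C x y"] by simp

lemma hom_add_facts:
  assumes "x \<in> Ob C" "y \<in> Ob C"
  shows add_comm: "\<And>f g. \<lbrakk>f \<in> Hom C x y; g \<in> Hom C x y\<rbrakk>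
      \<Longrightarrow> f \<oplus>\<^bsub>HMod C x y\<^esub> g = g \<oplus>\<^bsub>HMod C x y\<^esub> f"
    and add_assoc: "\<And>f g h. \<lbrakk>f \<in> Hom C x y; g \<in> Hom C x y; h \<in> Hom C x y\<rbrakk>
      \<Longrightarrow> (f \<oplus>\<^bsub>HMod C x y\<^esub> g) \<oplus>\<^bsub>HMod C x y\<^esub> h = f \<oplus>\<^bsub>HMod C x y\<^esub> (g \<oplus>\<^bsub>HMod C x y\<^esub> h)"
    and add_lcomm: "\<And>f g h. \<lbrakk>f \<in> Hom C x y; g \<in> Hom C x y; h \<in> Hom C x y\<rbrakk>
      \<Longrightarrow> f \<oplus>\<^bsub>HMod C x y\<^esub> (g \<oplus>\<^bsub>HMod C x y\<^esub> h) = g \<oplus>\<^bsub>HMod C x y\<^esub> (f \<oplus>\<^bsub>HMod C x y\<^esub> h)"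
  using abelian_group.axioms(1)[OF hmod_group[OF assms]] carrier_HMod[OF assms, symmetric]
  by (simp_all add: abelian_monoid.a_ac)

lemmas add_ac = add_comm add_assoc add_lcomm

lemma add_eq_zero_iff:
  assumes "x \<in> Ob C" "y \<in> Ob C" "f \<in> Hom C x y" "g \<in> Hom C x y"
  shows "f \<oplus>\<^bsub>HMod C x y\<^esub> (\<ominus>\<^bsub>HMod C x y\<^esub> g) = zero_arr C x y \<longleftrightarrow> f = g"
  using assms add_assoc[of x y f "\<ominus>\<^bsub>HMod C x y\<^esub> g" g] by auto

lemma add_cancel_self:
  assumes "x \<in> Ob C" "y \<in> Ob C" "f \<in> Hom C x y" "g \<in> Hom C x y"
  shows "f \<oplus>\<^bsub>HMod C x y\<^esub> g = f \<longleftrightarrow> g = zero_arr C x y"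
  using assms add_neg_cancel2[of x y f g] add_neg_left[of x y f] by (metis add_zero_right)

lemma Cmp_add_left [simp]:
  "\<lbrakk>x \<in> Ob C; y \<in> Ob C; z \<in> Ob C; f \<in> Hom C x y; g \<in> Hom C y z; h \<in> Hom C y z\<rbrakk>
    \<Longrightarrow> Cmp C x y z (g \<oplus>\<^bsub>HMod C y z\<^esub> h) f = Cmp C x y z g f \<oplus>\<^bsub>HMod C x z\<^esub> Cmp C x y z h f"
  using Cmp_linear_left[of x y z f] by (auto simp: linear_map_def carrier_HMod)

lemma Cmp_add_right [simp]:
  "\<lbrakk>x \<in> Ob C; y \<in> Ob C; z \<in> Ob C; g \<in> Hom C y z; f \<in> Hom C x y; h \<in> Hom C x y\<rbrakk>
    \<Longrightarrow> Cmp C x y z g (f \<oplus>\<^bsub>HMod C x y\<^esub> h) = Cmp C x y z g f \<oplus>\<^bsub>HMod C x z\<^esub> Cmp C x y z g h"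
  using Cmp_linear_right[of x y z g] by (auto simp: linear_map_def carrier_HMod)

lemma Cmp_smult_left:
  "\<lbrakk>x \<in> Ob C; y \<in> Ob C; z \<in> Ob C; f \<in> Hom C x y; g \<in> Hom C y z; a \<in> carrier K\<rbrakk>
    \<Longrightarrow> Cmp C x y z (a \<odot>\<^bsub>HMod C y z\<^esub> g) f = a \<odot>\<^bsub>HMod C x z\<^esub> Cmp C x y z g f"
  using Cmp_linear_left[of x y z f] by (auto simp: linear_map_def carrier_HMod)

lemma Cmp_smult_right:
  "\<lbrakk>x \<in> Ob C; y \<in> Ob C; z \<in> Ob C; f \<in> Hom C x y; g \<in> Hom C y z; a \<in> carrier K\<rbrakk>
    \<Longrightarrow> Cmp C x y z g (a \<odot>\<^bsub>HMod C x y\<^esub> f) = a \<odot>\<^bsub>HMod C x z\<^esub> Cmp C x y z g f"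
  using Cmp_linear_right[of x y z g] by (auto simp: linear_map_def carrier_HMod)

lemma smult_in_Hom [simp]:
  "\<lbrakk>x \<in> Ob C; y \<in> Ob C; f \<in> Hom C x y; a \<in> carrier K\<rbrakk> \<Longrightarrow> a \<odot>\<^bsub>HMod C x y\<^esub> f \<in> Hom C x y"
  using module.smult_closed[OF HMod_module[of x y]] by (simp add: carrier_HMod)

lemma Cmp_zero_left [simp]:
  assumes "x \<in> Ob C" "y \<in> Ob C" "z \<in> Ob C" "f \<in> Hom C x y"
  shows "Cmp C x y z (zero_arr C y z) f = zero_arr C x z"
proof -
  have "Cmp C x y z (zero_arr C y z) f \<oplus>\<^bsub>HMod C x z\<^esub> Cmp C x y z (zero_arr C y z) f
      = Cmp C x y z (zero_arr C y z) f"
    using assms by (simp flip: Cmp_add_left)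
  then show ?thesis using assms by (simp add: add_cancel_self)
qed

lemma Cmp_zero_right [simp]:
  assumes "x \<in> Ob C" "y \<in> Ob C" "z \<in> Ob C" "g \<in> Hom C y z"
  shows "Cmp C x y z g (zero_arr C x y) = zero_arr C x z"
proof -
  have "Cmp C x y z g (zero_arr C x y) \<oplus>\<^bsub>HMod C x z\<^esub> Cmp C x y z g (zero_arr C x y)
      = Cmp C x y z g (zero_arr C x y)"
    using assms by (simp flip: Cmp_add_right)
  then show ?thesis using assms by (simp add: add_cancel_self)
qed

lemma neg_unique:
  assumes "x \<in> Ob C" "y \<in> Ob C" "f \<in> Hom C x y" "g \<in> Hom C x y"
    and "f \<oplus>\<^bsub>HMod C x y\<^esub> g = zero_arr C x y"
  shows "g = \<ominus>\<^bsub>HMod C x y\<^esub> f"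
  using add_neg_cancel2[of x y f g] assms by simp

lemma Cmp_neg_left [simp]:
  assumes "x \<in> Ob C" "y \<in> Ob C" "z \<in> Ob C" "f \<in> Hom C x y" "g \<in> Hom C y z"
  shows "Cmp C x y z (\<ominus>\<^bsub>HMod C y z\<^esub> g) f = \<ominus>\<^bsub>HMod C x z\<^esub> Cmp C x y z g f"
  using assms by (intro neg_unique) (simp_all flip: Cmp_add_left)

lemma Cmp_neg_right [simp]:
  assumes "x \<in> Ob C" "y \<in> Ob C" "z \<in> Ob C" "f \<in> Hom C x y" "g \<in> Hom C y z"
  shows "Cmp C x y z g (\<ominus>\<^bsub>HMod C x y\<^esub> f) = \<ominus>\<^bsub>HMod C x z\<^esub> Cmp C x y z g f"
  using assms by (intro neg_unique) (simp_all flip: Cmp_add_right)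

lemmas Cmp_assoc' = Cmp_assoc[symmetric]

text \<open>
  Calculations keep composites nested to the right. In this form a relation between two arrows
  rewrites them also at the front of a longer composite.
\<close>

lemma Cmp_reassoc:
  assumes "Cmp C x y z g f = h" "w \<in> Ob C" "x \<in> Ob C" "y \<in> Ob C" "z \<in> Ob C"
    "k \<in> Hom C w x" "f \<in> Hom C x y" "g \<in> Hom C y z"
  shows "Cmp C w y z g (Cmp C w x y f k) = Cmp C w x z h k"
  using assms Cmp_assoc by simp

end

lemma full_subcat_simps [simp]:
  "Ob (full_subcat C S) = S" "Hom (full_subcat C S) = Hom C" "Cmp (full_subcat C S) = Cmp C"
  "Idn (full_subcat C S) = Idn C" "HMod (full_subcat C S) = HMod C"
  by (simp_all add: full_subcat_def)

lemma opcat_simps [simp]: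
  "Ob (opcat C) = Ob C" "Hom (opcat C) x y = Hom C y x"
  "Cmp (opcat C) x y z g f = Cmp C z y x f g"
  "Idn (opcat C) = Idn C" "HMod (opcat C) x y = HMod C y x"
  by (simp_all add: opcat_def)

lemma (in k_linear_category) k_linear_full_subcat:
  assumes "S \<subseteq> Ob C"
  shows "k_linear_category K (full_subcat C S)"
proof -
  have S: "x \<in> S \<Longrightarrow> x \<in> Ob C" for x using assms by blast
  show ?thesis
    apply (intro k_linear_category.intro k_linear_category_axioms.intro category.intro K.is_cring)
    subgoal by (simp add: S)
    subgoal by (simp add: S)
    subgoal by (simp add: S)
    subgoal by (simp add: S)
    subgoal by (simp add: S Cmp_assoc)
    subgoal by (simp add: S HMod_module)
    subgoal by (simp add: S carrier_HMod)
    subgoal using Cmp_linear_left by (simp add: S)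
    subgoal using Cmp_linear_right by (simp add: S)
    done
qed

lemma (in k_linear_category) k_linear_opcat: "k_linear_category K (opcat C)"
    apply (intro k_linear_category.intro k_linear_category_axioms.intro category.intro K.is_cring)
    subgoal by simp
    subgoal by simp
    subgoal by simp
    subgoal by simp
    subgoal by (simp add: Cmp_assoc)
    subgoal by (simp add: HMod_module)
    subgoal by (simp add: carrier_HMod)
    subgoal using Cmp_linear_right by simp
    subgoal using Cmp_linear_left by simp
    done

lemma full_subcat_Ob [simp]: "full_subcat C (Ob C) = (C :: ('k, 'o, 'a) lcat)"
  by (simp add: full_subcat_def)

section \<open>Biproducts and finite sums of a family of objects\<close>

text \<open>
  Zero objects in equational form: the equation passes to full subcategories and is preserved by
  linear functors.
\<close>

definition null_obj :: "('k, 'o, 'a) lcat \<Rightarrow> 'o \<Rightarrow> bool"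
  where "null_obj C z \<longleftrightarrow> z \<in> Ob C \<and> Idn C z = zero_arr C z z"

text \<open>
  Biproducts are described by equations, and not by a universal property, because equations are
  preserved by linear functors and survive the passage to a larger category.
\<close>

locale biprod_maps = k_linear_category K C
  for K :: "('k, 'r) ring_scheme" and C :: "('k, 'o, 'a) lcat" +
  fixes a b y j1 j2 q1 q2
  assumes obs [simp]: "a \<in> Ob C" "b \<in> Ob C" "y \<in> Ob C"
    and maps [simp]: "j1 \<in> Hom C a y" "j2 \<in> Hom C b y" "q1 \<in> Hom C y a" "q2 \<in> Hom C y b"
    and retract [simp]: "Cmp C a y a q1 j1 = Idn C a" "Cmp C b y b q2 j2 = Idn C b"
    and orth [simp]: "Cmp C a y b q2 j1 = zero_arr C a b" "Cmp C b y a q1 j2 = zero_arr C b a"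
    and sum_Idn [simp]: "Cmp C y a y j1 q1 \<oplus>\<^bsub>HMod C y y\<^esub> Cmp C y b y j2 q2 = Idn C y"
begin

lemma retract' [simp]:
  "\<lbrakk>w \<in> Ob C; k \<in> Hom C w a\<rbrakk> \<Longrightarrow> Cmp C w y a q1 (Cmp C w a y j1 k) = k"
  "\<lbrakk>w \<in> Ob C; k \<in> Hom C w b\<rbrakk> \<Longrightarrow> Cmp C w y b q2 (Cmp C w b y j2 k) = k"
  "\<lbrakk>w \<in> Ob C; k \<in> Hom C w a\<rbrakk> \<Longrightarrow> Cmp C w y b q2 (Cmp C w a y j1 k) = zero_arr C w b"
  "\<lbrakk>w \<in> Ob C; k \<in> Hom C w b\<rbrakk> \<Longrightarrow> Cmp C w y a q1 (Cmp C w b y j2 k) = zero_arr C w a"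
  by (simp_all add: Cmp_assoc)

lemma split_source:
  assumes "w \<in> Ob C" "f \<in> Hom C y w"
  shows "Cmp C y a w (Cmp C a y w f j1) q1 \<oplus>\<^bsub>HMod C y w\<^esub> Cmp C y b w (Cmp C b y w f j2) q2 = f"
proof -
  have "Cmp C y y w f (Cmp C y a y j1 q1 \<oplus>\<^bsub>HMod C y y\<^esub> Cmp C y b y j2 q2) = f"
    using assms by (simp del: Cmp_add_right)
  then show ?thesis using assms by (simp del: sum_Idn add: Cmp_assoc)
qed

lemma split_target:
  assumes "w \<in> Ob C" "f \<in> Hom C w y"
  shows "Cmp C w a y j1 (Cmp C w y a q1 f) \<oplus>\<^bsub>HMod C w y\<^esub> Cmp C w b y j2 (Cmp C w y b q2 f) = f"
proof -
  have "Cmp C w y y (Cmp C y a y j1 q1 \<oplus>\<^bsub>HMod C y y\<^esub> Cmp C y b y j2 q2) f = f"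
    using assms by (simp del: Cmp_add_left)
  then show ?thesis using assms by (simp del: sum_Idn add: Cmp_assoc')
qed

end

definition is_biprod :: "('k, 'o, 'a) lcat \<Rightarrow> 'o \<Rightarrow> 'o \<Rightarrow> 'o \<Rightarrow> bool"
  where "is_biprod C a b y \<longleftrightarrow> a \<in> Ob C \<and> b \<in> Ob C \<and> y \<in> Ob C \<and>
    (\<exists>j1\<in>Hom C a y. \<exists>j2\<in>Hom C b y. \<exists>q1\<in>Hom C y a. \<exists>q2\<in>Hom C y b.
      Cmp C a y a q1 j1 = Idn C a \<and> Cmp C b y b q2 j2 = Idn C b \<and>
      Cmp C a y b q2 j1 = zero_arr C a b \<and> Cmp C b y a q1 j2 = zero_arr C b a \<and>
      Cmp C y a y j1 q1 \<oplus>\<^bsub>HMod C y y\<^esub> Cmp C y b y j2 q2 = Idn C y)"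

text \<open>
  Finite direct sums of members of \<open>S\<close>, built by adding one summand at a time so that they admit
  induction.
\<close>

inductive_set fsums :: "('k, 'o, 'a) lcat \<Rightarrow> 'o set \<Rightarrow> 'o set" for C S where
  null: "null_obj C z \<Longrightarrow> z \<in> fsums C S"
| add: "\<lbrakk>x \<in> fsums C S; s \<in> S; is_biprod C x s y\<rbrakk> \<Longrightarrow> y \<in> fsums C S"

definition additive :: "('k, 'o, 'a) lcat \<Rightarrow> bool"
  where "additive C \<longleftrightarrow> (\<exists>z. null_obj C z) \<and> (\<forall>a\<in>Ob C. \<forall>b\<in>Ob C. \<exists>y. is_biprod C a b y)"

text \<open>
  The conclusion of Schur's lemma for pairwise nonisomorphic simple objects.
\<close>

definition schur_family :: "('k, 'o, 'a) lcat \<Rightarrow> 'o set \<Rightarrow> bool"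
  where "schur_family C S \<longleftrightarrow> S \<subseteq> Ob C \<and> (\<forall>s\<in>S. Idn C s \<noteq> zero_arr C s s) \<and>
    (\<forall>s\<in>S. \<forall>t\<in>S. \<forall>f\<in>Hom C s t. f \<noteq> zero_arr C s t \<longrightarrow> s = t \<and> is_iso C s t f)"

text \<open>
  The structure shared by semisimple abelian categories and the categories \<open>Fin X\<close>.
\<close>

definition simple_system :: "('k, 'o, 'a) lcat \<Rightarrow> 'o set \<Rightarrow> bool"
  where "simple_system C S \<longleftrightarrow> additive C \<and> schur_family C S \<and> Ob C \<subseteq> fsums C S"

lemma fsums_subset_Ob: "x \<in> fsums C S \<Longrightarrow> x \<in> Ob C"
  by (induction rule: fsums.induct) (auto simp: null_obj_def is_biprod_def)

context k_linear_category
begin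

lemma is_biprod_iff:
  "is_biprod C a b y \<longleftrightarrow> (\<exists>j1 j2 q1 q2. biprod_maps K C a b y j1 j2 q1 q2)"
  using k_linear_category_axioms
  by (auto simp: is_biprod_def biprod_maps_def biprod_maps_axioms_def)

lemma is_biprodI: "biprod_maps K C a b y j1 j2 q1 q2 \<Longrightarrow> is_biprod C a b y"
  unfolding is_biprod_iff by blast

lemma is_biprodE:
  assumes "is_biprod C a b y"
  obtains j1 j2 q1 q2 where "biprod_maps K C a b y j1 j2 q1 q2"
  using assms unfolding is_biprod_iff by blast

lemma biprod_mapsI:
  assumes "a \<in> Ob C" "b \<in> Ob C" "y \<in> Ob C"
    "j1 \<in> Hom C a y" "j2 \<in> Hom C b y" "q1 \<in> Hom C y a" "q2 \<in> Hom C y b"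
    "Cmp C a y a q1 j1 = Idn C a" "Cmp C b y b q2 j2 = Idn C b"
    "Cmp C a y b q2 j1 = zero_arr C a b" "Cmp C b y a q1 j2 = zero_arr C b a"
    "Cmp C y a y j1 q1 \<oplus>\<^bsub>HMod C y y\<^esub> Cmp C y b y j2 q2 = Idn C y"
  shows "biprod_maps K C a b y j1 j2 q1 q2"
  using assms k_linear_category_axioms by (simp add: biprod_maps_def biprod_maps_axioms_def)

lemma null_obj_into: "\<lbrakk>null_obj C z; x \<in> Ob C; f \<in> Hom C x z\<rbrakk> \<Longrightarrow> f = zero_arr C x z"
  by (metis Cmp_Idn_left Cmp_zero_left null_obj_def)

lemma null_obj_from: "\<lbrakk>null_obj C z; x \<in> Ob C; f \<in> Hom C z x\<rbrakk> \<Longrightarrow> f = zero_arr C z x"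
  by (metis Cmp_Idn_right Cmp_zero_right null_obj_def)

lemma null_obj_iff_zero: "null_obj C z \<longleftrightarrow> is_zero_obj C z"
proof
  assume z: "null_obj C z"
  then have zo: "z \<in> Ob C" by (simp add: null_obj_def)
  show "is_zero_obj C z"
    unfolding is_zero_obj_def
    using zo null_obj_into[OF z] null_obj_from[OF z] zero_in_Hom by blast
next
  assume "is_zero_obj C z"
  then show "null_obj C z"
    unfolding is_zero_obj_def null_obj_def using Idn_in_Hom zero_in_Hom by blast
qed

lemma isoI:
  assumes "f \<in> Hom C x y" "g \<in> Hom C y x" "Cmp C x y x g f = Idn C x" "Cmp C y x y f g = Idn C y"
  shows "is_iso C x y f"
  using assms by (auto simp: is_iso_def)

lemma isomorphicI:
  assumes "f \<in> Hom C x y" "g \<in> Hom C y x" "Cmp C x y x g f = Idn C x" "Cmp C y x y f g = Idn C y"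
  shows "isomorphic C x y"
  using assms by (auto simp: is_iso_def isomorphic_def)

lemma isomorphicE:
  assumes "isomorphic C x y"
  obtains f g where "f \<in> Hom C x y" "g \<in> Hom C y x" "Cmp C x y x g f = Idn C x"
    "Cmp C y x y f g = Idn C y"
  using assms by (auto simp: is_iso_def isomorphic_def)

lemma isomorphic_refl: "x \<in> Ob C \<Longrightarrow> isomorphic C x x"
  by (rule isomorphicI[of "Idn C x" _ _ "Idn C x"]) simp_all

lemma isomorphic_sym: "isomorphic C x y \<Longrightarrow> isomorphic C y x"
  by (auto simp: is_iso_def isomorphic_def)

lemma is_iso_Cmp:
  assumes "is_iso C x y f" "is_iso C y z g" "x \<in> Ob C" "y \<in> Ob C" "z \<in> Ob C"
  shows "is_iso C x z (Cmp C x y z g f)"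
proof -
  obtain f' where f: "f \<in> Hom C x y" "f' \<in> Hom C y x" "Cmp C x y x f' f = Idn C x"
    "Cmp C y x y f f' = Idn C y" using assms by (auto simp: is_iso_def)
  obtain g' where g: "g \<in> Hom C y z" "g' \<in> Hom C z y" "Cmp C y z y g' g = Idn C y"
    "Cmp C z y z g g' = Idn C z" using assms by (auto simp: is_iso_def)
  note r = Cmp_reassoc[OF f(3)] Cmp_reassoc[OF f(4)] Cmp_reassoc[OF g(3)] Cmp_reassoc[OF g(4)]
  show ?thesis
    by (rule isoI[of _ _ _ "Cmp C z y x f' g'"]) (use f g r assms in \<open>simp_all add: Cmp_assoc'\<close>)
qed

lemma isomorphic_trans:
  "\<lbrakk>isomorphic C x y; isomorphic C y z; x \<in> Ob C; y \<in> Ob C; z \<in> Ob C\<rbrakk> \<Longrightarrow> isomorphic C x z"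
  using is_iso_Cmp unfolding isomorphic_def by blast

lemma null_objs_isomorphic: "\<lbrakk>null_obj C x; null_obj C y\<rbrakk> \<Longrightarrow> isomorphic C x y"
  by (rule isomorphicI[of "zero_arr C x y" _ _ "zero_arr C y x"]) (simp_all add: null_obj_def)

lemma null_obj_iso:
  assumes "null_obj C x" "isomorphic C x y" "y \<in> Ob C"
  shows "null_obj C y"
proof -
  obtain f g where f: "f \<in> Hom C x y" "g \<in> Hom C y x" "Cmp C y x y f g = Idn C y"
    using assms(2) by (rule isomorphicE)
  moreover have "f = zero_arr C x y" using null_obj_from[OF assms(1,3) f(1)] .
  ultimately show ?thesis using assms by (auto simp: null_obj_def)
qed

lemma is_biprod_iso:
  assumes "is_biprod C a b y" "isomorphic C a a'" "isomorphic C b b'" "isomorphic C y y'"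
    and [simp]: "a' \<in> Ob C" "b' \<in> Ob C" "y' \<in> Ob C"
  shows "is_biprod C a' b' y'"
proof -
  obtain j1 j2 q1 q2 where "biprod_maps K C a b y j1 j2 q1 q2" using is_biprodE[OF assms(1)] .
  then interpret B: biprod_maps K C a b y j1 j2 q1 q2 .
  obtain f f' where f [simp]: "f \<in> Hom C a a'" "f' \<in> Hom C a' a" "Cmp C a a' a f' f = Idn C a"
    "Cmp C a' a a' f f' = Idn C a'" using assms(2) by (rule isomorphicE)
  obtain g g' where g [simp]: "g \<in> Hom C b b'" "g' \<in> Hom C b' b" "Cmp C b b' b g' g = Idn C b"
    "Cmp C b' b b' g g' = Idn C b'" using assms(3) by (rule isomorphicE)
  obtain h h' where h [simp]: "h \<in> Hom C y y'" "h' \<in> Hom C y' y" "Cmp C y y' y h' h = Idn C y"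
    "Cmp C y' y y' h h' = Idn C y'" using assms(4) by (rule isomorphicE)
  note r [simp] = Cmp_reassoc[OF f(3)] Cmp_reassoc[OF f(4)] Cmp_reassoc[OF g(3)] Cmp_reassoc[OF g(4)]
    Cmp_reassoc[OF h(3)] Cmp_reassoc[OF h(4)]
  have "Cmp C y' y y' h (Cmp C y' y y (Cmp C y a y j1 q1 \<oplus>\<^bsub>HMod C y y\<^esub> Cmp C y b y j2 q2) h') = Idn C y'"
    by (simp del: Cmp_add_left Cmp_add_right)
  then have s: "Cmp C y' y y' h (Cmp C y' a y j1 (Cmp C y' y a q1 h')) \<oplus>\<^bsub>HMod C y' y'\<^esub>
     Cmp C y' y y' h (Cmp C y' b y j2 (Cmp C y' y b q2 h')) = Idn C y'"
    by (simp del: B.sum_Idn add: Cmp_assoc')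
  show ?thesis
    by (rule is_biprodI[OF biprod_mapsI[of _ _ _ "Cmp C a' y y' h (Cmp C a' a y j1 f')"
      "Cmp C b' y y' h (Cmp C b' b y j2 g')" "Cmp C y' a a' f (Cmp C y' y a q1 h')"
      "Cmp C y' b b' g (Cmp C y' y b q2 h')"]]) (simp_all add: Cmp_assoc' s)
qed

lemma fsums_iso:
  assumes "x \<in> fsums C S" "isomorphic C x y" "y \<in> Ob C" "S \<subseteq> Ob C"
  shows "y \<in> fsums C S"
  using assms(1)
proof cases
  case null
  then show ?thesis by (intro fsums.null null_obj_iso[OF _ assms(2,3)])
next
  case (add x' s)
  then have "is_biprod C x' s y"
    using assms is_biprod_iso[OF add(3) isomorphic_refl isomorphic_refl assms(2)]
    by (auto simp: is_biprod_def)
  then show ?thesis using add fsums.add by metis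
qed

lemma fsums_cong_iso:
  assumes "is_biprod C x s y" "s \<in> Ob C" "t \<in> S" "isomorphic C s t" "x \<in> fsums C S" "S \<subseteq> Ob C"
  shows "y \<in> fsums C S"
proof -
  have "is_biprod C x t y"
    using assms by (intro is_biprod_iso[OF assms(1)] isomorphic_refl) (auto simp: is_biprod_def)
  then show ?thesis using assms fsums.add by metis
qed

lemma biprod_unique:
  assumes "is_biprod C a b y" "is_biprod C a b z"
  shows "isomorphic C y z"
proof -
  obtain j1 j2 q1 q2 where "biprod_maps K C a b y j1 j2 q1 q2" using is_biprodE[OF assms(1)] .
  then interpret B: biprod_maps K C a b y j1 j2 q1 q2 .
  obtain k1 k2 l1 l2 where "biprod_maps K C a b z k1 k2 l1 l2" using is_biprodE[OF assms(2)] .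
  then interpret D: biprod_maps K C a b z k1 k2 l1 l2 .
  show ?thesis
    by (rule isomorphicI[of "Cmp C y a z k1 q1 \<oplus>\<^bsub>HMod C y z\<^esub> Cmp C y b z k2 q2" _ _
      "Cmp C z a y j1 l1 \<oplus>\<^bsub>HMod C z y\<^esub> Cmp C z b y j2 l2"]) (simp_all add: Cmp_assoc')
qed

lemma is_biprod_assoc:
  assumes "is_biprod C y s u" "is_biprod C x u z" "is_biprod C x y w"
  shows "is_biprod C w s z"
proof -
  obtain j1 j2 q1 q2 where "biprod_maps K C y s u j1 j2 q1 q2" using is_biprodE[OF assms(1)] .
  then interpret B: biprod_maps K C y s u j1 j2 q1 q2 .
  obtain k1 k2 l1 l2 where "biprod_maps K C x u z k1 k2 l1 l2" using is_biprodE[OF assms(2)] .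
  then interpret D: biprod_maps K C x u z k1 k2 l1 l2 .
  obtain m1 m2 n1 n2 where "biprod_maps K C x y w m1 m2 n1 n2" using is_biprodE[OF assms(3)] .
  then interpret E: biprod_maps K C x y w m1 m2 n1 n2 .
  have "Cmp C z u z k2 (Cmp C z u u (Cmp C u y u j1 q1 \<oplus>\<^bsub>HMod C u u\<^esub> Cmp C u s u j2 q2) l2)
    = Cmp C z u z k2 l2"
    by (simp del: Cmp_add_left)
  then have e: "Cmp C z u z k2 (Cmp C z y u j1 (Cmp C z u y q1 l2)) \<oplus>\<^bsub>HMod C z z\<^esub>
      Cmp C z u z k2 (Cmp C z s u j2 (Cmp C z u s q2 l2)) = Cmp C z u z k2 l2"
    by (simp del: B.sum_Idn add: Cmp_assoc')
  show ?thesis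
    by (rule is_biprodI[OF biprod_mapsI[of _ _ _
      "Cmp C w x z k1 n1 \<oplus>\<^bsub>HMod C w z\<^esub> Cmp C w u z k2 (Cmp C w y u j1 n2)"
      "Cmp C s u z k2 j2"
      "Cmp C z x w m1 l1 \<oplus>\<^bsub>HMod C z w\<^esub> Cmp C z y w m2 (Cmp C z u y q1 l2)"
      "Cmp C z u s q2 l2"]]) (simp_all add: Cmp_assoc' add_assoc e)
qed

lemma is_biprod_null:
  assumes "is_biprod C x z y" "null_obj C z"
  shows "isomorphic C x y"
proof -
  obtain j1 j2 q1 q2 where "biprod_maps K C x z y j1 j2 q1 q2" using is_biprodE[OF assms(1)] .
  then interpret B: biprod_maps K C x z y j1 j2 q1 q2 .
  have "j2 = zero_arr C z y" using assms(2) by (simp add: null_obj_from)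
  then show ?thesis using B.sum_Idn by (intro isomorphicI[of j1 _ _ q1]) simp_all
qed

text \<open>
  By induction on the second summand: associativity moves its last simple summand to the outside.
\<close>

lemma fsums_biprod:
  assumes "additive C" "S \<subseteq> Ob C" "x \<in> fsums C S" "y \<in> fsums C S" "is_biprod C x y z"
  shows "z \<in> fsums C S"
  using assms(4,5)
proof (induction arbitrary: z rule: fsums.induct)
  case (null y)
  have "z \<in> Ob C" using null by (simp add: is_biprod_def)
  then show ?case using fsums_iso[OF assms(3) is_biprod_null[OF null(2,1)]] assms(2) by blast
next
  case (add y s u)
  then obtain w where w: "is_biprod C x y w"
    using assms(1) unfolding additive_def is_biprod_def by meson
  then have "w \<in> fsums C S" using add by blast
  then show ?case using fsums.add add is_biprod_assoc w by metis
qed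

lemma is_biprod_null_left:
  assumes z: "null_obj C z" and [simp]: "s \<in> Ob C"
  shows "is_biprod C z s s"
proof -
  have [simp]: "z \<in> Ob C" using z by (simp add: null_obj_def)
  show ?thesis
    using z by (intro is_biprodI[OF biprod_mapsI[of _ _ _ "zero_arr C z s" "Idn C s" "zero_arr C s z" "Idn C s"]])
      (simp_all add: null_obj_def)
qed

lemma fsums_base:
  assumes "additive C" "S \<subseteq> Ob C" "s \<in> S"
  shows "s \<in> fsums C S"
proof -
  obtain z where z: "null_obj C z" using assms by (auto simp: additive_def)
  have "is_biprod C z s s" using is_biprod_null_left[OF z] assms by blast
  then show ?thesis using fsums.add[OF fsums.null[OF z] assms(3)] by blast
qed

end

section \<open>Splitting of maps between finite sums of simple objects\<close>

text \<open>
  The map is a split epimorphism onto an object of \<open>B\<close> followed by a split monomorphism, which is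
  the coordinate-free form of a block matrix with an identity block and zeros. The notion is
  self-dual, so results on cokernels follow from results on kernels in the opposite category.
\<close>

definition split_factor :: "('k, 'o, 'a) lcat \<Rightarrow> 'o set \<Rightarrow> 'o \<Rightarrow> 'o \<Rightarrow> 'a \<Rightarrow> bool"
  where "split_factor C B x y f \<longleftrightarrow> (\<exists>i\<in>B. \<exists>e\<in>Hom C x i. \<exists>m\<in>Hom C i y. \<exists>s\<in>Hom C i x. \<exists>r\<in>Hom C y i.
    Cmp C x i y m e = f \<and> Cmp C i x i e s = Idn C i \<and> Cmp C i y i r m = Idn C i)"

definition maps_split :: "('k, 'o, 'a) lcat \<Rightarrow> 'o set \<Rightarrow> bool"
  where "maps_split C B \<longleftrightarrow> B \<subseteq> Ob C \<and> (\<forall>x\<in>B. \<forall>y\<in>B. \<forall>f\<in>Hom C x y. split_factor C B x y f)"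

lemma split_factor_opcat [simp]: "split_factor (opcat C) B y x f \<longleftrightarrow> split_factor C B x y f"
  unfolding split_factor_def opcat_simps by blast

lemma maps_split_opcat [simp]: "maps_split (opcat C) B \<longleftrightarrow> maps_split C B"
  by (auto simp: maps_split_def)

lemma schur_familyD:
  assumes "schur_family C S" "s \<in> S" "t \<in> S" "f \<in> Hom C s t" "f \<noteq> zero_arr C s t"
  shows "s = t \<and> is_iso C s t f"
  using assms by (simp add: schur_family_def)

lemma monoD:
  assumes "is_mono C x y f" "w \<in> Ob C" "g \<in> Hom C w x" "h \<in> Hom C w x"
    "Cmp C w x y f g = Cmp C w x y f h"
  shows "g = h"
  using assms by (simp add: is_mono_def)

context k_linear_category
begin

lemma split_factorI:
  assumes "i \<in> B" "e \<in> Hom C x i" "m \<in> Hom C i y" "s \<in> Hom C i x" "r \<in> Hom C y i"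
    "Cmp C x i y m e = f" "Cmp C i x i e s = Idn C i" "Cmp C i y i r m = Idn C i"
  shows "split_factor C B x y f"
  using assms unfolding split_factor_def by blast

lemma split_factorE:
  assumes "split_factor C B x y f"
  obtains i e m s r where "i \<in> B" "e \<in> Hom C x i" "m \<in> Hom C i y" "s \<in> Hom C i x" "r \<in> Hom C y i"
    "Cmp C x i y m e = f" "Cmp C i x i e s = Idn C i" "Cmp C i y i r m = Idn C i"
  using assms unfolding split_factor_def by blast

text \<open>
  A nonzero map from a simple object into a finite sum has a nonzero component. This component is
  invertible, and its inverse gives the retraction.
\<close>

lemma nonzero_from_simple_split:
  assumes "schur_family C S" "y \<in> fsums C S" "s \<in> S" "h \<in> Hom C s y" "h \<noteq> zero_arr C s y"
  shows "\<exists>p\<in>Hom C y s. Cmp C s y s p h = Idn C s"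
  using assms(2,4,5)
proof (induction arbitrary: h rule: fsums.induct)
  case (null z)
  then show ?case using assms(1,3) null_obj_from null_obj_into unfolding schur_family_def by blast
next
  case (add x t y)
  obtain j1 j2 q1 q2 where "biprod_maps K C x t y j1 j2 q1 q2" using is_biprodE[OF add(3)] .
  then interpret B: biprod_maps K C x t y j1 j2 q1 q2 .
  have [simp]: "s \<in> Ob C" using assms by (auto simp: schur_family_def)
  note [simp] = \<open>h \<in> Hom C s y\<close>
  show ?case
  proof (cases "Cmp C s y t q2 h = zero_arr C s t")
    case False
    have "s = t \<and> is_iso C s t (Cmp C s y t q2 h)"
      by (rule schur_familyD[OF assms(1,3) add(2) _ False]) simp
    then have "s = t" "is_iso C s t (Cmp C s y t q2 h)" by blast+
    then obtain g where "g \<in> Hom C s s" "Cmp C s s s g (Cmp C s y s q2 h) = Idn C s"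
      by (auto simp: is_iso_def)
    moreover have "h \<in> Hom C t y" using \<open>s = t\<close> \<open>h \<in> Hom C s y\<close> by simp
    ultimately show ?thesis
      using \<open>s = t\<close> by (intro bexI[of _ "Cmp C y s s g q2"]) (simp_all add: Cmp_assoc')
  next
    case True
    have "Cmp C s y x q1 h \<noteq> zero_arr C s x"
      using B.split_target[of s h] True add.prems by auto
    then obtain p where "p \<in> Hom C x s" "Cmp C s x s p (Cmp C s y x q1 h) = Idn C s"
      using add.IH[of "Cmp C s y x q1 h"] by auto
    then show ?thesis
      by (intro bexI[of _ "Cmp C y x s p q1"]) (simp_all add: Cmp_assoc')
  qed
qed

text \<open>
  Gaussian elimination on the columns of \<open>f\<close>, which correspond to the simple summands of \<open>x\<close>. Suppose
  that \<open>f\<close> restricted to all summands but \<open>s\<close> factors through a split monomorphism \<open>m\<close> with retraction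
  \<open>r\<close>, and let \<open>g\<close> be the remaining column. If \<open>h = g - m r g\<close> vanishes, then \<open>g\<close> factors through \<open>m\<close>
  as well. Otherwise \<open>h\<close> is split, and \<open>m\<close> and \<open>g\<close> together form a split monomorphism.
\<close>

lemma fsums_split_factor:
  assumes "additive C" "schur_family C S" "x \<in> fsums C S" "y \<in> fsums C S" "f \<in> Hom C x y"
  shows "split_factor C (fsums C S) x y f"
  using assms(3,5)
proof (induction arbitrary: f rule: fsums.induct)
  case (null z)
  then have [simp]: "z \<in> Ob C" "y \<in> Ob C" "z \<in> fsums C S"
    using fsums_subset_Ob[OF assms(4)] fsums.null[OF null(1)] by (auto simp: null_obj_def)
  have "Idn C z = zero_arr C z z" using null(1) by (simp add: null_obj_def)
  then show ?case using null(2) null_obj_from[OF null(1) _ null(2)]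
    by (intro split_factorI[of z _ "Idn C z" _ f _ "Idn C z" "zero_arr C y z"]) simp_all
next
  case (add x s u)
  have S: "S \<subseteq> Ob C" using assms(2) by (simp add: schur_family_def)
  obtain j1 j2 q1 q2 where "biprod_maps K C x s u j1 j2 q1 q2" using is_biprodE[OF add(3)] .
  then interpret B: biprod_maps K C x s u j1 j2 q1 q2 .
  have [simp]: "y \<in> Ob C" using assms(4) by (rule fsums_subset_Ob)
  note [simp] = \<open>f \<in> Hom C u y\<close>
  have "split_factor C (fsums C S) x y (Cmp C x u y f j1)" by (rule add.IH) simp
  then obtain i e m t r where ifs: "i \<in> fsums C S" and [simp]: "e \<in> Hom C x i" "m \<in> Hom C i y"
    "t \<in> Hom C i x" "r \<in> Hom C y i" and me: "Cmp C x i y m e = Cmp C x u y f j1"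
    and et [simp]: "Cmp C i x i e t = Idn C i" and rm [simp]: "Cmp C i y i r m = Idn C i"
    by (rule split_factorE)
  have io [simp]: "i \<in> Ob C" using ifs by (rule fsums_subset_Ob)
  note me' [simp] = Cmp_reassoc[OF me] and [simp] = Cmp_reassoc[OF et] Cmp_reassoc[OF rm] me
  define g where "g = Cmp C s u y f j2"
  have g [simp]: "g \<in> Hom C s y" by (simp add: g_def)
  have f_sum: "Cmp C u x y (Cmp C x u y f j1) q1 \<oplus>\<^bsub>HMod C u y\<^esub> Cmp C u s y g q2 = f"
    using B.split_source[of y f] by (simp add: g_def)
  define h where "h = g \<oplus>\<^bsub>HMod C s y\<^esub> (\<ominus>\<^bsub>HMod C s y\<^esub> Cmp C s i y m (Cmp C s y i r g))"
  have h [simp]: "h \<in> Hom C s y" by (simp add: h_def)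
  show ?case
  proof (cases "h = zero_arr C s y")
    case True
    then have mrg: "Cmp C s i y m (Cmp C s y i r g) = g" by (simp add: h_def add_eq_zero_iff)
    have "Cmp C u i y m (Cmp C u y i r (Cmp C u s y g q2)) =
        Cmp C u s y (Cmp C s i y m (Cmp C s y i r g)) q2" by (simp add: Cmp_assoc')
    then have "Cmp C u i y m (Cmp C u y i r (Cmp C u s y g q2)) = Cmp C u s y g q2"
      by (simp only: mrg)
    then show ?thesis
      using f_sum
      by (intro split_factorI[OF ifs, of "Cmp C u x i e q1 \<oplus>\<^bsub>HMod C u i\<^esub> Cmp C u s i (Cmp C s y i r g) q2" _ m _
            "Cmp C i x u j1 t" r]) (simp_all add: Cmp_assoc')
  next
    case False
    \<comment> \<open>the part of \<open>f\<close> outside the image of \<open>m\<close> splits off a copy of \<open>s\<close>\<close>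
    then obtain p0 where p0 [simp]: "p0 \<in> Hom C y s" and p0h: "Cmp C s y s p0 h = Idn C s"
      using nonzero_from_simple_split[OF assms(2,4) add(2) h] by blast
    \<comment> \<open>the retraction \<open>p0\<close> of \<open>h\<close> is changed to vanish on \<open>m\<close>, and is then a retraction of \<open>g\<close> too\<close>
    define p where "p = p0 \<oplus>\<^bsub>HMod C y s\<^esub> (\<ominus>\<^bsub>HMod C y s\<^esub> Cmp C y i s (Cmp C i y s p0 m) r)"
    have p [simp]: "p \<in> Hom C y s" by (simp add: p_def)
    have pm [simp]: "Cmp C i y s p m = zero_arr C i s" by (simp add: p_def Cmp_assoc')
    have pg [simp]: "Cmp C s y s p g = Idn C s"
      using p0h by (simp add: p_def h_def Cmp_assoc')
    note [simp] = Cmp_reassoc[OF pm] Cmp_reassoc[OF pg]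
    obtain w where w: "is_biprod C i s w"
      using assms(1) unfolding additive_def by (meson B.obs(2) io)
    then have wfs: "w \<in> fsums C S" using fsums.add[OF ifs add(2)] by blast
    obtain k1 k2 l1 l2 where "biprod_maps K C i s w k1 k2 l1 l2" using is_biprodE[OF w] .
    then interpret W: biprod_maps K C i s w k1 k2 l1 l2 .
    \<comment> \<open>in the last map, a retraction of \<open>(m, g)\<close>, the correction \<open>r g p\<close> makes the first component vanish on \<open>g\<close>\<close>
    show ?thesis
      using f_sum
      by (intro split_factorI[OF wfs, of
          "Cmp C u i w k1 (Cmp C u x i e q1) \<oplus>\<^bsub>HMod C u w\<^esub> Cmp C u s w k2 q2" _
          "Cmp C w i y m l1 \<oplus>\<^bsub>HMod C w y\<^esub> Cmp C w s y g l2" _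
          "Cmp C w x u j1 (Cmp C w i x t l1) \<oplus>\<^bsub>HMod C w u\<^esub> Cmp C w s u j2 l2"
          "Cmp C y i w k1 (r \<oplus>\<^bsub>HMod C y i\<^esub> (\<ominus>\<^bsub>HMod C y i\<^esub> Cmp C y s i (Cmp C s y i r g) p))
            \<oplus>\<^bsub>HMod C y w\<^esub> Cmp C y s w k2 p"]) (simp_all add: Cmp_assoc' add_assoc)
  qed
qed

lemma fsums_maps_split:
  assumes "additive C" "schur_family C S"
  shows "maps_split C (fsums C S)"
  unfolding maps_split_def by (auto intro: fsums_split_factor[OF assms] dest: fsums_subset_Ob)

text \<open>
  Let \<open>e0 = m e\<close> with \<open>e\<close> split epi and \<open>m\<close> split mono. Cancelling \<open>m\<close> on the left and \<open>e\<close> on the right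
  in \<open>m e m e = m e\<close> shows that \<open>e m\<close> is the identity.
\<close>

lemma split_idempotent:
  assumes "maps_split C B" "x \<in> B" "e0 \<in> Hom C x x" and idem: "Cmp C x x x e0 e0 = e0"
  obtains i k q where "i \<in> B" "k \<in> Hom C i x" "q \<in> Hom C x i" "Cmp C x i x k q = e0"
    "Cmp C i x i q k = Idn C i"
proof -
  have "split_factor C B x x e0" using assms by (auto simp: maps_split_def)
  then obtain i e m s r where i: "i \<in> B" and h [simp]: "e \<in> Hom C x i" "m \<in> Hom C i x"
    "s \<in> Hom C i x" "r \<in> Hom C x i" and me: "Cmp C x i x m e = e0"
    and es: "Cmp C i x i e s = Idn C i" and rm: "Cmp C i x i r m = Idn C i"
    by (rule split_factorE)
  have [simp]: "i \<in> Ob C" "x \<in> Ob C" using i assms by (auto simp: maps_split_def)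
  have "Cmp C i x i r (Cmp C i x x (Cmp C x x x (Cmp C x i x m e) (Cmp C x i x m e)) s) =
      Cmp C i x i r (Cmp C i x x (Cmp C x i x m e) s)"
    using idem by (simp add: me)
  then have "Cmp C i x i e m = Idn C i"
    by (simp add: Cmp_assoc' Cmp_reassoc[OF es] Cmp_reassoc[OF rm] es rm)
  then show ?thesis using that[OF i h(2,1) me] by blast
qed

text \<open>
  If \<open>f = m e\<close> with \<open>m\<close> mono, the kernel of \<open>f\<close> is that of \<open>e\<close>; if moreover \<open>e s\<close> is the identity, this
  is the image of the idempotent \<open>1 - s e\<close>. The kernel has its universal property with respect to all
  objects of the category, although only maps between objects of \<open>B\<close> are known to split.
\<close>

lemma kernel_exists:
  assumes "maps_split C B" "x \<in> B" "y \<in> B" "f \<in> Hom C x y"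
  shows "\<exists>z\<in>B. \<exists>k. is_kernel C x y f z k"
proof -
  have "split_factor C B x y f" using assms by (auto simp: maps_split_def)
  then obtain i e m s r where i: "i \<in> B" and h [simp]: "e \<in> Hom C x i" "m \<in> Hom C i y"
    "s \<in> Hom C i x" "r \<in> Hom C y i" and me: "Cmp C x i y m e = f"
    and es [simp]: "Cmp C i x i e s = Idn C i" and rm [simp]: "Cmp C i y i r m = Idn C i"
    by (rule split_factorE)
  have [simp]: "i \<in> Ob C" "x \<in> Ob C" "y \<in> Ob C" using i assms by (auto simp: maps_split_def)
  note [simp] = Cmp_reassoc[OF es] Cmp_reassoc[OF rm]
  define c where "c = Idn C x \<oplus>\<^bsub>HMod C x x\<^esub> (\<ominus>\<^bsub>HMod C x x\<^esub> Cmp C x i x s e)"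
  have c [simp]: "c \<in> Hom C x x" by (simp add: c_def)
  have cc: "Cmp C x x x c c = c" by (simp add: c_def Cmp_assoc')
  obtain z k q where z: "z \<in> B" and k [simp]: "k \<in> Hom C z x" "q \<in> Hom C x z"
    and kq: "Cmp C x z x k q = c" and qk [simp]: "Cmp C z x z q k = Idn C z"
    using split_idempotent[OF assms(1,2) c cc] .
  have [simp]: "z \<in> Ob C" using z assms by (auto simp: maps_split_def)
  have "Cmp C z x i e k = Cmp C z x i e (Cmp C z x x (Cmp C x z x k q) k)" by (simp add: Cmp_assoc')
  also have "\<dots> = zero_arr C z i" by (simp add: kq c_def Cmp_assoc')
  finally have ek: "Cmp C z x i e k = zero_arr C z i" .
  have "is_kernel C x y f z k"
    unfolding is_kernel_def
  proof (intro conjI ballI impI)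
    show "Cmp C z x y f k = zero_arr C z y" by (simp add: ek Cmp_assoc' flip: me)
    fix w g assume [simp]: "w \<in> Ob C" "g \<in> Hom C w x" and "Cmp C w x y f g = zero_arr C w y"
    then have "Cmp C w y i r (Cmp C w x y (Cmp C x i y m e) g) = zero_arr C w i" by (simp add: me)
    then have eg: "Cmp C w x i e g = zero_arr C w i" by (simp add: Cmp_assoc')
    have "Cmp C w x x (Cmp C x z x k q) g = g" by (simp add: kq c_def eg Cmp_assoc')
    then show "\<exists>!u. u \<in> Hom C w z \<and> Cmp C w z x k u = g"
      by (intro ex1I[of _ "Cmp C w x z q g"]) (auto simp: Cmp_assoc' Cmp_reassoc[OF qk])
  qed simp_all
  then show ?thesis using z by blast
qed

text \<open>
  In a factorization \<open>f = m e\<close> of a monomorphism, the split epimorphism \<open>e\<close> is mono and therefore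
  invertible.
\<close>

lemma mono_split:
  assumes "maps_split C B" "x \<in> B" "y \<in> B" "is_mono C x y f"
  shows "\<exists>r\<in>Hom C y x. Cmp C x y x r f = Idn C x"
proof -
  have f [simp]: "f \<in> Hom C x y" using assms by (simp add: is_mono_def)
  then have "split_factor C B x y f" using assms by (auto simp: maps_split_def)
  then obtain i e m s r where i: "i \<in> B" and h [simp]: "e \<in> Hom C x i" "m \<in> Hom C i y"
    "s \<in> Hom C i x" "r \<in> Hom C y i" and me: "Cmp C x i y m e = f"
    and es [simp]: "Cmp C i x i e s = Idn C i" and rm [simp]: "Cmp C i y i r m = Idn C i"
    by (rule split_factorE)
  have [simp]: "i \<in> Ob C" "x \<in> Ob C" "y \<in> Ob C" using i assms by (auto simp: maps_split_def)
  note [simp] = Cmp_reassoc[OF es] Cmp_reassoc[OF rm]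
  have "Cmp C x x y f (Cmp C x i x s e) = Cmp C x x y f (Idn C x)"
    by (simp add: Cmp_assoc' flip: me)
  then have "Cmp C x i x s e = Idn C x"
    by (rule monoD[OF assms(4), rotated -1]) simp_all
  then show ?thesis
    by (intro bexI[of _ "Cmp C y i x s r"]) (simp_all add: Cmp_assoc' me[symmetric])
qed

text \<open>
  A split monomorphism is the kernel of the complementary idempotent.
\<close>

lemma split_mono_kernel:
  assumes [simp]: "x \<in> Ob C" "y \<in> Ob C" "f \<in> Hom C x y" "r \<in> Hom C y x"
    and rf [simp]: "Cmp C x y x r f = Idn C x"
  shows "is_kernel C y y (Idn C y \<oplus>\<^bsub>HMod C y y\<^esub> (\<ominus>\<^bsub>HMod C y y\<^esub> Cmp C y x y f r)) x f"
  unfolding is_kernel_def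
proof (intro conjI ballI impI)
  fix w h assume [simp]: "w \<in> Ob C" "h \<in> Hom C w y"
    and "Cmp C w y y (Idn C y \<oplus>\<^bsub>HMod C y y\<^esub> (\<ominus>\<^bsub>HMod C y y\<^esub> Cmp C y x y f r)) h = zero_arr C w y"
  then have "h = Cmp C w x y f (Cmp C w y x r h)"
    by (simp add: Cmp_assoc' add_eq_zero_iff)
  then show "\<exists>!u. u \<in> Hom C w x \<and> Cmp C w x y f u = h"
    by (intro ex1I[of _ "Cmp C w y x r h"]) (auto simp: Cmp_reassoc[OF rf])
qed (simp_all add: Cmp_assoc')

lemma split_monoI:
  assumes [simp]: "x \<in> Ob C" "y \<in> Ob C" "f \<in> Hom C x y" "r \<in> Hom C y x"
    and rf [simp]: "Cmp C x y x r f = Idn C x"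
  shows "is_mono C x y f"
  unfolding is_mono_def
proof (intro conjI ballI impI)
  fix w g h assume [simp]: "w \<in> Ob C" "g \<in> Hom C w x" "h \<in> Hom C w x"
    and e: "Cmp C w x y f g = Cmp C w x y f h"
  have "Cmp C w y x r (Cmp C w x y f g) = Cmp C w y x r (Cmp C w x y f h)" using e by simp
  then show "g = h" by (simp add: Cmp_reassoc[OF rf])
qed simp

end

lemma (in k_linear_category) cokernel_exists:
  assumes "maps_split C B" "x \<in> B" "y \<in> B" "f \<in> Hom C x y"
  shows "\<exists>z\<in>B. \<exists>q. is_cokernel C x y f z q"
  using k_linear_category.kernel_exists[OF k_linear_opcat, of B y x f] assms
  by (simp add: is_cokernel_def)

section \<open>Finite direct sums\<close>

context k_linear_category
begin

lemma hom_sum_closed [simp]: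
  assumes "x \<in> Ob C" "y \<in> Ob C" "\<And>i. i < n \<Longrightarrow> f i \<in> Hom C x y"
  shows "finsum (HMod C x y) f {..<n::nat} \<in> Hom C x y"
proof -
  interpret M: abelian_group "HMod C x y" by (rule hmod_group[OF assms(1,2)])
  show ?thesis
    using M.finsum_closed[of f "{..<n}"] assms by (simp add: carrier_HMod Pi_def)
qed

lemma hom_sum_0 [simp]:
  assumes "x \<in> Ob C" "y \<in> Ob C"
  shows "finsum (HMod C x y) f {..<0::nat} = zero_arr C x y" "finsum (HMod C x y) f {} = zero_arr C x y"
proof -
  interpret M: abelian_group "HMod C x y" by (rule hmod_group[OF assms(1,2)])
  show "finsum (HMod C x y) f {..<0::nat} = zero_arr C x y" "finsum (HMod C x y) f {} = zero_arr C x y"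
    by simp_all
qed

lemma hom_sum_Suc:
  assumes "x \<in> Ob C" "y \<in> Ob C" "\<And>i. i < Suc n \<Longrightarrow> f i \<in> Hom C x y"
  shows "finsum (HMod C x y) f {..<Suc n} = f n \<oplus>\<^bsub>HMod C x y\<^esub> finsum (HMod C x y) f {..<n}"
proof -
  interpret M: abelian_group "HMod C x y" by (rule hmod_group[OF assms(1,2)])
  show ?thesis
    using assms by (simp add: lessThan_Suc carrier_HMod Pi_def)
qed

lemma hom_sum_cong:
  assumes "x \<in> Ob C" "y \<in> Ob C" "\<And>i. i < n \<Longrightarrow> g i \<in> Hom C x y" "\<And>i. i < n \<Longrightarrow> f i = g i"
  shows "finsum (HMod C x y) f {..<n::nat} = finsum (HMod C x y) g {..<n}"
proof -
  interpret M: abelian_group "HMod C x y" by (rule hmod_group[OF assms(1,2)])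
  show ?thesis
    using assms by (intro M.finsum_cong') (auto simp: carrier_HMod)
qed

lemma hom_sum_zero [simp]:
  assumes "x \<in> Ob C" "y \<in> Ob C"
  shows "finsum (HMod C x y) (\<lambda>i. zero_arr C x y) {..<n::nat} = zero_arr C x y"
proof -
  interpret M: abelian_group "HMod C x y" by (rule hmod_group[OF assms(1,2)])
  show ?thesis by (rule M.finsum_zero)
qed

lemma hom_sum_delta:
  assumes "x \<in> Ob C" "y \<in> Ob C" "\<And>i. i < n \<Longrightarrow> f i \<in> Hom C x y" "k < n"
  shows "finsum (HMod C x y) (\<lambda>i. if k = i then f i else zero_arr C x y) {..<n::nat} = f k"
proof -
  interpret M: abelian_group "HMod C x y" by (rule hmod_group[OF assms(1,2)])
  show ?thesis using assms by (intro M.finsum_singleton) (auto simp: carrier_HMod)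
qed

lemma Cmp_hom_sum_left:
  assumes "x \<in> Ob C" "y \<in> Ob C" "z \<in> Ob C" "g \<in> Hom C x y" "\<And>i. i < n \<Longrightarrow> f i \<in> Hom C y z"
  shows "Cmp C x y z (finsum (HMod C y z) f {..<n::nat}) g =
    finsum (HMod C x z) (\<lambda>i. Cmp C x y z (f i) g) {..<n}"
  using assms(5)
proof (induction n)
  case 0 then show ?case using assms by simp
next
  case (Suc n) then show ?case using assms(1-4) by (simp add: hom_sum_Suc)
qed

lemma Cmp_hom_sum_right:
  assumes "x \<in> Ob C" "y \<in> Ob C" "z \<in> Ob C" "g \<in> Hom C y z" "\<And>i. i < n \<Longrightarrow> f i \<in> Hom C x y"
  shows "Cmp C x y z g (finsum (HMod C x y) f {..<n::nat}) =
    finsum (HMod C x z) (\<lambda>i. Cmp C x y z g (f i)) {..<n}"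
  using assms(5)
proof (induction n)
  case 0 then show ?case using assms by simp
next
  case (Suc n) then show ?case using assms(1-4) by (simp add: hom_sum_Suc)
qed

lemma dsum_0: "is_direct_sum C 0 s x \<longleftrightarrow> null_obj C x"
  by (auto simp: is_direct_sum_def null_obj_def)

lemma dsumI:
  assumes "x \<in> Ob C" "\<And>i. i < n \<Longrightarrow> u i \<in> Hom C (s i) x" "\<And>i. i < n \<Longrightarrow> p i \<in> Hom C x (s i)"
    "\<And>i j. \<lbrakk>i < n; j < n\<rbrakk> \<Longrightarrow> Cmp C (s i) x (s j) (p j) (u i) =
        (if i = j then Idn C (s i) else zero_arr C (s i) (s j))"
    "finsum (HMod C x x) (\<lambda>i. Cmp C x (s i) x (u i) (p i)) {..<n} = Idn C x"
  shows "is_direct_sum C n s x"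
  unfolding is_direct_sum_def using assms by blast

lemma dsumE:
  assumes "is_direct_sum C n s x"
  obtains u p where "x \<in> Ob C" "\<And>i. i < n \<Longrightarrow> u i \<in> Hom C (s i) x"
    "\<And>i. i < n \<Longrightarrow> p i \<in> Hom C x (s i)"
    "\<And>i j. \<lbrakk>i < n; j < n\<rbrakk> \<Longrightarrow> Cmp C (s i) x (s j) (p j) (u i) =
        (if i = j then Idn C (s i) else zero_arr C (s i) (s j))"
    "finsum (HMod C x x) (\<lambda>i. Cmp C x (s i) x (u i) (p i)) {..<n} = Idn C x"
  using assms unfolding is_direct_sum_def by blast

lemma dsum_cong:
  assumes "is_direct_sum C n s x" "\<And>i. i < n \<Longrightarrow> t i = s i" "\<And>i. i < n \<Longrightarrow> s i \<in> Ob C"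
  shows "is_direct_sum C n t x"
proof -
  obtain u p where u: "x \<in> Ob C" "\<And>i. i < n \<Longrightarrow> u i \<in> Hom C (s i) x"
    "\<And>i. i < n \<Longrightarrow> p i \<in> Hom C x (s i)"
    "\<And>i j. \<lbrakk>i < n; j < n\<rbrakk> \<Longrightarrow> Cmp C (s i) x (s j) (p j) (u i) =
        (if i = j then Idn C (s i) else zero_arr C (s i) (s j))"
    and sum: "finsum (HMod C x x) (\<lambda>i. Cmp C x (s i) x (u i) (p i)) {..<n} = Idn C x"
    using dsumE[OF assms(1)] by blast
  have "finsum (HMod C x x) (\<lambda>i. Cmp C x (t i) x (u i) (p i)) {..<n} =
      finsum (HMod C x x) (\<lambda>i. Cmp C x (s i) x (u i) (p i)) {..<n}"
    using u assms by (intro hom_sum_cong) simp_all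
  then show ?thesis using u assms sum by (intro dsumI[where u = u and p = p]) simp_all
qed

lemma dsum_Suc:
  assumes d: "is_direct_sum C n s x" and b: "is_biprod C x (s n) y" and s: "\<And>i. i < n \<Longrightarrow> s i \<in> Ob C"
  shows "is_direct_sum C (Suc n) s y"
proof -
  obtain u p where xo: "x \<in> Ob C" and u [simp]: "\<And>i. i < n \<Longrightarrow> u i \<in> Hom C (s i) x"
    and p [simp]: "\<And>i. i < n \<Longrightarrow> p i \<in> Hom C x (s i)"
    and pu: "\<And>i j. \<lbrakk>i < n; j < n\<rbrakk> \<Longrightarrow> Cmp C (s i) x (s j) (p j) (u i) =
        (if i = j then Idn C (s i) else zero_arr C (s i) (s j))"
    and sum: "finsum (HMod C x x) (\<lambda>i. Cmp C x (s i) x (u i) (p i)) {..<n} = Idn C x"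
    using dsumE[OF d] by blast
  obtain j1 j2 q1 q2 where "biprod_maps K C x (s n) y j1 j2 q1 q2" using is_biprodE[OF b] .
  then interpret B: biprod_maps K C x "s n" y j1 j2 q1 q2 .
  note [simp] = s
  have si [simp]: "i < Suc n \<Longrightarrow> s i \<in> Ob C" for i by (auto simp: less_Suc_eq)
  define u' where "u' i = (if i = n then j2 else Cmp C (s i) x y j1 (u i))" for i
  define p' where "p' i = (if i = n then q2 else Cmp C y x (s i) (p i) q1)" for i
  have "finsum (HMod C y y) (\<lambda>i. Cmp C y (s i) y (u' i) (p' i)) {..<n} =
    finsum (HMod C y y) (\<lambda>i. Cmp C y x y j1 (Cmp C y x x (Cmp C x (s i) x (u i) (p i)) q1)) {..<n}"
    by (rule hom_sum_cong) (simp_all add: u'_def p'_def Cmp_assoc')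
  also have "\<dots> = Cmp C y x y j1 (Cmp C y x x (finsum (HMod C x x) (\<lambda>i. Cmp C x (s i) x (u i) (p i)) {..<n}) q1)"
    by (simp add: Cmp_hom_sum_left Cmp_hom_sum_right)
  also have "\<dots> = Cmp C y x y j1 q1" by (simp add: sum)
  finally have 1: "finsum (HMod C y y) (\<lambda>i. Cmp C y (s i) y (u' i) (p' i)) {..<n} = Cmp C y x y j1 q1" .
  have u't: "u' i \<in> Hom C (s i) y" "p' i \<in> Hom C y (s i)" if "i < Suc n" for i
    using that by (auto simp: u'_def p'_def less_Suc_eq)
  show ?thesis
  proof (rule dsumI[where u = u' and p = p'])
    show "finsum (HMod C y y) (\<lambda>i. Cmp C y (s i) y (u' i) (p' i)) {..<Suc n} = Idn C y"
      using u't by (simp add: hom_sum_Suc 1) (simp add: u'_def p'_def add_comm)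
    fix i j assume "i < Suc n" "j < Suc n"
    then show "Cmp C (s i) y (s j) (p' j) (u' i) = (if i = j then Idn C (s i) else zero_arr C (s i) (s j))"
      by (auto simp: less_Suc_eq u'_def p'_def pu Cmp_assoc')
  qed (use u't in auto)
qed

text \<open>
  The sum of the maps \<open>v i \<circ> p i\<close> is the map into the direct sum \<open>y\<close> with components \<open>p i\<close>.
\<close>

lemma dsum_projection:
  fixes n :: nat
  assumes [simp]: "x \<in> Ob C" "y \<in> Ob C" "\<And>i. i < n \<Longrightarrow> s i \<in> Ob C"
    "\<And>i. i < n \<Longrightarrow> p i \<in> Hom C x (s i)" "\<And>i. i < n \<Longrightarrow> v i \<in> Hom C (s i) y"
    "\<And>i. i < n \<Longrightarrow> q i \<in> Hom C y (s i)"
    and qv: "\<And>i j. \<lbrakk>i < n; j < n\<rbrakk> \<Longrightarrow> Cmp C (s i) y (s j) (q j) (v i) =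
        (if i = j then Idn C (s i) else zero_arr C (s i) (s j))"
    and k: "k < n"
  shows "Cmp C x y (s k) (q k) (finsum (HMod C x y) (\<lambda>i. Cmp C x (s i) y (v i) (p i)) {..<n}) = p k"
proof -
  have "Cmp C x y (s k) (q k) (finsum (HMod C x y) (\<lambda>i. Cmp C x (s i) y (v i) (p i)) {..<n}) =
      finsum (HMod C x (s k)) (\<lambda>i. Cmp C x (s i) (s k) (Cmp C (s i) y (s k) (q k) (v i)) (p i)) {..<n}"
    using k by (subst Cmp_hom_sum_right) (auto intro!: hom_sum_cong simp: Cmp_assoc)
  also have "\<dots> = finsum (HMod C x (s k)) (\<lambda>i. if k = i then (\<lambda>i. if i = k then p k else zero_arr C x (s k)) i
      else zero_arr C x (s k)) {..<n}"
    using k by (intro hom_sum_cong) (auto simp: qv)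
  also have "\<dots> = p k" using k by (subst hom_sum_delta) auto
  finally show ?thesis .
qed

lemma dsum_unique:
  assumes "is_direct_sum C n s x" "is_direct_sum C n s y" and s [simp]: "\<And>i. i < n \<Longrightarrow> s i \<in> Ob C"
  shows "isomorphic C x y"
proof -
  obtain u p where x [simp]: "x \<in> Ob C" "\<And>i. i < n \<Longrightarrow> u i \<in> Hom C (s i) x"
    "\<And>i. i < n \<Longrightarrow> p i \<in> Hom C x (s i)"
    and pu: "\<And>i j. \<lbrakk>i < n; j < n\<rbrakk> \<Longrightarrow> Cmp C (s i) x (s j) (p j) (u i) =
        (if i = j then Idn C (s i) else zero_arr C (s i) (s j))"
    and up: "finsum (HMod C x x) (\<lambda>i. Cmp C x (s i) x (u i) (p i)) {..<n} = Idn C x"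
    using dsumE[OF assms(1)] by blast
  obtain v q where y [simp]: "y \<in> Ob C" "\<And>i. i < n \<Longrightarrow> v i \<in> Hom C (s i) y"
    "\<And>i. i < n \<Longrightarrow> q i \<in> Hom C y (s i)"
    and qv: "\<And>i j. \<lbrakk>i < n; j < n\<rbrakk> \<Longrightarrow> Cmp C (s i) y (s j) (q j) (v i) =
        (if i = j then Idn C (s i) else zero_arr C (s i) (s j))"
    and vq: "finsum (HMod C y y) (\<lambda>i. Cmp C y (s i) y (v i) (q i)) {..<n} = Idn C y"
    using dsumE[OF assms(2)] by blast
  define f where "f = finsum (HMod C x y) (\<lambda>i. Cmp C x (s i) y (v i) (p i)) {..<n}"
  define g where "g = finsum (HMod C y x) (\<lambda>i. Cmp C y (s i) x (u i) (q i)) {..<n}"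
  have [simp]: "f \<in> Hom C x y" "g \<in> Hom C y x" by (simp_all add: f_def g_def)
  have qf: "k < n \<Longrightarrow> Cmp C x y (s k) (q k) f = p k" for k
    unfolding f_def by (rule dsum_projection) (simp_all add: qv)
  have pg: "k < n \<Longrightarrow> Cmp C y x (s k) (p k) g = q k" for k
    unfolding g_def by (rule dsum_projection) (simp_all add: pu)
  have "Cmp C x y x g f = finsum (HMod C x x) (\<lambda>i. Cmp C x (s i) x (u i) (p i)) {..<n}"
    by (simp add: g_def Cmp_hom_sum_left, intro hom_sum_cong) (simp_all add: Cmp_assoc' qf)
  moreover have "Cmp C y x y f g = finsum (HMod C y y) (\<lambda>i. Cmp C y (s i) y (v i) (q i)) {..<n}"
    by (simp add: f_def Cmp_hom_sum_left, intro hom_sum_cong) (simp_all add: Cmp_assoc' pg)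
  ultimately show ?thesis by (intro isomorphicI[of f _ _ g]) (simp_all add: up vq)
qed

lemma dsum_in_fsums:
  assumes "additive C" "S \<subseteq> Ob C" "\<And>i. i < n \<Longrightarrow> s i \<in> Ob C \<and> (\<exists>t\<in>S. isomorphic C (s i) t)"
  shows "\<exists>x\<in>fsums C S. is_direct_sum C n s x"
  using assms(3)
proof (induction n)
  case 0
  obtain z where "null_obj C z" using assms(1) by (auto simp: additive_def)
  then show ?case using fsums.null dsum_0 by metis
next
  case (Suc n)
  then obtain x where x: "x \<in> fsums C S" "is_direct_sum C n s x" by auto
  obtain t where t: "t \<in> S" "isomorphic C (s n) t" using Suc.prems by blast
  have sn: "s n \<in> Ob C" using Suc.prems by blast
  obtain y where y: "is_biprod C x (s n) y"
    using assms(1) fsums_subset_Ob[OF x(1)] sn unfolding additive_def by blast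
  have "y \<in> fsums C S" by (rule fsums_cong_iso[OF y sn t x(1) assms(2)])
  moreover have "is_direct_sum C (Suc n) s y"
    by (rule dsum_Suc[OF x(2) y]) (use Suc.prems in simp)
  ultimately show ?case by blast
qed

lemma fsums_dsum:
  assumes "S \<subseteq> Ob C" "x \<in> fsums C S"
  shows "\<exists>n s. (\<forall>i<n. s i \<in> S) \<and> is_direct_sum C n s x"
  using assms(2)
proof (induction rule: fsums.induct)
  case (null z)
  then have "is_direct_sum C 0 s z" for s by (simp add: dsum_0)
  then show ?case by (intro exI[of _ 0]) auto
next
  case (add x s y)
  then obtain n t where t: "\<forall>i<n. t i \<in> S" "is_direct_sum C n t x" by blast
  define t' where "t' = t(n := s)"
  have "is_direct_sum C n t' x"
    by (rule dsum_cong[OF t(2)]) (use t(1) assms(1) in \<open>auto simp: t'_def\<close>)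
  then have "is_direct_sum C (Suc n) t' y"
    using add t assms(1) by (intro dsum_Suc[of n t' x y]) (auto simp: t'_def)
  moreover have "\<forall>i<Suc n. t' i \<in> S" using t(1) add(2) by (auto simp: t'_def less_Suc_eq)
  ultimately show ?case by blast
qed

end

section \<open>Simple systems and semisimple abelian categories\<close>

context k_linear_category
begin

text \<open>
  Kernels come from split idempotents, and monomorphisms are split, hence kernels. The
  axioms on cokernels and epimorphisms are the same statements for the opposite category.
\<close>

lemma abelian_of_maps_split:
  assumes a: "additive C" and m: "maps_split C (Ob C)"
  shows "abelian_category K C"
  unfolding abelian_category_def
proof (intro conjI allI ballI impI)
  show "k_linear_category K C" by (rule k_linear_category_axioms)
  show "\<exists>z. is_zero_obj C z" using a by (auto simp: additive_def null_obj_iff_zero)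
  show "\<exists>x. is_direct_sum C n s x" if "\<forall>i<n. s i \<in> Ob C" for n s
    using dsum_in_fsums[OF a, of "Ob C" n s] that isomorphic_refl by blast
  fix x y f assume xy: "x \<in> Ob C" "y \<in> Ob C"
  show "\<exists>z k. is_kernel C x y f z k" if "f \<in> Hom C x y"
    using kernel_exists[OF m xy that] by blast
  show "\<exists>z q. is_cokernel C x y f z q" if "f \<in> Hom C x y"
    using cokernel_exists[OF m xy that] by blast
  show "\<exists>z\<in>Ob C. \<exists>g\<in>Hom C y z. is_kernel C y z g x f" if f: "is_mono C x y f"
  proof -
    obtain r where r: "r \<in> Hom C y x" "Cmp C x y x r f = Idn C x"
      using mono_split[OF m xy f] by blast
    have ft: "f \<in> Hom C x y" using f by (simp add: is_mono_def)
    have "Idn C y \<oplus>\<^bsub>HMod C y y\<^esub> (\<ominus>\<^bsub>HMod C y y\<^esub> Cmp C y x y f r) \<in> Hom C y y"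
      using xy r ft by simp
    then show ?thesis using split_mono_kernel[OF xy ft r] xy by blast
  qed
  interpret O: k_linear_category K "opcat C" by (rule k_linear_opcat)
  show "\<exists>z\<in>Ob C. \<exists>g\<in>Hom C z x. is_cokernel C z x g y f" if "is_epi C x y f"
  proof -
    have f: "is_mono (opcat C) y x f" using that by (simp add: is_epi_def)
    obtain r where r: "r \<in> Hom C y x" "Cmp C y x y f r = Idn C y"
      using O.mono_split[of "Ob C" y x f] m xy f by auto
    have ft: "f \<in> Hom C x y" using f by (simp add: is_mono_def)
    have "Idn C x \<oplus>\<^bsub>HMod C x x\<^esub> (\<ominus>\<^bsub>HMod C x x\<^esub> Cmp C x y x r f) \<in> Hom C x x"
      using xy r ft by simp
    moreover have "is_cokernel C x x (Idn C x \<oplus>\<^bsub>HMod C x x\<^esub> (\<ominus>\<^bsub>HMod C x x\<^esub> Cmp C x y x r f)) y f"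
      using O.split_mono_kernel[of y x f r] xy ft r by (simp add: is_cokernel_def)
    ultimately show ?thesis using xy by blast
  qed
qed

end

lemma isomorphic_full_subcat [simp]: "isomorphic (full_subcat C S) x y \<longleftrightarrow> isomorphic C x y"
  by (simp add: isomorphic_def is_iso_def)

context k_linear_category
begin

lemma schur_not_null: "\<lbrakk>schur_family C S; s \<in> S\<rbrakk> \<Longrightarrow> \<not> null_obj C s"
  by (auto simp: schur_family_def null_obj_def)

lemma schur_isomorphic_eq:
  assumes "schur_family C S" "s \<in> S" "t \<in> S" "isomorphic C s t"
  shows "s = t"
proof -
  obtain f g where f: "f \<in> Hom C s t" "g \<in> Hom C t s" "Cmp C s t s g f = Idn C s"
    using assms(4) by (rule isomorphicE)
  have [simp]: "s \<in> Ob C" "t \<in> Ob C" using assms by (auto simp: schur_family_def)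
  have "f \<noteq> zero_arr C s t"
    using f schur_not_null[OF assms(1,2)] by (auto simp: null_obj_def)
  then show ?thesis using schur_familyD[OF assms(1-3) f(1)] by blast
qed

text \<open>
  A monomorphism \<open>f : y \<rightarrow> s\<close> has a retraction \<open>r\<close>, and \<open>f r\<close> is an idempotent endomorphism of \<open>s\<close>. If it
  is zero then so is \<open>y\<close>, and if it is invertible then so is \<open>f\<close>.
\<close>

lemma schur_simple:
  assumes sys: "simple_system C S" and s: "s \<in> S"
  shows "is_simple C s"
proof -
  have sch: "schur_family C S" and m: "maps_split C (Ob C)"
    using sys fsums_maps_split[of S] fsums_subset_Ob[of _ C S]
    by (auto simp: simple_system_def) (metis subsetI subset_antisym)
  have [simp]: "s \<in> Ob C" using sch s by (auto simp: schur_family_def)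
  show ?thesis
    unfolding is_simple_def null_obj_iff_zero[symmetric]
  proof (intro conjI ballI allI impI)
    show "\<not> null_obj C s" using schur_not_null[OF sch s] .
    fix y f assume [simp]: "y \<in> Ob C" and f: "is_mono C y s f"
    have ft [simp]: "f \<in> Hom C y s" using f by (simp add: is_mono_def)
    obtain r where r [simp]: "r \<in> Hom C s y" and rf: "Cmp C y s y r f = Idn C y"
      using mono_split[OF m _ _ f] by auto
    show "null_obj C y \<or> is_iso C y s f"
    proof (cases "Cmp C s y s f r = zero_arr C s s")
      case True
      have "Cmp C y s y r (Cmp C y s s (Cmp C s y s f r) f) = Idn C y"
        by (simp add: Cmp_assoc' Cmp_reassoc[OF rf] rf)
      then have "Idn C y = zero_arr C y y" by (simp add: True)
      then show ?thesis by (simp add: null_obj_def)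
    next
      case False
      have "Cmp C s y s f r \<in> Hom C s s" by simp
      then obtain g where g [simp]: "g \<in> Hom C s s" and fg: "Cmp C s s s (Cmp C s y s f r) g = Idn C s"
        using schur_familyD[OF sch s s _ False] by (auto simp: is_iso_def)
      have e: "Cmp C s s s (Cmp C s y s f r) (Cmp C s y s f r) = Cmp C s y s f r"
        by (simp add: Cmp_assoc' Cmp_reassoc[OF rf])
      have "Cmp C s y s f r = Cmp C s s s (Cmp C s y s f r) (Cmp C s s s (Cmp C s y s f r) g)"
        by (simp add: fg)
      also have "\<dots> = Cmp C s s s (Cmp C s s s (Cmp C s y s f r) (Cmp C s y s f r)) g"
        by (rule Cmp_assoc) simp_all
      also have "\<dots> = Idn C s" by (simp only: e fg)
      finally show ?thesis by (intro disjI2 isoI[OF ft r rf])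
    qed
  qed simp
qed

text \<open>
  A nonzero finite sum has a member of \<open>S\<close> as a direct summand, and the inclusion of a nonzero summand
  into a simple object is invertible.
\<close>

lemma simple_iso_schur:
  assumes sys: "simple_system C S" and x: "is_simple C x"
  shows "\<exists>s\<in>S. isomorphic C s x"
proof -
  have S: "S \<subseteq> Ob C" "schur_family C S" using sys by (auto simp: simple_system_def schur_family_def)
  have xo: "x \<in> Ob C" and nx: "\<not> null_obj C x"
    and sx: "\<And>y m. \<lbrakk>y \<in> Ob C; is_mono C y x m\<rbrakk> \<Longrightarrow> null_obj C y \<or> is_iso C y x m"
    using x by (auto simp: is_simple_def null_obj_iff_zero)
  have "x \<in> fsums C S" using sys xo by (auto simp: simple_system_def)
  then show ?thesis
  proof cases
    case null then show ?thesis using nx by blast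
  next
    case (add y s)
    obtain j1 j2 q1 q2 where "biprod_maps K C y s x j1 j2 q1 q2" using is_biprodE[OF add(3)] .
    then interpret B: biprod_maps K C y s x j1 j2 q1 q2 .
    have "is_mono C s x j2" by (rule split_monoI[of _ _ _ q2]) simp_all
    then have "is_iso C s x j2" using sx[of s j2] schur_not_null[OF S(2) add(2)] by simp
    then show ?thesis using add(2) by (auto simp: isomorphic_def)
  qed
qed

lemma simple_system_skeleton:
  assumes sys: "simple_system C S"
  shows "is_skeleton (simples C) S"
  unfolding is_skeleton_def simples_def
proof (intro conjI ballI)
  show "S \<subseteq> Ob (full_subcat C {x. is_simple C x})" using schur_simple[OF sys] by auto
  fix x assume "x \<in> Ob (full_subcat C {x. is_simple C x})"
  then have x: "is_simple C x" by simp
  then have xo: "x \<in> Ob C" by (simp add: is_simple_def)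
  have sch: "schur_family C S" "S \<subseteq> Ob C" using sys by (auto simp: simple_system_def schur_family_def)
  obtain s where s: "s \<in> S" "isomorphic C s x" using simple_iso_schur[OF sys x] by blast
  show "\<exists>!s. s \<in> S \<and> isomorphic (full_subcat C {x. is_simple C x}) s x"
  proof (rule ex1I[of _ s])
    show "s \<in> S \<and> isomorphic (full_subcat C {x. is_simple C x}) s x" using s by simp
    fix t assume "t \<in> S \<and> isomorphic (full_subcat C {x. is_simple C x}) t x"
    then have t: "t \<in> S" "isomorphic C t x" by auto
    then have "isomorphic C t s"
      using isomorphic_trans[OF t(2) isomorphic_sym[OF s(2)]] xo sch s(1) by blast
    then show "t = s" using schur_isomorphic_eq[OF sch(1) t(1) s(1)] by blast
  qed
qed

lemma biprod_cokernel:
  assumes "biprod_maps K C a b y j1 j2 q1 q2"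
  shows "is_cokernel C a y j1 b q2"
proof -
  interpret B: biprod_maps K C a b y j1 j2 q1 q2 by (rule assms)
  show ?thesis
    unfolding is_cokernel_def is_kernel_def opcat_simps
  proof (intro conjI ballI impI)
    fix w h assume [simp]: "w \<in> Ob C" "h \<in> Hom C y w" and h: "Cmp C a y w h j1 = zero_arr C a w"
    have "Cmp C y b w (Cmp C b y w h j2) q2 = h"
      using B.split_source[of w h] h by (simp del: B.sum_Idn)
    then show "\<exists>!u. u \<in> Hom C b w \<and> Cmp C y b w u q2 = h"
      by (intro ex1I[of _ "Cmp C b y w h j2"]) (auto simp: Cmp_assoc')
  qed simp_all
qed

text \<open>
  A composition series of \<open>x\<close> followed by the inclusion of \<open>x\<close> into its biproduct with \<open>s\<close> is a composition
  series of the biproduct: the last quotient is \<open>s\<close>.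
\<close>

lemma fsums_finite_length:
  assumes simp: "\<And>s. s \<in> S \<Longrightarrow> is_simple C s" and "x \<in> fsums C S"
  shows "has_finite_length C x"
  using assms(2)
proof (induction rule: fsums.induct)
  case (null z)
  then show ?case
    unfolding has_finite_length_def
    by (intro exI[of _ 0] exI[of _ "\<lambda>_. z"]) (auto simp: null_obj_iff_zero[symmetric] null_obj_def)
next
  case (add x s y)
  obtain n c m where c: "\<forall>i\<le>n. c i \<in> Ob C" "is_zero_obj C (c 0)" "c n = x"
    "\<forall>i<n. is_mono C (c i) (c (Suc i)) (m i) \<and>
        (\<exists>z q. is_cokernel C (c i) (c (Suc i)) (m i) z q \<and> is_simple C z)"
    using add.IH unfolding has_finite_length_def by blast
  obtain j1 j2 q1 q2 where b: "biprod_maps K C x s y j1 j2 q1 q2" using is_biprodE[OF add(3)] .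
  then interpret B: biprod_maps K C x s y j1 j2 q1 q2 .
  have "is_mono C x y j1" by (rule split_monoI[of _ _ _ q1]) simp_all
  then show ?case
    unfolding has_finite_length_def
    using c biprod_cokernel[OF b] simp[OF add(2)]
    by (intro exI[of _ "Suc n"] exI[of _ "c(Suc n := y)"] exI[of _ "m(n := j1)"])
      (auto simp: less_Suc_eq le_Suc_eq)
qed

theorem simple_system_semisimple:
  assumes sys: "simple_system C S"
  shows "semisimple_abelian_finite_length K C"
proof -
  have a: "additive C" and sch: "schur_family C S" and fs: "fsums C S = Ob C" and S: "S \<subseteq> Ob C"
    using sys fsums_subset_Ob[of _ C S] by (auto simp: simple_system_def schur_family_def)
  have "abelian_category K C"
    using abelian_of_maps_split[OF a] fsums_maps_split[OF a sch] fs by simp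
  moreover have "has_finite_length C x" if "x \<in> Ob C" for x
    using fsums_finite_length[of S x] schur_simple[OF sys] that fs by simp
  moreover have "\<exists>n s. (\<forall>i<n. is_simple C (s i)) \<and> is_direct_sum C n s x" if "x \<in> Ob C" for x
    using fsums_dsum[OF S, of x] that fs schur_simple[OF sys] by blast
  ultimately show ?thesis by (simp add: semisimple_abelian_finite_length_def)
qed

text \<open>
  Schur's lemma. The kernel of a nonzero map out of a simple object is a proper subobject, hence zero,
  so the map is a nonzero subobject of its simple target.
\<close>

lemma simple_maps_iso:
  assumes ab: "abelian_category K C" and s: "is_simple C s" and t: "is_simple C t"
    and f [simp]: "f \<in> Hom C s t" and nz: "f \<noteq> zero_arr C s t"
  shows "is_iso C s t f"
proof -
  have [simp]: "s \<in> Ob C" "t \<in> Ob C" using s t by (auto simp: is_simple_def)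
  have "\<exists>z k. is_kernel C s t f z k" using ab by (simp add: abelian_category_def)
  then obtain z k where k: "is_kernel C s t f z k" by blast
  have [simp]: "z \<in> Ob C" "k \<in> Hom C z s" and fk: "Cmp C z s t f k = zero_arr C z t"
    and uni: "\<And>w h. \<lbrakk>w \<in> Ob C; h \<in> Hom C w s; Cmp C w s t f h = zero_arr C w t\<rbrakk> \<Longrightarrow>
      (\<exists>!u. u \<in> Hom C w z \<and> Cmp C w z s k u = h)"
    using k by (auto simp: is_kernel_def)
  have "is_mono C z s k"
    unfolding is_mono_def
  proof (intro conjI ballI impI)
    fix w g h assume [simp]: "w \<in> Ob C" "g \<in> Hom C w z" "h \<in> Hom C w z"
      and e: "Cmp C w z s k g = Cmp C w z s k h"
    have "\<exists>!u. u \<in> Hom C w z \<and> Cmp C w z s k u = Cmp C w z s k h"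
      by (rule uni) (simp_all add: Cmp_reassoc[OF fk])
    then show "g = h" using e \<open>g \<in> Hom C w z\<close> \<open>h \<in> Hom C w z\<close> by blast
  qed simp
  then have "null_obj C z \<or> is_iso C z s k"
    using s unfolding is_simple_def null_obj_iff_zero[symmetric] by simp
  moreover have False if ki: "is_iso C z s k"
  proof -
    obtain g where "g \<in> Hom C s z" "Cmp C s z s k g = Idn C s" using ki by (auto simp: is_iso_def)
    then have "f = zero_arr C s t"
      using Cmp_assoc[of s z s t g k f] fk by simp
    with nz show False by simp
  qed
  ultimately have z: "null_obj C z" by blast
  have "is_mono C s t f"
    unfolding is_mono_def
  proof (intro conjI ballI impI)
    fix w g h assume [simp]: "w \<in> Ob C" "g \<in> Hom C w s" "h \<in> Hom C w s"
      and e: "Cmp C w s t f g = Cmp C w s t f h"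
    have "Cmp C w s t f (g \<oplus>\<^bsub>HMod C w s\<^esub> (\<ominus>\<^bsub>HMod C w s\<^esub> h)) = zero_arr C w t"
      using e by simp
    then obtain u where u: "u \<in> Hom C w z" "Cmp C w z s k u = g \<oplus>\<^bsub>HMod C w s\<^esub> (\<ominus>\<^bsub>HMod C w s\<^esub> h)"
      using uni[of w "g \<oplus>\<^bsub>HMod C w s\<^esub> (\<ominus>\<^bsub>HMod C w s\<^esub> h)"] by auto
    then have "u = zero_arr C w z" using null_obj_into[OF z] by simp
    with u have "g \<oplus>\<^bsub>HMod C w s\<^esub> (\<ominus>\<^bsub>HMod C w s\<^esub> h) = zero_arr C w s" by simp
    then show "g = h" by (simp add: add_eq_zero_iff)
  qed simp
  then show ?thesis
    using t s \<open>s \<in> Ob C\<close> unfolding is_simple_def null_obj_iff_zero[symmetric] by blast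
qed

lemma skeleton_exists:
  assumes "\<And>x. x \<in> Q \<Longrightarrow> x \<in> Ob C"
  obtains T where "T \<subseteq> Q" "\<And>x. x \<in> Q \<Longrightarrow> \<exists>t\<in>T. isomorphic C t x"
    "\<And>s t. \<lbrakk>s \<in> T; t \<in> T; isomorphic C s t\<rbrakk> \<Longrightarrow> s = t"
proof -
  define rep where "rep x = (SOME t. t \<in> Q \<and> isomorphic C t x)" for x
  have rep: "rep x \<in> Q" "isomorphic C (rep x) x" if "x \<in> Q" for x
    using someI[of "\<lambda>t. t \<in> Q \<and> isomorphic C t x" x] isomorphic_refl[of x] that assms
    by (auto simp: rep_def)
  have eq: "rep x = rep y" if "x \<in> Q" "y \<in> Q" "isomorphic C x y" for x y
  proof -
    have "t \<in> Q \<and> isomorphic C t x \<longleftrightarrow> t \<in> Q \<and> isomorphic C t y" for t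
      using isomorphic_trans isomorphic_sym that assms by meson
    then show ?thesis by (simp add: rep_def)
  qed
  show ?thesis
  proof (rule that[of "rep ` Q"])
    fix s t assume "s \<in> rep ` Q" "t \<in> rep ` Q" and i: "isomorphic C s t"
    then obtain x y where xy: "x \<in> Q" "y \<in> Q" "s = rep x" "t = rep y" by blast
    have "isomorphic C x (rep y)"
      using isomorphic_trans[OF isomorphic_sym[OF rep(2)[OF xy(1)]]] i xy rep assms by simp
    then have "isomorphic C x y"
      using isomorphic_trans[OF _ rep(2)[OF xy(2)]] xy rep assms by simp
    then show "s = t" using eq xy by simp
  qed (use rep in auto)
qed

lemma abelian_additive:
  assumes "abelian_category K C"
  shows "additive C"
  unfolding additive_def
proof (intro conjI ballI)
  obtain z where z: "null_obj C z"
    using assms by (auto simp: abelian_category_def null_obj_iff_zero)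
  then show "\<exists>z. null_obj C z" ..
  fix a b assume ab: "a \<in> Ob C" "b \<in> Ob C"
  define s where "s = (\<lambda>i::nat. if i = 0 then a else b)"
  have "\<forall>i<2. s i \<in> Ob C" using ab by (simp add: s_def)
  then obtain y where y: "is_direct_sum C 2 s y"
    using assms unfolding abelian_category_def by blast
  obtain u p where [simp]: "y \<in> Ob C" and ty: "\<And>i. i < 2 \<Longrightarrow> u i \<in> Hom C (s i) y"
    "\<And>i. i < 2 \<Longrightarrow> p i \<in> Hom C y (s i)"
    and pu: "\<And>i j. \<lbrakk>i < 2; j < 2\<rbrakk> \<Longrightarrow> Cmp C (s i) y (s j) (p j) (u i) =
        (if i = j then Idn C (s i) else zero_arr C (s i) (s j))"
    and up: "finsum (HMod C y y) (\<lambda>i. Cmp C y (s i) y (u i) (p i)) {..<2} = Idn C y"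
    using dsumE[OF y] by blast
  have [simp]: "u 0 \<in> Hom C a y" "u (Suc 0) \<in> Hom C b y" "p 0 \<in> Hom C y a" "p (Suc 0) \<in> Hom C y b"
    using ty(1)[of 0] ty(1)[of 1] ty(2)[of 0] ty(2)[of 1] by (simp_all add: s_def)
  have "Cmp C y a y (u 0) (p 0) \<oplus>\<^bsub>HMod C y y\<^esub> Cmp C y b y (u 1) (p 1) = Idn C y"
  proof -
    define g where "g = (\<lambda>i. Cmp C y (s i) y (u i) (p i))"
    have "s i \<in> Ob C" for i using ab by (simp add: s_def)
    then have g: "i < 2 \<Longrightarrow> g i \<in> Hom C y y" for i using ty by (simp add: g_def)
    then have "finsum (HMod C y y) g {..<Suc 1} = g 1 \<oplus>\<^bsub>HMod C y y\<^esub> finsum (HMod C y y) g {..<Suc 0}"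
      using hom_sum_Suc[of y y 1 g] by simp
    also have "finsum (HMod C y y) g {..<Suc 0} = g 0" using hom_sum_Suc[of y y 0 g] g by simp
    finally have "g 0 \<oplus>\<^bsub>HMod C y y\<^esub> g 1 = finsum (HMod C y y) g {..<2}"
      using g by (simp add: add_comm numeral_2_eq_2)
    also have "\<dots> = Idn C y" using up by (simp only: g_def)
    finally show ?thesis by (simp add: g_def s_def)
  qed
  then have "is_biprod C a b y"
    using ab pu[of 0 0] pu[of 0 1] pu[of 1 0] pu[of 1 1]
    by (intro is_biprodI[OF biprod_mapsI[of _ _ _ "u 0" "u 1" "p 0" "p 1"]]) (simp_all add: s_def)
  then show "\<exists>y. is_biprod C a b y" ..
qed

text \<open>
  A skeleton of the simple objects is a simple system.
\<close>

theorem semisimple_simple_system: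
  assumes ss: "semisimple_abelian_finite_length K C"
  shows "\<exists>T. simple_system C T"
proof -
  have ab: "abelian_category K C" using ss by (simp add: semisimple_abelian_finite_length_def)
  have simple_Ob: "is_simple C x \<Longrightarrow> x \<in> Ob C" for x by (simp add: is_simple_def)
  obtain T where T: "T \<subseteq> {x. is_simple C x}" "\<And>x. is_simple C x \<Longrightarrow> \<exists>t\<in>T. isomorphic C t x"
    "\<And>s t. \<lbrakk>s \<in> T; t \<in> T; isomorphic C s t\<rbrakk> \<Longrightarrow> s = t"
    using skeleton_exists[of "{x. is_simple C x}"] simple_Ob by auto
  have TO: "T \<subseteq> Ob C" using T(1) simple_Ob by blast
  have fs: "x \<in> fsums C T" if s: "\<forall>i<n. is_simple C (s i)" and x: "is_direct_sum C n s x" for n s x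
  proof -
    have so: "s i \<in> Ob C" if "i < n" for i using s that simple_Ob by blast
    have "\<exists>t\<in>T. isomorphic C (s i) t" if "i < n" for i
      using s T(2)[of "s i"] isomorphic_sym that by blast
    then obtain y where y: "y \<in> fsums C T" "is_direct_sum C n s y"
      using dsum_in_fsums[OF abelian_additive[OF ab] TO, of n s] so by blast
    have "x \<in> Ob C" using x by (simp add: is_direct_sum_def)
    then show ?thesis using fsums_iso[OF y(1) dsum_unique[OF y(2) x so]] TO by blast
  qed
  have "schur_family C T"
    unfolding schur_family_def
  proof (intro conjI ballI impI)
    show "Idn C s \<noteq> zero_arr C s s" if "s \<in> T" for s
      using that T(1) unfolding is_simple_def null_obj_iff_zero[symmetric] null_obj_def by blast
    fix s t f assume st: "s \<in> T" "t \<in> T" "f \<in> Hom C s t" "f \<noteq> zero_arr C s t"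
    then show "is_iso C s t f" using simple_maps_iso[OF ab] T(1) by blast
    then show "s = t" using T(3) st by (auto simp: isomorphic_def)
  qed (rule TO)
  then have "simple_system C T"
    using abelian_additive[OF ab] fs ss
    by (auto simp: simple_system_def semisimple_abelian_finite_length_def)
  then show ?thesis ..
qed

end

section \<open>Fully faithful functors and equivalences\<close>

locale lin_functor = C: k_linear_category K C + D: k_linear_category K D
  for K :: "('k, 'r) ring_scheme" and C :: "('k, 'o, 'a) lcat" and D :: "('k, 'p, 'b) lcat" +
  fixes F :: "('o, 'a, 'p, 'b) fnctr"
  assumes linear: "linear_functor K C D F"
begin

lemma F_Ob [simp]: "x \<in> Ob C \<Longrightarrow> OMap F x \<in> Ob D"
  using linear by (simp add: linear_functor_def is_functor_def)

lemma F_Hom [simp]: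
  "\<lbrakk>x \<in> Ob C; y \<in> Ob C; f \<in> Hom C x y\<rbrakk> \<Longrightarrow> AMap F x y f \<in> Hom D (OMap F x) (OMap F y)"
  using linear by (simp add: linear_functor_def is_functor_def)

lemma F_Idn [simp]: "x \<in> Ob C \<Longrightarrow> AMap F x x (Idn C x) = Idn D (OMap F x)"
  using linear by (simp add: linear_functor_def is_functor_def)

lemma F_Cmp [simp]:
  "\<lbrakk>x \<in> Ob C; y \<in> Ob C; z \<in> Ob C; f \<in> Hom C x y; g \<in> Hom C y z\<rbrakk> \<Longrightarrow> AMap F x z (Cmp C x y z g f) =
    Cmp D (OMap F x) (OMap F y) (OMap F z) (AMap F y z g) (AMap F x y f)"
  using linear by (simp add: linear_functor_def is_functor_def)

lemma F_add [simp]: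
  "\<lbrakk>x \<in> Ob C; y \<in> Ob C; f \<in> Hom C x y; g \<in> Hom C x y\<rbrakk> \<Longrightarrow> AMap F x y (f \<oplus>\<^bsub>HMod C x y\<^esub> g) =
    AMap F x y f \<oplus>\<^bsub>HMod D (OMap F x) (OMap F y)\<^esub> AMap F x y g"
  using linear by (simp add: linear_functor_def linear_map_def C.carrier_HMod)

lemma F_smult [simp]:
  "\<lbrakk>x \<in> Ob C; y \<in> Ob C; f \<in> Hom C x y; a \<in> carrier K\<rbrakk> \<Longrightarrow> AMap F x y (a \<odot>\<^bsub>HMod C x y\<^esub> f) =
    a \<odot>\<^bsub>HMod D (OMap F x) (OMap F y)\<^esub> AMap F x y f"
  using linear by (simp add: linear_functor_def linear_map_def C.carrier_HMod)

lemma F_zero [simp]: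
  assumes "x \<in> Ob C" "y \<in> Ob C"
  shows "AMap F x y (zero_arr C x y) = zero_arr D (OMap F x) (OMap F y)"
proof -
  have "AMap F x y (zero_arr C x y) \<oplus>\<^bsub>HMod D (OMap F x) (OMap F y)\<^esub> AMap F x y (zero_arr C x y) =
      AMap F x y (zero_arr C x y)"
    using assms F_add[of x y "zero_arr C x y" "zero_arr C x y"] by simp
  then show ?thesis using assms by (simp add: D.add_cancel_self)
qed

end

lemma (in k_linear_category) linear_functorI:
  fixes D :: "('k, 'p, 'b) lcat"
  assumes "k_linear_category K D"
    and "\<And>x. x \<in> Ob C \<Longrightarrow> OMap F x \<in> Ob D"
    and "\<And>x y f. \<lbrakk>x \<in> Ob C; y \<in> Ob C; f \<in> Hom C x y\<rbrakk> \<Longrightarrow> AMap F x y f \<in> Hom D (OMap F x) (OMap F y)"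
    and "\<And>x. x \<in> Ob C \<Longrightarrow> AMap F x x (Idn C x) = Idn D (OMap F x)"
    and "\<And>x y z f g. \<lbrakk>x \<in> Ob C; y \<in> Ob C; z \<in> Ob C; f \<in> Hom C x y; g \<in> Hom C y z\<rbrakk> \<Longrightarrow>
      AMap F x z (Cmp C x y z g f) =
        Cmp D (OMap F x) (OMap F y) (OMap F z) (AMap F y z g) (AMap F x y f)"
    and "\<And>x y f g. \<lbrakk>x \<in> Ob C; y \<in> Ob C; f \<in> Hom C x y; g \<in> Hom C x y\<rbrakk> \<Longrightarrow>
      AMap F x y (f \<oplus>\<^bsub>HMod C x y\<^esub> g) = AMap F x y f \<oplus>\<^bsub>HMod D (OMap F x) (OMap F y)\<^esub> AMap F x y g"
    and "\<And>x y f a. \<lbrakk>x \<in> Ob C; y \<in> Ob C; f \<in> Hom C x y; a \<in> carrier K\<rbrakk> \<Longrightarrow>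
      AMap F x y (a \<odot>\<^bsub>HMod C x y\<^esub> f) = a \<odot>\<^bsub>HMod D (OMap F x) (OMap F y)\<^esub> AMap F x y f"
  shows "linear_functor K C D F"
  using assms
  by (simp add: linear_functor_def is_functor_def linear_map_def carrier_HMod
      k_linear_category.carrier_HMod[OF assms(1)])

definition ff_pair ::
  "('k, 'o, 'a) lcat \<Rightarrow> ('k, 'p, 'b) lcat \<Rightarrow> ('o, 'a, 'p, 'b) fnctr \<Rightarrow> 'o \<Rightarrow> 'o \<Rightarrow> bool"
  where "ff_pair C D F x y \<longleftrightarrow> bij_betw (AMap F x y) (Hom C x y) (Hom D (OMap F x) (OMap F y))"

definition fully_faithful ::
  "('k, 'o, 'a) lcat \<Rightarrow> ('k, 'p, 'b) lcat \<Rightarrow> ('o, 'a, 'p, 'b) fnctr \<Rightarrow> bool"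
  where "fully_faithful C D F \<longleftrightarrow> (\<forall>x\<in>Ob C. \<forall>y\<in>Ob C. ff_pair C D F x y)"

definition ess_surj ::
  "('k, 'o, 'a) lcat \<Rightarrow> ('k, 'p, 'b) lcat \<Rightarrow> ('o, 'a, 'p, 'b) fnctr \<Rightarrow> bool"
  where "ess_surj C D F \<longleftrightarrow> (\<forall>d\<in>Ob D. \<exists>c\<in>Ob C. isomorphic D (OMap F c) d)"

lemma comp_functor_simps [simp]:
  "OMap (comp_functor G F) x = OMap G (OMap F x)"
  "AMap (comp_functor G F) x y f = AMap G (OMap F x) (OMap F y) (AMap F x y f)"
  by (simp_all add: comp_functor_def)

lemma id_functor_simps [simp]: "OMap id_functor x = x" "AMap id_functor x y f = f"
  by (simp_all add: id_functor_def)

lemma linear_functor_comp: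
  "\<lbrakk>linear_functor K C D F; linear_functor K D E G\<rbrakk> \<Longrightarrow> linear_functor K C E (comp_functor G F)"
  by (auto simp: linear_functor_def is_functor_def linear_map_def Pi_def)

lemma fully_faithful_comp:
  assumes "is_functor C D F" "fully_faithful C D F" "fully_faithful D E G"
  shows "fully_faithful C E (comp_functor G F)"
  unfolding fully_faithful_def ff_pair_def
proof (intro ballI)
  fix x y assume xy: "x \<in> Ob C" "y \<in> Ob C"
  have "bij_betw (AMap G (OMap F x) (OMap F y) \<circ> AMap F x y) (Hom C x y)
      (Hom E (OMap G (OMap F x)) (OMap G (OMap F y)))"
    using assms xy
    by (intro bij_betw_trans[of _ _ "Hom D (OMap F x) (OMap F y)"])
      (simp_all add: fully_faithful_def ff_pair_def is_functor_def)
  moreover have "AMap (comp_functor G F) x y = AMap G (OMap F x) (OMap F y) \<circ> AMap F x y"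
    by (simp add: fun_eq_iff)
  ultimately show "bij_betw (AMap (comp_functor G F) x y) (Hom C x y)
      (Hom E (OMap (comp_functor G F) x) (OMap (comp_functor G F) y))"
    by simp
qed

lemma nat_isoD:
  assumes "nat_iso C D F G t" "x \<in> Ob C"
  obtains t' where "t x \<in> Hom D (OMap F x) (OMap G x)" "t' \<in> Hom D (OMap G x) (OMap F x)"
    "Cmp D (OMap F x) (OMap G x) (OMap F x) t' (t x) = Idn D (OMap F x)"
    "Cmp D (OMap G x) (OMap F x) (OMap G x) (t x) t' = Idn D (OMap G x)"
  using assms by (auto simp: nat_iso_def is_iso_def)

lemma nat_iso_natural:
  "\<lbrakk>nat_iso C D F G t; x \<in> Ob C; y \<in> Ob C; f \<in> Hom C x y\<rbrakk> \<Longrightarrow>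
      Cmp D (OMap F x) (OMap F y) (OMap G y) (t y) (AMap F x y f) =
      Cmp D (OMap F x) (OMap G x) (OMap G y) (AMap G x y f) (t x)"
  by (auto simp: nat_iso_def nat_trans_def)

lemma (in k_linear_category) nat_iso_inverse:
  fixes D :: "('k, 'p, 'b) lcat"
  assumes "k_linear_category K D" "linear_functor K C D F" "linear_functor K C D G" "nat_iso C D F G t"
  shows "\<exists>t'. nat_iso C D G F t'"
proof -
  interpret F: lin_functor K C D F by (simp add: lin_functor_def lin_functor_axioms_def assms k_linear_category_axioms)
  interpret G: lin_functor K C D G by (simp add: lin_functor_def lin_functor_axioms_def assms k_linear_category_axioms)
  have "\<forall>x\<in>Ob C. \<exists>t'. t' \<in> Hom D (OMap G x) (OMap F x) \<and>
      Cmp D (OMap F x) (OMap G x) (OMap F x) t' (t x) = Idn D (OMap F x) \<and>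
      Cmp D (OMap G x) (OMap F x) (OMap G x) (t x) t' = Idn D (OMap G x)"
    using assms(4) nat_isoD by metis
  then obtain t' where t' [simp]: "\<And>x. x \<in> Ob C \<Longrightarrow> t' x \<in> Hom D (OMap G x) (OMap F x)"
    and l: "\<And>x. x \<in> Ob C \<Longrightarrow> Cmp D (OMap F x) (OMap G x) (OMap F x) (t' x) (t x) = Idn D (OMap F x)"
    and r: "\<And>x. x \<in> Ob C \<Longrightarrow> Cmp D (OMap G x) (OMap F x) (OMap G x) (t x) (t' x) = Idn D (OMap G x)"
    by metis
  have t [simp]: "x \<in> Ob C \<Longrightarrow> t x \<in> Hom D (OMap F x) (OMap G x)" for x
    using assms(4) by (auto simp: nat_iso_def nat_trans_def)
  have "nat_iso C D G F t'"
    unfolding nat_iso_def nat_trans_def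
  proof (intro conjI ballI)
    fix x assume [simp]: "x \<in> Ob C"
    show "t' x \<in> Hom D (OMap G x) (OMap F x)" by simp
    show "is_iso D (OMap G x) (OMap F x) (t' x)"
      by (rule F.D.isoI[of _ _ _ "t x"]) (simp_all add: l r)
    fix y f assume [simp]: "y \<in> Ob C" "f \<in> Hom C x y"
    have "Cmp D (OMap G x) (OMap G y) (OMap F y) (t' y) (AMap G x y f) =
      Cmp D (OMap G x) (OMap G y) (OMap F y) (t' y)
        (Cmp D (OMap G x) (OMap F x) (OMap G y)
          (Cmp D (OMap F x) (OMap G x) (OMap G y) (AMap G x y f) (t x)) (t' x))"
      by (simp add: F.D.Cmp_assoc' r)
    also have "\<dots> = Cmp D (OMap G x) (OMap F x) (OMap F y) (AMap F x y f) (t' x)"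
      by (simp add: nat_iso_natural[OF assms(4), symmetric])
        (simp add: F.D.Cmp_assoc' F.D.Cmp_reassoc[OF l])
    finally show "Cmp D (OMap G x) (OMap G y) (OMap F y) (t' y) (AMap G x y f) =
      Cmp D (OMap G x) (OMap F x) (OMap F y) (AMap F x y f) (t' x)" .
  qed
  then show ?thesis by blast
qed

lemma linear_functor_id: "linear_functor K C C id_functor"
  by (auto simp: linear_functor_def is_functor_def linear_map_def)

lemma (in k_linear_category) equivalence_inverse:
  fixes D :: "('k, 'p, 'b) lcat"
  assumes "k_linear_category K D" "is_equivalence K C D F"
  shows "\<exists>G. is_equivalence K D C G"
proof -
  obtain G s t where F: "linear_functor K C D F" and G: "linear_functor K D C G"
    and s: "nat_iso C C id_functor (comp_functor G F) s" and t: "nat_iso D D (comp_functor F G) id_functor t"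
    using assms by (auto simp: is_equivalence_def)
  obtain s' where s': "nat_iso C C (comp_functor G F) id_functor s'"
    using nat_iso_inverse[OF k_linear_category_axioms linear_functor_id linear_functor_comp[OF F G] s] by blast
  obtain t' where t': "nat_iso D D id_functor (comp_functor F G) t'"
    using k_linear_category.nat_iso_inverse[OF assms(1,1) linear_functor_comp[OF G F] linear_functor_id t] by blast
  show ?thesis using F G s' t' unfolding is_equivalence_def by blast
qed

context lin_functor
begin

text \<open>
  By naturality, \<open>f\<close> is the conjugate of \<open>G (F f)\<close> by the components of the isomorphism.
\<close>

lemma faithful_of_nat_iso:
  fixes G :: "('p, 'b, 'o, 'a) fnctr"
  assumes "nat_iso C C (comp_functor G F) id_functor t"
    and [simp]: "x \<in> Ob C" "y \<in> Ob C" "f \<in> Hom C x y" "g \<in> Hom C x y"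
    and e: "AMap F x y f = AMap F x y g" and "linear_functor K D C G"
  shows "f = g"
proof -
  interpret G: lin_functor K D C G
    by (simp add: lin_functor_def lin_functor_axioms_def C.k_linear_category_axioms
        D.k_linear_category_axioms assms)
  obtain t' where t' [simp]: "t x \<in> Hom C (OMap G (OMap F x)) x" "t' \<in> Hom C x (OMap G (OMap F x))"
    and tt: "Cmp C x (OMap G (OMap F x)) x (t x) t' = Idn C x"
    using nat_isoD[OF assms(1,2)] by auto
  have n: "Cmp C (OMap G (OMap F x)) x y h (t x) =
      Cmp C (OMap G (OMap F x)) (OMap G (OMap F y)) y (t y) (AMap G (OMap F x) (OMap F y) (AMap F x y h))"
    if "h \<in> Hom C x y" for h
    using nat_iso_natural[OF assms(1) assms(2,3) that] by simp
  have h: "h = Cmp C x (OMap G (OMap F x)) y (Cmp C (OMap G (OMap F x)) x y h (t x)) t'"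
    if [simp]: "h \<in> Hom C x y" for h
    by (simp add: C.Cmp_assoc' tt)
  show ?thesis by (subst h[of f], simp, subst h[of g], simp) (simp add: n e)
qed

text \<open>
  A preimage of \<open>h\<close> under \<open>F\<close> is found by conjugating \<open>G h\<close> with the isomorphism between the identity
  and \<open>G F\<close>. That \<open>F\<close> sends it to \<open>h\<close> can be tested after applying \<open>G\<close>, which is faithful.
\<close>

lemma equivalence_ff_ess_surj:
  assumes eq: "is_equivalence K C D F"
  shows "fully_faithful C D F" "ess_surj C D F"
proof -
  obtain G s t where GL: "linear_functor K D C G"
    and s: "nat_iso C C id_functor (comp_functor G F) s" and t: "nat_iso D D (comp_functor F G) id_functor t"
    using eq by (auto simp: is_equivalence_def)
  interpret G: lin_functor K D C G
    by (simp add: lin_functor_def lin_functor_axioms_def C.k_linear_category_axioms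
        D.k_linear_category_axioms GL)
  obtain s' where s': "nat_iso C C (comp_functor G F) id_functor s'"
    using C.nat_iso_inverse[OF C.k_linear_category_axioms linear_functor_id linear_functor_comp[OF linear GL] s] by blast
  show "ess_surj C D F"
    unfolding ess_surj_def isomorphic_def
  proof
    fix d assume "d \<in> Ob D"
    then show "\<exists>c\<in>Ob C. \<exists>f. is_iso D (OMap F c) d f"
      using t by (intro bexI[of _ "OMap G d"] exI[of _ "t d"]) (auto simp: nat_iso_def)
  qed
  show "fully_faithful C D F"
    unfolding fully_faithful_def ff_pair_def
  proof (intro ballI bij_betwI')
    fix x y assume [simp]: "x \<in> Ob C" "y \<in> Ob C"
    show "AMap F x y f = AMap F x y g \<longleftrightarrow> f = g" if "f \<in> Hom C x y" "g \<in> Hom C x y" for f g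
      using faithful_of_nat_iso[OF s' _ _ that _ GL] by auto
    show "AMap F x y f \<in> Hom D (OMap F x) (OMap F y)" if "f \<in> Hom C x y" for f
      using that by simp
    fix h assume [simp]: "h \<in> Hom D (OMap F x) (OMap F y)"
    let ?GFx = "OMap G (OMap F x)" and ?GFy = "OMap G (OMap F y)"
    obtain sx where [simp]: "s x \<in> Hom C x ?GFx" "sx \<in> Hom C ?GFx x" and sx: "Cmp C ?GFx x ?GFx (s x) sx = Idn C ?GFx"
      using nat_isoD[OF s, of x] by auto
    obtain sy where [simp]: "s y \<in> Hom C y ?GFy" "sy \<in> Hom C ?GFy y" and sy: "Cmp C ?GFy y ?GFy (s y) sy = Idn C ?GFy"
      using nat_isoD[OF s, of y] by auto
    define f where "f = Cmp C x ?GFy y sy (Cmp C x ?GFx ?GFy (AMap G (OMap F x) (OMap F y) h) (s x))"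
    have [simp]: "f \<in> Hom C x y" by (simp add: f_def)
    have n: "Cmp C x y ?GFy (s y) f = Cmp C x ?GFx ?GFy (AMap G (OMap F x) (OMap F y) (AMap F x y f)) (s x)"
      using nat_iso_natural[OF s, of x y f] by simp
    have "AMap G (OMap F x) (OMap F y) (AMap F x y f) =
      Cmp C ?GFx x ?GFy (Cmp C x ?GFx ?GFy (AMap G (OMap F x) (OMap F y) (AMap F x y f)) (s x)) sx"
      by (simp add: C.Cmp_assoc' sx)
    also have "\<dots> = Cmp C ?GFx x ?GFy (Cmp C x y ?GFy (s y) f) sx" by (simp only: n)
    also have "\<dots> = AMap G (OMap F x) (OMap F y) h"
      by (simp add: f_def C.Cmp_assoc' C.Cmp_reassoc[OF sy] sx)
    finally have "AMap F x y f = h"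
      using G.faithful_of_nat_iso[OF t _ _ _ _ _ linear, of "OMap F x" "OMap F y"] by simp
    then show "\<exists>f\<in>Hom C x y. h = AMap F x y f" by (intro bexI[of _ f]) auto
  qed
qed

end

locale ff_functor = lin_functor K C D F
  for K :: "('k, 'r) ring_scheme" and C :: "('k, 'o, 'a) lcat" and D :: "('k, 'p, 'b) lcat" and F +
  assumes ff: "fully_faithful C D F"
begin

lemma F_eq:
  "\<lbrakk>AMap F x y f = AMap F x y g; x \<in> Ob C; y \<in> Ob C; f \<in> Hom C x y; g \<in> Hom C x y\<rbrakk> \<Longrightarrow> f = g"
  using ff by (auto simp: fully_faithful_def ff_pair_def bij_betw_def inj_on_def)

lemma F_full:
  assumes "x \<in> Ob C" "y \<in> Ob C" "h \<in> Hom D (OMap F x) (OMap F y)"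
  obtains f where "f \<in> Hom C x y" "AMap F x y f = h"
proof -
  have "AMap F x y ` Hom C x y = Hom D (OMap F x) (OMap F y)"
    using ff assms by (simp add: fully_faithful_def ff_pair_def bij_betw_def)
  then show ?thesis using assms that by (metis imageE)
qed

lemma reflects_iso:
  assumes [simp]: "x \<in> Ob C" "y \<in> Ob C" and "isomorphic D (OMap F x) (OMap F y)"
  shows "isomorphic C x y"
proof -
  obtain h k where h: "h \<in> Hom D (OMap F x) (OMap F y)" "k \<in> Hom D (OMap F y) (OMap F x)"
    "Cmp D (OMap F x) (OMap F y) (OMap F x) k h = Idn D (OMap F x)"
    "Cmp D (OMap F y) (OMap F x) (OMap F y) h k = Idn D (OMap F y)"
    using assms(3) by (rule D.isomorphicE)
  obtain f where f [simp]: "f \<in> Hom C x y" "AMap F x y f = h" using F_full[OF assms(1,2) h(1)] .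
  obtain g where g [simp]: "g \<in> Hom C y x" "AMap F y x g = k" using F_full[OF assms(2,1) h(2)] .
  show ?thesis
  proof (rule C.isomorphicI[OF f(1) g(1)])
    show "Cmp C x y x g f = Idn C x" by (rule F_eq[of x x]) (simp_all add: h)
    show "Cmp C y x y f g = Idn C y" by (rule F_eq[of y y]) (simp_all add: h)
  qed
qed

text \<open>
  The functor backwards given by a choice of objects \<open>c d\<close> with maps \<open>u d : F (c d) \<rightarrow> d\<close> and
  \<open>v d : d \<rightarrow> F (c d)\<close>. For an equivalence the maps come from essential surjectivity; for an
  isomorphism of categories they are identities.
\<close>

definition inverse_functor :: "('p \<Rightarrow> 'o) \<Rightarrow> ('p \<Rightarrow> 'b) \<Rightarrow> ('p \<Rightarrow> 'b) \<Rightarrow> ('p, 'b, 'o, 'a) fnctr"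
  where "inverse_functor c u v = \<lparr>OMap = c, AMap = (\<lambda>d e h. inv_into (Hom C (c d) (c e)) (AMap F (c d) (c e))
    (Cmp D (OMap F (c d)) e (OMap F (c e)) (v e) (Cmp D (OMap F (c d)) d e h (u d))))\<rparr>"

lemma inverse_functor_AMap:
  assumes [simp]: "d \<in> Ob D" "e \<in> Ob D" "c d \<in> Ob C" "c e \<in> Ob C"
    "u d \<in> Hom D (OMap F (c d)) d" "v e \<in> Hom D e (OMap F (c e))" "h \<in> Hom D d e"
  shows "AMap (inverse_functor c u v) d e h \<in> Hom C (c d) (c e)"
    and "AMap F (c d) (c e) (AMap (inverse_functor c u v) d e h) =
      Cmp D (OMap F (c d)) e (OMap F (c e)) (v e) (Cmp D (OMap F (c d)) d e h (u d))"
proof -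
  let ?h = "Cmp D (OMap F (c d)) e (OMap F (c e)) (v e) (Cmp D (OMap F (c d)) d e h (u d))"
  have "?h \<in> Hom D (OMap F (c d)) (OMap F (c e))" by simp
  then obtain f where "f \<in> Hom C (c d) (c e)" "AMap F (c d) (c e) f = ?h"
    using F_full[of "c d" "c e" ?h] by auto
  then have "?h \<in> AMap F (c d) (c e) ` Hom C (c d) (c e)" by force
  then show "AMap (inverse_functor c u v) d e h \<in> Hom C (c d) (c e)"
    "AMap F (c d) (c e) (AMap (inverse_functor c u v) d e h) = ?h"
    by (auto simp: inverse_functor_def inv_into_into f_inv_into_f)
qed

text \<open>
  Since \<open>F\<close> is faithful, the functor laws need only be verified after applying \<open>F\<close>.
\<close>

lemma inverse_functor_linear:
  assumes c [simp]: "\<And>d. d \<in> Ob D \<Longrightarrow> c d \<in> Ob C"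
    and u [simp]: "\<And>d. d \<in> Ob D \<Longrightarrow> u d \<in> Hom D (OMap F (c d)) d"
    and v [simp]: "\<And>d. d \<in> Ob D \<Longrightarrow> v d \<in> Hom D d (OMap F (c d))"
    and uv: "\<And>d. d \<in> Ob D \<Longrightarrow> Cmp D d (OMap F (c d)) d (u d) (v d) = Idn D d"
    and vu: "\<And>d. d \<in> Ob D \<Longrightarrow> Cmp D (OMap F (c d)) d (OMap F (c d)) (v d) (u d) = Idn D (OMap F (c d))"
  shows "linear_functor K D C (inverse_functor c u v)"
proof -
  have O [simp]: "OMap (inverse_functor c u v) d = c d" for d by (simp add: inverse_functor_def)
  note [simp] = inverse_functor_AMap
  note r = D.Cmp_reassoc[OF uv]
  show ?thesis
  proof (rule D.linear_functorI[OF C.k_linear_category_axioms])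
    fix d assume "d \<in> Ob D"
    then show "AMap (inverse_functor c u v) d d (Idn D d) = Idn C (OMap (inverse_functor c u v) d)"
      by (intro F_eq[of "c d" "c d"]) (simp_all add: vu)
  next
    fix d e f h k assume "d \<in> Ob D" "e \<in> Ob D" "f \<in> Ob D" "h \<in> Hom D d e" "k \<in> Hom D e f"
    then show "AMap (inverse_functor c u v) d f (Cmp D d e f k h) = Cmp C (OMap (inverse_functor c u v) d) (OMap (inverse_functor c u v) e)
        (OMap (inverse_functor c u v) f) (AMap (inverse_functor c u v) e f k) (AMap (inverse_functor c u v) d e h)"
      by (intro F_eq[of "c d" "c f"]) (simp_all add: D.Cmp_assoc' r)
  next
    fix d e h k assume "d \<in> Ob D" "e \<in> Ob D" "h \<in> Hom D d e" "k \<in> Hom D d e"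
    then show "AMap (inverse_functor c u v) d e (h \<oplus>\<^bsub>HMod D d e\<^esub> k) = AMap (inverse_functor c u v) d e h
       \<oplus>\<^bsub>HMod C (OMap (inverse_functor c u v) d) (OMap (inverse_functor c u v) e)\<^esub> AMap (inverse_functor c u v) d e k"
      by (intro F_eq[of "c d" "c e"]) simp_all
  next
    fix d e h a assume "d \<in> Ob D" "e \<in> Ob D" "h \<in> Hom D d e" "a \<in> carrier K"
    then show "AMap (inverse_functor c u v) d e (a \<odot>\<^bsub>HMod D d e\<^esub> h) =
        a \<odot>\<^bsub>HMod C (OMap (inverse_functor c u v) d) (OMap (inverse_functor c u v) e)\<^esub> AMap (inverse_functor c u v) d e h"
      by (intro F_eq[of "c d" "c e"]) (simp_all add: D.Cmp_smult_left D.Cmp_smult_right)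
  qed simp_all
qed

lemma equivalence_of_ess_surj:
  assumes "ess_surj C D F"
  shows "is_equivalence K C D F"
proof -
  have "\<forall>d\<in>Ob D. \<exists>c u v. c \<in> Ob C \<and> u \<in> Hom D (OMap F c) d \<and> v \<in> Hom D d (OMap F c) \<and>
      Cmp D d (OMap F c) d u v = Idn D d \<and> Cmp D (OMap F c) d (OMap F c) v u = Idn D (OMap F c)"
    using assms by (auto simp: ess_surj_def isomorphic_def is_iso_def) blast
  then obtain c u v where c [simp]: "\<And>d. d \<in> Ob D \<Longrightarrow> c d \<in> Ob C"
    and u [simp]: "\<And>d. d \<in> Ob D \<Longrightarrow> u d \<in> Hom D (OMap F (c d)) d"
    and v [simp]: "\<And>d. d \<in> Ob D \<Longrightarrow> v d \<in> Hom D d (OMap F (c d))"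
    and uv: "\<And>d. d \<in> Ob D \<Longrightarrow> Cmp D d (OMap F (c d)) d (u d) (v d) = Idn D d"
    and vu: "\<And>d. d \<in> Ob D \<Longrightarrow> Cmp D (OMap F (c d)) d (OMap F (c d)) (v d) (u d) = Idn D (OMap F (c d))"
    by metis
  let ?G = "inverse_functor c u v"
  have O [simp]: "OMap ?G d = c d" for d by (simp add: inverse_functor_def)
  note [simp] = inverse_functor_AMap
  note ruv = D.Cmp_reassoc[OF uv] and rvu = D.Cmp_reassoc[OF vu]
  have t: "nat_iso D D (comp_functor F ?G) id_functor u"
    unfolding nat_iso_def nat_trans_def
  proof (intro conjI ballI)
    fix d assume [simp]: "d \<in> Ob D"
    show "u d \<in> Hom D (OMap (comp_functor F ?G) d) (OMap id_functor d)" by simp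
    show "is_iso D (OMap (comp_functor F ?G) d) (OMap id_functor d) (u d)"
      by (rule D.isoI[of _ _ _ "v d"]) (simp_all add: uv vu)
    fix e f assume [simp]: "e \<in> Ob D" "f \<in> Hom D d e"
    show "Cmp D (OMap (comp_functor F ?G) d) (OMap (comp_functor F ?G) e) (OMap id_functor e) (u e)
        (AMap (comp_functor F ?G) d e f) =
       Cmp D (OMap (comp_functor F ?G) d) (OMap id_functor d) (OMap id_functor e) (AMap id_functor d e f) (u d)"
      by (simp add: ruv)
  qed
  have "\<forall>x\<in>Ob C. \<exists>s. s \<in> Hom C x (c (OMap F x)) \<and> AMap F x (c (OMap F x)) s = v (OMap F x)"
  proof
    fix x assume [simp]: "x \<in> Ob C"
    show "\<exists>s. s \<in> Hom C x (c (OMap F x)) \<and> AMap F x (c (OMap F x)) s = v (OMap F x)"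
      by (rule F_full[of x "c (OMap F x)" "v (OMap F x)"]) auto
  qed
  then obtain s where s [simp]: "\<And>x. x \<in> Ob C \<Longrightarrow> s x \<in> Hom C x (c (OMap F x))"
    and Fs [simp]: "\<And>x. x \<in> Ob C \<Longrightarrow> AMap F x (c (OMap F x)) (s x) = v (OMap F x)" by metis
  have s: "nat_iso C C id_functor (comp_functor ?G F) s"
    unfolding nat_iso_def nat_trans_def
  proof (intro conjI ballI)
    fix x assume [simp]: "x \<in> Ob C"
    show "s x \<in> Hom C (OMap id_functor x) (OMap (comp_functor ?G F) x)" by simp
    obtain s' where s' [simp]: "s' \<in> Hom C (c (OMap F x)) x" "AMap F (c (OMap F x)) x s' = u (OMap F x)"
      by (rule F_full[of "c (OMap F x)" x "u (OMap F x)"]) auto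
    have "Cmp C x (c (OMap F x)) x s' (s x) = Idn C x"
      by (rule F_eq[of x x]) (simp_all add: uv)
    moreover have "Cmp C (c (OMap F x)) x (c (OMap F x)) (s x) s' = Idn C (c (OMap F x))"
      by (rule F_eq[of "c (OMap F x)" "c (OMap F x)"]) (simp_all add: vu)
    ultimately show "is_iso C (OMap id_functor x) (OMap (comp_functor ?G F) x) (s x)"
      by (intro C.isoI[of _ _ _ s']) simp_all
    fix y f assume [simp]: "y \<in> Ob C" "f \<in> Hom C x y"
    show "Cmp C (OMap id_functor x) (OMap id_functor y) (OMap (comp_functor ?G F) y) (s y) (AMap id_functor x y f) =
       Cmp C (OMap id_functor x) (OMap (comp_functor ?G F) x) (OMap (comp_functor ?G F) y)
        (AMap (comp_functor ?G F) x y f) (s x)"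
      by (simp, rule F_eq[of x "c (OMap F y)"]) (simp_all add: D.Cmp_assoc' uv)
  qed
  show ?thesis
    unfolding is_equivalence_def using linear inverse_functor_linear[of c u v] uv vu s t by auto
qed

lemma isomorphism_of_bij:
  assumes "bij_betw (OMap F) (Ob C) (Ob D)"
  shows "is_isomorphism K C D F"
proof -
  define c where "c = inv_into (Ob C) (OMap F)"
  have im: "OMap F ` Ob C = Ob D" and inj: "inj_on (OMap F) (Ob C)"
    using assms by (auto simp: bij_betw_def)
  have c [simp]: "d \<in> Ob D \<Longrightarrow> c d \<in> Ob C" "d \<in> Ob D \<Longrightarrow> OMap F (c d) = d" for d
    using im by (auto simp: c_def inv_into_into f_inv_into_f)
  have cF [simp]: "x \<in> Ob C \<Longrightarrow> c (OMap F x) = x" for x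
    using inj by (simp add: c_def)
  let ?G = "inverse_functor c (Idn D) (Idn D)"
  have O [simp]: "OMap ?G d = c d" for d by (simp add: inverse_functor_def)
  have l: "linear_functor K D C ?G" by (rule inverse_functor_linear) simp_all
  have A: "AMap ?G d e h \<in> Hom C (c d) (c e)" "AMap F (c d) (c e) (AMap ?G d e h) = h"
    if "d \<in> Ob D" "e \<in> Ob D" "h \<in> Hom D d e" for d e h
    using inverse_functor_AMap[of d e c "Idn D" "Idn D" h] that by simp_all
  have 1: "functor_eq D (comp_functor F ?G) id_functor" by (simp add: functor_eq_def A)
  have "functor_eq C (comp_functor ?G F) id_functor"
    unfolding functor_eq_def
  proof (intro conjI ballI)
    fix x y f assume [simp]: "x \<in> Ob C" "y \<in> Ob C" "f \<in> Hom C x y"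
    have "AMap ?G (OMap F x) (OMap F y) (AMap F x y f) = f"
      using A[of "OMap F x" "OMap F y" "AMap F x y f"] by (intro F_eq[of x y]) simp_all
    then show "AMap (comp_functor ?G F) x y f = AMap id_functor x y f" by simp
  qed simp
  then show ?thesis unfolding is_isomorphism_def using linear l 1 by blast
qed

end

lemma lin_functorI:
  "\<lbrakk>k_linear_category K C; k_linear_category K D; linear_functor K C D F\<rbrakk> \<Longrightarrow> lin_functor K C D F"
  by (simp add: lin_functor_def lin_functor_axioms_def)

lemma ff_functor_of_equivalence:
  assumes "k_linear_category K C" "k_linear_category K D" "is_equivalence K C D F"
  shows "ff_functor K C D F"
proof -
  interpret lin_functor K C D F using assms by (intro lin_functorI) (auto simp: is_equivalence_def)
  show ?thesis by unfold_locales (rule equivalence_ff_ess_surj[OF assms(3)])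
qed

lemma equivalence_trans:
  assumes "k_linear_category K C" "k_linear_category K D" "k_linear_category K E"
    and F: "is_equivalence K C D F" and G: "is_equivalence K D E G"
  shows "is_equivalence K C E (comp_functor G F)"
proof -
  interpret F: ff_functor K C D F using assms ff_functor_of_equivalence by blast
  interpret G: ff_functor K D E G using assms ff_functor_of_equivalence by blast
  have "is_functor C D F" using F.linear by (simp add: linear_functor_def)
  then interpret GF: ff_functor K C E "comp_functor G F"
    using linear_functor_comp[OF F.linear G.linear] fully_faithful_comp[OF _ F.ff G.ff]
    by unfold_locales
  show ?thesis
  proof (rule GF.equivalence_of_ess_surj, unfold ess_surj_def, intro ballI)
    fix e assume e: "e \<in> Ob E"
    then obtain d where d: "d \<in> Ob D" "isomorphic E (OMap G d) e"
      using G.equivalence_ff_ess_surj(2)[OF assms(5)] by (auto simp: ess_surj_def)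
    then obtain c where c: "c \<in> Ob C" "isomorphic D (OMap F c) d"
      using F.equivalence_ff_ess_surj(2)[OF assms(4)] by (auto simp: ess_surj_def)
    obtain f g where [simp]: "f \<in> Hom D (OMap F c) d" "g \<in> Hom D d (OMap F c)"
      "Cmp D (OMap F c) d (OMap F c) g f = Idn D (OMap F c)"
      "Cmp D d (OMap F c) d f g = Idn D d" using c(2) by (rule F.D.isomorphicE)
    have "isomorphic E (OMap G (OMap F c)) (OMap G d)"
      using c d by (intro G.D.isomorphicI[of "AMap G (OMap F c) d f" _ _ "AMap G d (OMap F c) g"])
        (simp_all flip: G.F_Cmp)
    then have "isomorphic E (OMap G (OMap F c)) e"
      by (rule G.D.isomorphic_trans[OF _ d(2)]) (use c d e in simp_all)
    then show "\<exists>c\<in>Ob C. isomorphic E (OMap (comp_functor G F) c) e" using c by auto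
  qed
qed

section \<open>Equivalences between categories with simple systems\<close>

context lin_functor
begin

lemma preserves_null: "null_obj C z \<Longrightarrow> null_obj D (OMap F z)"
  by (metis F_Idn F_Ob F_zero null_obj_def)

lemma preserves_biprod_maps:
  assumes "biprod_maps K C a b y j1 j2 q1 q2"
  shows "biprod_maps K D (OMap F a) (OMap F b) (OMap F y) (AMap F a y j1) (AMap F b y j2)
    (AMap F y a q1) (AMap F y b q2)"
proof -
  interpret B: biprod_maps K C a b y j1 j2 q1 q2 by (rule assms)
  have "AMap F y y (Cmp C y a y j1 q1 \<oplus>\<^bsub>HMod C y y\<^esub> Cmp C y b y j2 q2) = Idn D (OMap F y)" by simp
  then have "Cmp D (OMap F y) (OMap F a) (OMap F y) (AMap F a y j1) (AMap F y a q1)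
    \<oplus>\<^bsub>HMod D (OMap F y) (OMap F y)\<^esub>
    Cmp D (OMap F y) (OMap F b) (OMap F y) (AMap F b y j2) (AMap F y b q2) = Idn D (OMap F y)"
    by (simp del: B.sum_Idn)
  then show ?thesis by (intro D.biprod_mapsI) (simp_all flip: F_Cmp)
qed

lemma preserves_biprod: "is_biprod C a b y \<Longrightarrow> is_biprod D (OMap F a) (OMap F b) (OMap F y)"
  using preserves_biprod_maps unfolding C.is_biprod_iff D.is_biprod_iff by blast

lemma preserves_fsums: "x \<in> fsums C S \<Longrightarrow> OMap F x \<in> fsums D (OMap F ` S)"
  by (induction rule: fsums.induct) (auto intro: fsums.intros preserves_null preserves_biprod)

lemma ff_pairI:
  assumes "x \<in> Ob C" "y \<in> Ob C"
    and "\<And>f g. \<lbrakk>f \<in> Hom C x y; g \<in> Hom C x y; AMap F x y f = AMap F x y g\<rbrakk> \<Longrightarrow> f = g"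
    and "\<And>h. h \<in> Hom D (OMap F x) (OMap F y) \<Longrightarrow> \<exists>f\<in>Hom C x y. AMap F x y f = h"
  shows "ff_pair C D F x y"
  unfolding ff_pair_def by (intro bij_betwI') (use assms in \<open>auto dest: assms(4)\<close>)

lemma ff_pair_eq: "\<lbrakk>ff_pair C D F x y; f \<in> Hom C x y; g \<in> Hom C x y; AMap F x y f = AMap F x y g\<rbrakk> \<Longrightarrow> f = g"
  by (auto simp: ff_pair_def bij_betw_def inj_on_def)

lemma ff_pair_full:
  assumes "ff_pair C D F x y" "h \<in> Hom D (OMap F x) (OMap F y)"
  obtains f where "f \<in> Hom C x y" "AMap F x y f = h"
  using assms unfolding ff_pair_def bij_betw_def by (metis imageE)

lemma ff_pair_null_left:
  assumes z: "null_obj C z" and [simp]: "y \<in> Ob C"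
  shows "ff_pair C D F z y"
proof -
  have [simp]: "z \<in> Ob C" using z by (simp add: null_obj_def)
  show ?thesis
  proof (rule ff_pairI)
    show "f = g" if "f \<in> Hom C z y" "g \<in> Hom C z y" for f g
      using C.null_obj_from[OF z _ that(1)] C.null_obj_from[OF z _ that(2)] by simp
    show "\<exists>f\<in>Hom C z y. AMap F z y f = h" if "h \<in> Hom D (OMap F z) (OMap F y)" for h
      using that D.null_obj_from[OF preserves_null[OF z]]
      by (intro bexI[of _ "zero_arr C z y"]) simp_all
  qed simp_all
qed

lemma ff_pair_null_right:
  assumes z: "null_obj C z" and [simp]: "y \<in> Ob C"
  shows "ff_pair C D F y z"
proof -
  have [simp]: "z \<in> Ob C" using z by (simp add: null_obj_def)
  show ?thesis
  proof (rule ff_pairI)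
    show "f = g" if "f \<in> Hom C y z" "g \<in> Hom C y z" for f g
      using C.null_obj_into[OF z _ that(1)] C.null_obj_into[OF z _ that(2)] by simp
    show "\<exists>f\<in>Hom C y z. AMap F y z f = h" if "h \<in> Hom D (OMap F y) (OMap F z)" for h
      using that D.null_obj_into[OF preserves_null[OF z]]
      by (intro bexI[of _ "zero_arr C y z"]) simp_all
  qed simp_all
qed

text \<open>
  Maps out of a biproduct are pairs of maps out of the summands, and \<open>F\<close> preserves biproducts.
\<close>

lemma ff_pair_biprod_left:
  assumes b: "is_biprod C a b x" and ay: "ff_pair C D F a y" and "ff_pair C D F b y" and [simp]: "y \<in> Ob C"
  shows "ff_pair C D F x y"
proof -
  obtain j1 j2 q1 q2 where bm: "biprod_maps K C a b x j1 j2 q1 q2" using C.is_biprodE[OF b] .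
  interpret B: biprod_maps K C a b x j1 j2 q1 q2 by (rule bm)
  interpret B': biprod_maps K D "OMap F a" "OMap F b" "OMap F x" "AMap F a x j1" "AMap F b x j2"
    "AMap F x a q1" "AMap F x b q2" by (rule preserves_biprod_maps[OF bm])
  show ?thesis
  proof (rule ff_pairI)
    fix f g assume [simp]: "f \<in> Hom C x y" "g \<in> Hom C x y" and e: "AMap F x y f = AMap F x y g"
    have "Cmp C a x y f j1 = Cmp C a x y g j1" by (rule ff_pair_eq[OF ay]) (simp_all add: e)
    moreover have "Cmp C b x y f j2 = Cmp C b x y g j2" by (rule ff_pair_eq[OF assms(3)]) (simp_all add: e)
    ultimately have "Cmp C x a y (Cmp C a x y f j1) q1 \<oplus>\<^bsub>HMod C x y\<^esub> Cmp C x b y (Cmp C b x y f j2) q2 = g"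
      by (simp add: B.split_source)
    then show "f = g" by (simp add: B.split_source)
  next
    fix h assume [simp]: "h \<in> Hom D (OMap F x) (OMap F y)"
    obtain f1 where f1 [simp]: "f1 \<in> Hom C a y"
      and e1: "AMap F a y f1 = Cmp D (OMap F a) (OMap F x) (OMap F y) h (AMap F a x j1)"
      by (rule ff_pair_full[OF ay, of "Cmp D (OMap F a) (OMap F x) (OMap F y) h (AMap F a x j1)"]) simp_all
    obtain f2 where f2 [simp]: "f2 \<in> Hom C b y"
      and e2: "AMap F b y f2 = Cmp D (OMap F b) (OMap F x) (OMap F y) h (AMap F b x j2)"
      by (rule ff_pair_full[OF assms(3), of "Cmp D (OMap F b) (OMap F x) (OMap F y) h (AMap F b x j2)"]) simp_all
    have "AMap F x y (Cmp C x a y f1 q1 \<oplus>\<^bsub>HMod C x y\<^esub> Cmp C x b y f2 q2) = h"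
      using B'.split_source[of "OMap F y" h, folded e1 e2] by simp
    then show "\<exists>f\<in>Hom C x y. AMap F x y f = h"
      by (intro bexI[of _ "Cmp C x a y f1 q1 \<oplus>\<^bsub>HMod C x y\<^esub> Cmp C x b y f2 q2"]) simp_all
  qed simp_all
qed

lemma ff_pair_biprod_right:
  assumes b: "is_biprod C a b x" and ay: "ff_pair C D F y a" and "ff_pair C D F y b" and [simp]: "y \<in> Ob C"
  shows "ff_pair C D F y x"
proof -
  obtain j1 j2 q1 q2 where bm: "biprod_maps K C a b x j1 j2 q1 q2" using C.is_biprodE[OF b] .
  interpret B: biprod_maps K C a b x j1 j2 q1 q2 by (rule bm)
  interpret B': biprod_maps K D "OMap F a" "OMap F b" "OMap F x" "AMap F a x j1" "AMap F b x j2"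
    "AMap F x a q1" "AMap F x b q2" by (rule preserves_biprod_maps[OF bm])
  show ?thesis
  proof (rule ff_pairI)
    fix f g assume [simp]: "f \<in> Hom C y x" "g \<in> Hom C y x" and e: "AMap F y x f = AMap F y x g"
    have "Cmp C y x a q1 f = Cmp C y x a q1 g" by (rule ff_pair_eq[OF ay]) (simp_all add: e)
    moreover have "Cmp C y x b q2 f = Cmp C y x b q2 g" by (rule ff_pair_eq[OF assms(3)]) (simp_all add: e)
    ultimately have "Cmp C y a x j1 (Cmp C y x a q1 f) \<oplus>\<^bsub>HMod C y x\<^esub> Cmp C y b x j2 (Cmp C y x b q2 f) = g"
      by (simp add: B.split_target)
    then show "f = g" by (simp add: B.split_target)
  next
    fix h assume [simp]: "h \<in> Hom D (OMap F y) (OMap F x)"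
    obtain f1 where f1 [simp]: "f1 \<in> Hom C y a"
      and e1: "AMap F y a f1 = Cmp D (OMap F y) (OMap F x) (OMap F a) (AMap F x a q1) h"
      by (rule ff_pair_full[OF ay, of "Cmp D (OMap F y) (OMap F x) (OMap F a) (AMap F x a q1) h"]) simp_all
    obtain f2 where f2 [simp]: "f2 \<in> Hom C y b"
      and e2: "AMap F y b f2 = Cmp D (OMap F y) (OMap F x) (OMap F b) (AMap F x b q2) h"
      by (rule ff_pair_full[OF assms(3), of "Cmp D (OMap F y) (OMap F x) (OMap F b) (AMap F x b q2) h"]) simp_all
    have "AMap F y x (Cmp C y a x j1 f1 \<oplus>\<^bsub>HMod C y x\<^esub> Cmp C y b x j2 f2) = h"
      using B'.split_target[of "OMap F y" h, folded e1 e2] by simp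
    then show "\<exists>f\<in>Hom C y x. AMap F y x f = h"
      by (intro bexI[of _ "Cmp C y a x j1 f1 \<oplus>\<^bsub>HMod C y x\<^esub> Cmp C y b x j2 f2"]) simp_all
  qed simp_all
qed

text \<open>
  Full faithfulness extends from \<open>S\<close> to finite sums in each variable separately. Essential
  surjectivity follows by rebuilding an object of \<open>D\<close> from its summands in \<open>C\<close>.
\<close>

theorem equivalence_of_ff_on_simples:
  assumes sys: "simple_system C S" and gen: "Ob D \<subseteq> fsums D (OMap F ` S)"
    and ffS: "\<And>s t. \<lbrakk>s \<in> S; t \<in> S\<rbrakk> \<Longrightarrow> ff_pair C D F s t"
  shows "is_equivalence K C D F"
proof -
  have S: "S \<subseteq> Ob C" and add: "additive C" and fs: "Ob C \<subseteq> fsums C S"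
    using sys by (auto simp: simple_system_def schur_family_def)
  have 1: "ff_pair C D F s y" if s: "s \<in> S" and "y \<in> fsums C S" for s y
    using that(2)
  proof (induction rule: fsums.induct)
    case (null z) then show ?case using s S ff_pair_null_right by blast
  next
    case (add x t y) then show ?case using s S ffS ff_pair_biprod_right by blast
  qed
  have 2: "ff_pair C D F x y" if y: "y \<in> fsums C S" and "x \<in> fsums C S" for x y
    using that(2)
  proof (induction rule: fsums.induct)
    case (null z) then show ?case using fsums_subset_Ob[OF y] ff_pair_null_left by blast
  next
    case (add x t z) then show ?case using fsums_subset_Ob[OF y] ff_pair_biprod_left 1 y by blast
  qed
  interpret F: ff_functor K C D F
    by unfold_locales (use 2 fs in \<open>auto simp: fully_faithful_def\<close>)
  have "\<exists>c\<in>Ob C. isomorphic D (OMap F c) d" if "d \<in> fsums D (OMap F ` S)" for d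
    using that
  proof (induction rule: fsums.induct)
    case (null d)
    obtain z where "null_obj C z" using add by (auto simp: additive_def)
    then show ?case
      using D.null_objs_isomorphic[OF preserves_null null] by (auto simp: null_obj_def)
  next
    case (add d' t d)
    then obtain c s where c [simp]: "c \<in> Ob C" and i: "isomorphic D (OMap F c) d'" and s: "s \<in> S" "t = OMap F s"
      by blast
    obtain y where y: "is_biprod C c s y" using assms s S c \<open>additive C\<close> unfolding additive_def by blast
    then have [simp]: "y \<in> Ob C" by (simp add: is_biprod_def)
    have dd: "d' \<in> Ob D" "t \<in> Ob D" using add(3) by (auto simp: is_biprod_def)
    have "is_biprod D (OMap F c) (OMap F s) (OMap F y)" using preserves_biprod[OF y] .
    then have "is_biprod D d' t (OMap F y)"
      by (rule D.is_biprod_iso) (use i dd s S in \<open>auto intro: D.isomorphic_refl\<close>)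
    then have "isomorphic D (OMap F y) d" using D.biprod_unique add(3) by blast
    then show ?case by (intro bexI[of _ y]) simp_all
  qed
  then have "ess_surj C D F" using gen unfolding ess_surj_def by blast
  then show ?thesis by (rule F.equivalence_of_ess_surj)
qed

end

lemma (in ff_functor) schur_family_image:
  assumes sch: "schur_family C S"
  shows "schur_family D (OMap F ` S)"
proof -
  have S: "S \<subseteq> Ob C" using sch by (simp add: schur_family_def)
  show ?thesis
      unfolding schur_family_def
    proof (intro conjI ballI impI)
      show "OMap F ` S \<subseteq> Ob D" using S by auto
      fix s' assume "s' \<in> OMap F ` S"
      then obtain s where s: "s \<in> S" "s' = OMap F s" "s \<in> Ob C" using S by blast
      show "Idn D s' \<noteq> zero_arr D s' s'"
      proof
        assume "Idn D s' = zero_arr D s' s'"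
        then have "AMap F s s (Idn C s) = AMap F s s (zero_arr C s s)" using s by simp
        then have "Idn C s = zero_arr C s s" by (rule F_eq) (use s in simp_all)
        then show False using sch s by (simp add: schur_family_def)
      qed
      fix t' h assume "t' \<in> OMap F ` S" and h: "h \<in> Hom D s' t'" and nz: "h \<noteq> zero_arr D s' t'"
      then obtain t where t: "t \<in> S" "t' = OMap F t" "t \<in> Ob C" using S by blast
      obtain f where f: "f \<in> Hom C s t" "AMap F s t f = h" using F_full[of s t h] h s t by auto
      have "f \<noteq> zero_arr C s t" using f nz s t by auto
      then have st: "s = t" and i: "is_iso C s t f" using schur_familyD[OF sch s(1) t(1) f(1)] by auto
      then show "s' = t'" using s t by simp
      obtain g where g: "g \<in> Hom C t s" "Cmp C s t s g f = Idn C s" "Cmp C t s t f g = Idn C t"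
        using i by (auto simp: is_iso_def)
      show "is_iso D s' t' h"
        by (rule D.isoI[of _ _ _ "AMap F t s g"])
          (use h s t f(1) g in \<open>simp_all flip: f(2) F_Cmp\<close>)
    qed
qed

theorem (in ff_functor) simple_system_transport:
  assumes es: "ess_surj C D F" and sys: "simple_system C S"
  shows "simple_system D (OMap F ` S)"
proof -
  have S: "S \<subseteq> Ob C" and add: "additive C" and sch: "schur_family C S" and fs: "Ob C \<subseteq> fsums C S"
    using sys by (auto simp: simple_system_def schur_family_def)
  have "additive D"
    unfolding additive_def
  proof (intro conjI ballI)
    show "\<exists>z. null_obj D z" using add preserves_null by (auto simp: additive_def)
    fix d e assume de: "d \<in> Ob D" "e \<in> Ob D"
    obtain a where a: "a \<in> Ob C" "isomorphic D (OMap F a) d" using es de by (auto simp: ess_surj_def)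
    obtain b where b: "b \<in> Ob C" "isomorphic D (OMap F b) e" using es de by (auto simp: ess_surj_def)
    obtain y where y: "is_biprod C a b y" using add a b by (auto simp: additive_def)
    then have "y \<in> Ob C" by (simp add: is_biprod_def)
    then have "is_biprod D d e (OMap F y)"
      using D.is_biprod_iso[OF preserves_biprod[OF y] a(2) b(2) D.isomorphic_refl] de by simp
    then show "\<exists>y. is_biprod D d e y" ..
  qed
  moreover have "schur_family D (OMap F ` S)" by (rule schur_family_image[OF sch])
  moreover have "Ob D \<subseteq> fsums D (OMap F ` S)"
  proof
    fix d assume d: "d \<in> Ob D"
    then obtain c where c: "c \<in> Ob C" "isomorphic D (OMap F c) d" using es by (auto simp: ess_surj_def)
    then have "OMap F c \<in> fsums D (OMap F ` S)" using fs preserves_fsums by blast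
    then show "d \<in> fsums D (OMap F ` S)" by (rule D.fsums_iso[OF _ c(2) d]) (use S in auto)
  qed
  ultimately show ?thesis by (simp add: simple_system_def)
qed

section \<open>Finite colimits of finite sums\<close>

definition discrete_cat :: "nat \<Rightarrow> (nat, nat) cat"
  where "discrete_cat n = \<lparr>Ob = {..<n}, Hom = (\<lambda>i j. if i = j then {0} else {}),
    Cmp = (\<lambda>_ _ _ _ _. 0), Idn = (\<lambda>_. 0)\<rparr>"

definition discrete_diagram :: "('k, 'o, 'a) lcat \<Rightarrow> (nat \<Rightarrow> 'o) \<Rightarrow> (nat, nat, 'o, 'a) fnctr"
  where "discrete_diagram C x = \<lparr>OMap = x, AMap = (\<lambda>i j f. Idn C (x i))\<rparr>"

lemma finite_discrete_cat: "finite_category (discrete_cat n)"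
  unfolding finite_category_def by (auto simp: discrete_cat_def category_def split: if_splits)

lemma is_cokernelD:
  assumes "is_cokernel C x y f z q"
  shows "z \<in> Ob C" "q \<in> Hom C y z" "Cmp C x y z q f = zero_arr C x z"
    "\<And>w h. \<lbrakk>w \<in> Ob C; h \<in> Hom C y w; Cmp C x y w h f = zero_arr C x w\<rbrakk> \<Longrightarrow>
      \<exists>!u. u \<in> Hom C z w \<and> Cmp C y z w u q = h"
  using assms unfolding is_cokernel_def is_kernel_def opcat_simps by blast+

text \<open>
  A coproduct of the objects \<open>x i\<close>, stated for a set of indices in place of an index category.
\<close>

definition coproduct_cocone ::
  "('k, 'o, 'a) lcat \<Rightarrow> 'i set \<Rightarrow> ('i \<Rightarrow> 'o) \<Rightarrow> 'o \<Rightarrow> ('i \<Rightarrow> 'a) \<Rightarrow> bool"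
  where "coproduct_cocone C I x p inc \<longleftrightarrow> (\<forall>i\<in>I. inc i \<in> Hom C (x i) p) \<and>
    (\<forall>w\<in>Ob C. \<forall>h. (\<forall>i\<in>I. h i \<in> Hom C (x i) w) \<longrightarrow>
      (\<exists>u\<in>Hom C p w. \<forall>i\<in>I. Cmp C (x i) p w u (inc i) = h i)) \<and>
    (\<forall>w\<in>Ob C. \<forall>u\<in>Hom C p w. \<forall>v\<in>Hom C p w.
      (\<forall>i\<in>I. Cmp C (x i) p w u (inc i) = Cmp C (x i) p w v (inc i)) \<longrightarrow> u = v)"

lemma coproduct_coconeD:
  assumes "coproduct_cocone C I x p inc"
  shows "\<And>i. i \<in> I \<Longrightarrow> inc i \<in> Hom C (x i) p"
    and "\<And>w h. \<lbrakk>w \<in> Ob C; \<And>i. i \<in> I \<Longrightarrow> h i \<in> Hom C (x i) w\<rbrakk>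
      \<Longrightarrow> \<exists>u\<in>Hom C p w. \<forall>i\<in>I. Cmp C (x i) p w u (inc i) = h i"
    and "\<And>w u v. \<lbrakk>w \<in> Ob C; u \<in> Hom C p w; v \<in> Hom C p w;
      \<And>i. i \<in> I \<Longrightarrow> Cmp C (x i) p w u (inc i) = Cmp C (x i) p w v (inc i)\<rbrakk> \<Longrightarrow> u = v"
  using assms by (simp_all add: coproduct_cocone_def)

text \<open>
  The universal map out of \<open>p\<close> that composes to zero with every \<open>d r\<close>.
\<close>

definition joint_cokernel ::
  "('k, 'o, 'a) lcat \<Rightarrow> 'o \<Rightarrow> 'i set \<Rightarrow> ('i \<Rightarrow> 'o) \<Rightarrow> ('i \<Rightarrow> 'a) \<Rightarrow> 'o \<Rightarrow> 'a \<Rightarrow> bool"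
  where "joint_cokernel C p R a d q h \<longleftrightarrow> h \<in> Hom C p q \<and>
    (\<forall>r\<in>R. Cmp C (a r) p q h (d r) = zero_arr C (a r) q) \<and>
    (\<forall>w\<in>Ob C. \<forall>g\<in>Hom C p w. (\<forall>r\<in>R. Cmp C (a r) p w g (d r) = zero_arr C (a r) w) \<longrightarrow>
      (\<exists>u\<in>Hom C q w. Cmp C p q w u h = g)) \<and>
    (\<forall>w\<in>Ob C. \<forall>u\<in>Hom C q w. \<forall>v\<in>Hom C q w. Cmp C p q w u h = Cmp C p q w v h \<longrightarrow> u = v)"

lemma joint_cokernelD:
  assumes "joint_cokernel C p R a d q h"
  shows "h \<in> Hom C p q"
    and "\<And>r. r \<in> R \<Longrightarrow> Cmp C (a r) p q h (d r) = zero_arr C (a r) q"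
    and "\<And>w g. \<lbrakk>w \<in> Ob C; g \<in> Hom C p w;
        \<And>r. r \<in> R \<Longrightarrow> Cmp C (a r) p w g (d r) = zero_arr C (a r) w\<rbrakk>
      \<Longrightarrow> \<exists>u\<in>Hom C q w. Cmp C p q w u h = g"
    and "\<And>w u v. \<lbrakk>w \<in> Ob C; u \<in> Hom C q w; v \<in> Hom C q w; Cmp C p q w u h = Cmp C p q w v h\<rbrakk> \<Longrightarrow> u = v"
  using assms by (simp_all add: joint_cokernel_def)

context k_linear_category
begin

lemma discrete_diagram_functor:
  "\<lbrakk>\<And>i. i < n \<Longrightarrow> x i \<in> S; S \<subseteq> Ob C\<rbrakk>
    \<Longrightarrow> is_functor (discrete_cat n) (full_subcat C S) (discrete_diagram C x)"
  by (auto simp: is_functor_def discrete_cat_def discrete_diagram_def subset_iff split: if_splits)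

lemma null_in_closed:
  assumes "closed_finite_colimits C S" "S \<subseteq> Ob C" "null_obj C z"
  shows "z \<in> S"
proof -
  have "is_colimit (discrete_cat 0) C (discrete_diagram C (\<lambda>_. z)) z (\<lambda>_. undefined)"
    using assms(3)[unfolded null_obj_iff_zero]
    by (auto simp: is_colimit_def is_cocone_def discrete_cat_def is_zero_obj_def)
  moreover have "is_functor (discrete_cat 0) (full_subcat C S) (discrete_diagram C (\<lambda>_. z))"
    using assms(2) by (intro discrete_diagram_functor) auto
  ultimately show ?thesis
    using assms(1) finite_discrete_cat unfolding closed_finite_colimits_def by blast
qed

lemma biprod_in_closed:
  assumes "closed_finite_colimits C S" "S \<subseteq> Ob C" "a \<in> S" "b \<in> S" "is_biprod C a b y"
  shows "y \<in> S"
proof -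
  obtain j1 j2 q1 q2 where "biprod_maps K C a b y j1 j2 q1 q2" using is_biprodE[OF assms(5)] .
  then interpret B: biprod_maps K C a b y j1 j2 q1 q2 .
  define x where "x = (\<lambda>i::nat. if i = 0 then a else b)"
  define t where "t = (\<lambda>i::nat. if i = 0 then j1 else j2)"
  have two: "i < 2 \<longleftrightarrow> i = 0 \<or> i = 1" for i :: nat by auto
  have [simp]: "x i \<in> Ob C" "t i \<in> Hom C (x i) y" for i by (simp_all add: x_def t_def)
  have "is_colimit (discrete_cat 2) C (discrete_diagram C x) y t"
    unfolding is_colimit_def
  proof (intro conjI allI impI)
    show "is_cocone (discrete_cat 2) C (discrete_diagram C x) y t"
      by (auto simp: is_cocone_def discrete_cat_def discrete_diagram_def split: if_splits)
    fix w h assume "is_cocone (discrete_cat 2) C (discrete_diagram C x) w h"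
    then have [simp]: "w \<in> Ob C" and "\<And>i. i < 2 \<Longrightarrow> h i \<in> Hom C (x i) w"
      by (auto simp: is_cocone_def discrete_cat_def discrete_diagram_def)
    from this(2)[of 0] this(2)[of 1] have [simp]: "h 0 \<in> Hom C a w" "h (Suc 0) \<in> Hom C b w"
      by (simp_all add: x_def)
    have h2: "u \<in> Hom C y w \<and> (\<forall>i\<in>Ob (discrete_cat 2).
          Cmp C (OMap (discrete_diagram C x) i) y w u (t i) = h i) \<longleftrightarrow>
        u \<in> Hom C y w \<and> Cmp C a y w u j1 = h 0 \<and> Cmp C b y w u j2 = h (Suc 0)" for u
      by (auto simp: discrete_cat_def discrete_diagram_def two x_def t_def Ball_def)
    have uni: "u = Cmp C y a w (h 0) q1 \<oplus>\<^bsub>HMod C y w\<^esub> Cmp C y b w (h (Suc 0)) q2"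
      if "u \<in> Hom C y w" "Cmp C a y w u j1 = h 0" "Cmp C b y w u j2 = h (Suc 0)" for u
      using B.split_source[of w u] that by simp
    show "\<exists>!u. u \<in> Hom C y w \<and> (\<forall>i\<in>Ob (discrete_cat 2). Cmp C (OMap (discrete_diagram C x) i) y w u (t i) = h i)"
      unfolding h2
      by (rule ex1I[of _ "Cmp C y a w (h 0) q1 \<oplus>\<^bsub>HMod C y w\<^esub> Cmp C y b w (h (Suc 0)) q2"])
        (auto simp: Cmp_assoc' intro: uni)
  qed
  moreover have "is_functor (discrete_cat 2) (full_subcat C S) (discrete_diagram C x)"
    using assms by (intro discrete_diagram_functor) (auto simp: x_def)
  ultimately show ?thesis
    using assms(1) finite_discrete_cat unfolding closed_finite_colimits_def by blast
qed

text \<open>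
  Zero objects and biproducts are colimits of diagrams without arrows on no and on two objects.
\<close>

lemma fsums_least:
  assumes "closed_finite_colimits C T" "T \<subseteq> Ob C" "S \<subseteq> T"
  shows "fsums C S \<subseteq> T"
proof
  fix x assume "x \<in> fsums C S"
  then show "x \<in> T"
  proof (induction rule: fsums.induct)
    case (null z) then show ?case by (rule null_in_closed[OF assms(1,2)])
  next
    case (add x s y)
    then show ?case using biprod_in_closed[OF assms(1,2) _ _ add(3)] assms(3) by blast
  qed
qed

lemma finite_coproduct:
  assumes "additive C" "S \<subseteq> Ob C" "finite I" "\<And>i. i \<in> I \<Longrightarrow> x i \<in> fsums C S"
  shows "\<exists>p inc. p \<in> fsums C S \<and> coproduct_cocone C I x p inc"
  using assms(3,4)
proof (induction I rule: finite_induct)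
  case empty
  obtain z where z: "null_obj C z" using assms(1) by (auto simp: additive_def)
  then have "z \<in> Ob C" by (simp add: null_obj_def)
  moreover have "u = v" if "w \<in> Ob C" "u \<in> Hom C z w" "v \<in> Hom C z w" for u v w
    using null_obj_from[OF z that(1,2)] null_obj_from[OF z that(1,3)] by simp
  moreover have "\<exists>u. u \<in> Hom C z w" if "w \<in> Ob C" for w
    using zero_in_Hom[OF \<open>z \<in> Ob C\<close> that] by blast
  ultimately show ?case
    using fsums.null[OF z] by (auto intro!: exI[of _ z] simp: coproduct_cocone_def)
next
  case (insert k I)
  then obtain p inc where p: "p \<in> fsums C S" and pc: "coproduct_cocone C I x p inc"
    by blast
  note inc = coproduct_coconeD(1)[OF pc] and ex = coproduct_coconeD(2)[OF pc]
    and uni = coproduct_coconeD(3)[OF pc]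
  have xo: "\<And>i. i \<in> insert k I \<Longrightarrow> x i \<in> Ob C" by (rule fsums_subset_Ob[OF insert.prems])
  have [simp]: "p \<in> Ob C" "x k \<in> Ob C" "i \<in> I \<Longrightarrow> x i \<in> Ob C" for i
    using fsums_subset_Ob[OF p] xo by auto
  obtain y where y: "is_biprod C p (x k) y"
    using assms(1) \<open>p \<in> Ob C\<close> \<open>x k \<in> Ob C\<close> unfolding additive_def by blast
  have yfs: "y \<in> fsums C S" using fsums_biprod[OF assms(1,2) p _ y] insert.prems by simp
  obtain j1 j2 q1 q2 where "biprod_maps K C p (x k) y j1 j2 q1 q2" using is_biprodE[OF y] .
  then interpret B: biprod_maps K C p "x k" y j1 j2 q1 q2 .
  define inj' where "inj' i = (if i = k then j2 else Cmp C (x i) p y j1 (inc i))" for i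
  note [simp] = inc
  have inj' [simp]: "inj' k = j2" "i \<in> I \<Longrightarrow> inj' i = Cmp C (x i) p y j1 (inc i)" for i
    using insert.hyps by (auto simp: inj'_def)
  show ?case
    unfolding coproduct_cocone_def
  proof (rule exI[of _ y], rule exI[of _ inj'], intro conjI ballI allI impI)
    show "y \<in> fsums C S" by (rule yfs)
    show "inj' i \<in> Hom C (x i) y" if "i \<in> insert k I" for i using that by auto
    fix w assume [simp]: "w \<in> Ob C"
    show "\<exists>u\<in>Hom C y w. \<forall>i\<in>insert k I. Cmp C (x i) y w u (inj' i) = h i"
      if "\<forall>i\<in>insert k I. h i \<in> Hom C (x i) w" for h
    proof -
      have [simp]: "h k \<in> Hom C (x k) w" "i \<in> I \<Longrightarrow> h i \<in> Hom C (x i) w" for i using that by auto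
      obtain u where [simp]: "u \<in> Hom C p w" and u: "\<And>i. i \<in> I \<Longrightarrow> Cmp C (x i) p w u (inc i) = h i"
        using ex[of w h] by auto
      show ?thesis
        by (intro bexI[of _ "Cmp C y p w u q1 \<oplus>\<^bsub>HMod C y w\<^esub> Cmp C y (x k) w (h k) q2"])
          (auto simp: Cmp_assoc' u)
    qed
    fix u v assume [simp]: "u \<in> Hom C y w" "v \<in> Hom C y w"
      and e: "\<forall>i\<in>insert k I. Cmp C (x i) y w u (inj' i) = Cmp C (x i) y w v (inj' i)"
    have 1: "Cmp C p y w u j1 = Cmp C p y w v j1"
    proof (rule uni)
      fix i assume i: "i \<in> I"
      then show "Cmp C (x i) p w (Cmp C p y w u j1) (inc i) = Cmp C (x i) p w (Cmp C p y w v j1) (inc i)"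
        using e by (simp add: Cmp_assoc')
    qed simp_all
    moreover have "Cmp C (x k) y w u j2 = Cmp C (x k) y w v j2" using e by simp
    ultimately have "Cmp C y p w (Cmp C p y w u j1) q1 \<oplus>\<^bsub>HMod C y w\<^esub>
        Cmp C y (x k) w (Cmp C (x k) y w u j2) q2 = v"
      by (simp add: B.split_source)
    then show "u = v" by (simp add: B.split_source)
  qed
qed

text \<open>
  The maps \<open>d r\<close> are made zero one after the other, by passing to the cokernel of the next map into
  the quotient obtained so far.
\<close>

lemma joint_cokernel_exists:
  assumes m: "maps_split C B" and p: "p \<in> B" and "finite R"
    and "\<And>r. r \<in> R \<Longrightarrow> a r \<in> B \<and> d r \<in> Hom C (a r) p"
  shows "\<exists>q h. q \<in> B \<and> joint_cokernel C p R a d q h"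
  using assms(3,4)
proof (induction R rule: finite_induct)
  case empty
  have [simp]: "p \<in> Ob C" using m p by (auto simp: maps_split_def)
  show ?case using p
    by (intro exI[of _ p] exI[of _ "Idn C p"]) (auto simp: joint_cokernel_def)
next
  case (insert k R)
  then obtain q h where q: "q \<in> B" and qc: "joint_cokernel C p R a d q h"
    by blast
  note h [simp] = joint_cokernelD(1)[OF qc] and hd = joint_cokernelD(2)[OF qc]
    and ex = joint_cokernelD(3)[OF qc] and uni = joint_cokernelD(4)[OF qc]
  have BO: "B \<subseteq> Ob C" using m by (simp add: maps_split_def)
  have t [simp]: "a k \<in> B" "d k \<in> Hom C (a k) p" "r \<in> R \<Longrightarrow> a r \<in> B" "r \<in> R \<Longrightarrow> d r \<in> Hom C (a r) p" for r
    using insert.prems by auto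
  have [simp]: "p \<in> Ob C" "q \<in> Ob C" "a k \<in> Ob C" "r \<in> R \<Longrightarrow> a r \<in> Ob C" for r
    using BO p q t by auto
  have "Cmp C (a k) p q h (d k) \<in> Hom C (a k) q" by simp
  then obtain z c where z: "z \<in> B" and c: "is_cokernel C (a k) q (Cmp C (a k) p q h (d k)) z c"
    using cokernel_exists[OF m t(1) q] by blast
  note cD = is_cokernelD[OF c]
  have [simp]: "z \<in> Ob C" "c \<in> Hom C q z" using cD by auto
  have chd: "Cmp C (a k) p z (Cmp C p q z c h) (d k) = zero_arr C (a k) z"
    using cD(3) by (simp add: Cmp_assoc')
  show ?case
    unfolding joint_cokernel_def
  proof (rule exI[of _ z], rule exI[of _ "Cmp C p q z c h"], intro conjI ballI impI)
    show "z \<in> B" by (rule z)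
    show "Cmp C (a r) p z (Cmp C p q z c h) (d r) = zero_arr C (a r) z" if "r \<in> insert k R" for r
      using that chd by (auto simp: Cmp_assoc' hd)
    fix w assume [simp]: "w \<in> Ob C"
    show "\<exists>u\<in>Hom C z w. Cmp C p z w u (Cmp C p q z c h) = g"
      if [simp]: "g \<in> Hom C p w" and g: "\<forall>r\<in>insert k R. Cmp C (a r) p w g (d r) = zero_arr C (a r) w" for g
    proof -
      obtain u where [simp]: "u \<in> Hom C q w" and u: "Cmp C p q w u h = g" using ex[of w g] g by auto
      have "Cmp C (a k) q w u (Cmp C (a k) p q h (d k)) = zero_arr C (a k) w"
        using g by (simp add: Cmp_assoc u)
      then obtain u' where "u' \<in> Hom C z w" "Cmp C q z w u' c = u" using cD(4)[of w u] by auto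
      then show ?thesis by (intro bexI[of _ u']) (simp_all add: Cmp_assoc u)
    qed
    fix u v assume [simp]: "u \<in> Hom C z w" "v \<in> Hom C z w"
      and e: "Cmp C p z w u (Cmp C p q z c h) = Cmp C p z w v (Cmp C p q z c h)"
    have uv: "Cmp C q z w u c = Cmp C q z w v c" by (rule uni[of w]) (use e in \<open>simp_all add: Cmp_assoc\<close>)
    have "\<exists>!u'. u' \<in> Hom C z w \<and> Cmp C q z w u' c = Cmp C q z w v c"
      by (rule cD(4)) (simp_all add: Cmp_assoc' cD(3))
    then show "u = v" using uv \<open>u \<in> Hom C z w\<close> \<open>v \<in> Hom C z w\<close> by blast
  qed simp
qed

text \<open>
  A colimit of \<open>D\<close> is the quotient \<open>q\<close> of the coproduct of the objects \<open>D i\<close> by the relations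
  \<open>inc j \<circ> D f = inc i\<close>, one for each arrow \<open>f : i \<rightarrow> j\<close>. For a finite diagram of finite sums, the
  constructions above yield \<open>q\<close> as a finite sum with the universal property with respect to all
  objects of \<open>C\<close>. An arbitrary colimit in \<open>C\<close> is therefore isomorphic to \<open>q\<close>.
\<close>

lemma fsums_closed_finite_colimits:
  assumes add: "additive C" and sch: "schur_family C S"
  shows "closed_finite_colimits C (fsums C S)"
  unfolding closed_finite_colimits_def
proof (intro allI impI)
  fix J :: "(nat, nat) cat" and D c t
  assume J: "finite_category J" and "is_functor J (full_subcat C (fsums C S)) D"
    and col: "is_colimit J C D c t"
  then have Df: "\<And>i. i \<in> Ob J \<Longrightarrow> OMap D i \<in> fsums C S"
    and Da [simp]: "\<And>i j f. \<lbrakk>i \<in> Ob J; j \<in> Ob J; f \<in> Hom J i j\<rbrakk> \<Longrightarrow> AMap D i j f \<in> Hom C (OMap D i) (OMap D j)"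
    by (simp_all add: is_functor_def)
  have S: "S \<subseteq> Ob C" using sch by (simp add: schur_family_def)
  have Do [simp]: "i \<in> Ob J \<Longrightarrow> OMap D i \<in> Ob C" for i by (rule fsums_subset_Ob[OF Df])
  have cc: "is_cocone J C D c t"
    and cex: "\<And>w h. is_cocone J C D w h \<Longrightarrow>
      \<exists>!u. u \<in> Hom C c w \<and> (\<forall>i\<in>Ob J. Cmp C (OMap D i) c w u (t i) = h i)"
    using col by (auto simp: is_colimit_def)
  have c [simp]: "c \<in> Ob C" and t [simp]: "\<And>i. i \<in> Ob J \<Longrightarrow> t i \<in> Hom C (OMap D i) c"
    and tD: "\<And>i j f. \<lbrakk>i \<in> Ob J; j \<in> Ob J; f \<in> Hom J i j\<rbrakk> \<Longrightarrow>
      Cmp C (OMap D i) (OMap D j) c (t j) (AMap D i j f) = t i"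
    using cc by (auto simp: is_cocone_def)
  have fin: "finite (Ob J)" using J by (simp add: finite_category_def)
  obtain p inc where p: "p \<in> fsums C S" and pc: "coproduct_cocone C (Ob J) (OMap D) p inc"
    using finite_coproduct[OF add S fin, of "OMap D"] Df by blast
  note inc [simp] = coproduct_coconeD(1)[OF pc] and pex = coproduct_coconeD(2)[OF pc]
    and puni = coproduct_coconeD(3)[OF pc]
  have [simp]: "p \<in> Ob C" using fsums_subset_Ob[OF p] .
  define R where "R = (SIGMA i:Ob J. SIGMA j:Ob J. Hom J i j)"
  have finR: "finite R" unfolding R_def using J by (auto simp: finite_category_def)
  define d where "d = (\<lambda>(i, j, f). Cmp C (OMap D i) (OMap D j) p (inc j) (AMap D i j f)
    \<oplus>\<^bsub>HMod C (OMap D i) p\<^esub> (\<ominus>\<^bsub>HMod C (OMap D i) p\<^esub> inc i))"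
  have Rd: "\<And>r. r \<in> R \<Longrightarrow> OMap D (fst r) \<in> fsums C S \<and> d r \<in> Hom C (OMap D (fst r)) p"
    using Df by (auto simp: R_def d_def)
  obtain q h where q: "q \<in> fsums C S" and qc: "joint_cokernel C p R (\<lambda>r. OMap D (fst r)) d q h"
    using joint_cokernel_exists[OF fsums_maps_split[OF add sch] p finR, of "\<lambda>r. OMap D (fst r)" d] Rd
    by blast
  note h [simp] = joint_cokernelD(1)[OF qc] and hd = joint_cokernelD(2)[OF qc]
    and qex = joint_cokernelD(3)[OF qc] and quni = joint_cokernelD(4)[OF qc]
  have [simp]: "q \<in> Ob C" using fsums_subset_Ob[OF q] .
  have hD: "Cmp C (OMap D i) (OMap D j) q (Cmp C (OMap D j) p q h (inc j)) (AMap D i j f) =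
      Cmp C (OMap D i) p q h (inc i)" if "i \<in> Ob J" "j \<in> Ob J" "f \<in> Hom J i j" for i j f
  proof -
    have "(i, j, f) \<in> R" using that by (simp add: R_def)
    from hd[OF this] show ?thesis using that by (simp add: d_def Cmp_assoc' add_eq_zero_iff)
  qed
  have "is_cocone J C D q (\<lambda>i. Cmp C (OMap D i) p q h (inc i))"
    unfolding is_cocone_def using hD by simp
  then obtain u where u [simp]: "u \<in> Hom C c q"
    and ut: "\<And>i. i \<in> Ob J \<Longrightarrow> Cmp C (OMap D i) c q u (t i) = Cmp C (OMap D i) p q h (inc i)"
    using cex[of q "\<lambda>i. Cmp C (OMap D i) p q h (inc i)"] by auto
  obtain g where g [simp]: "g \<in> Hom C p c" and gi: "\<And>i. i \<in> Ob J \<Longrightarrow> Cmp C (OMap D i) p c g (inc i) = t i"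
    using pex[of c t] by auto
  have "Cmp C (OMap D (fst r)) p c g (d r) = zero_arr C (OMap D (fst r)) c" if r0: "r \<in> R" for r
  proof -
    obtain i j f where r: "r = (i, j, f)" "i \<in> Ob J" "j \<in> Ob J" "f \<in> Hom J i j" using r0 by (auto simp: R_def)
    have "Cmp C (OMap D i) p c g (Cmp C (OMap D i) (OMap D j) p (inc j) (AMap D i j f)) = t i"
      using r by (simp add: Cmp_assoc gi tD)
    then show ?thesis using r by (simp add: d_def gi)
  qed
  then obtain v where v [simp]: "v \<in> Hom C q c" and vh: "Cmp C p q c v h = g"
    using qex[of c g] by auto
  have vu: "Cmp C (OMap D i) c c (Cmp C c q c v u) (t i) = t i" if "i \<in> Ob J" for i
    using that by (simp add: Cmp_assoc' ut) (simp add: Cmp_assoc vh gi)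
  have "\<exists>!u. u \<in> Hom C c c \<and> (\<forall>i\<in>Ob J. Cmp C (OMap D i) c c u (t i) = t i)" by (rule cex[OF cc])
  moreover have "Cmp C c q c v u \<in> Hom C c c \<and> (\<forall>i\<in>Ob J. Cmp C (OMap D i) c c (Cmp C c q c v u) (t i) = t i)"
    using vu by simp
  moreover have "Idn C c \<in> Hom C c c \<and> (\<forall>i\<in>Ob J. Cmp C (OMap D i) c c (Idn C c) (t i) = t i)"
    by simp
  ultimately have 1: "Cmp C c q c v u = Idn C c" by blast
  have "Cmp C p q q (Cmp C q c q u v) h = h"
  proof (rule puni)
    fix i assume i: "i \<in> Ob J"
    have "Cmp C (OMap D i) p q (Cmp C p q q (Cmp C q c q u v) h) (inc i) =
      Cmp C (OMap D i) c q u (Cmp C (OMap D i) p c (Cmp C p q c v h) (inc i))"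
      using i by (simp add: Cmp_assoc')
    also have "\<dots> = Cmp C (OMap D i) p q h (inc i)" using i by (simp add: vh gi ut)
    finally show "Cmp C (OMap D i) p q (Cmp C p q q (Cmp C q c q u v) h) (inc i) = Cmp C (OMap D i) p q h (inc i)" .
  qed simp_all
  then have 2: "Cmp C q c q u v = Idn C q" using quni[of q "Cmp C q c q u v" "Idn C q"] by simp
  have "isomorphic C q c" using 1 2 by (intro isomorphicI[of v _ _ u]) simp_all
  then show "c \<in> fsums C S" using fsums_iso[OF q] S by simp
qed

lemma fsums_closed_iso: "S \<subseteq> Ob C \<Longrightarrow> closed_iso C (fsums C S)"
  unfolding closed_iso_def by (auto intro: fsums_iso)

lemma least_colimit_closed_eq_fsums:
  assumes add: "additive C" and sch: "schur_family C S"
  shows "\<Inter>{T. T \<subseteq> Ob C \<and> closed_iso C T \<and> S \<subseteq> T \<and> closed_finite_colimits C T} = fsums C S"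
proof
  have S: "S \<subseteq> Ob C" using sch by (simp add: schur_family_def)
  have "fsums C S \<in> {T. T \<subseteq> Ob C \<and> closed_iso C T \<and> S \<subseteq> T \<and> closed_finite_colimits C T}"
    using fsums_closed_iso[OF S] fsums_closed_finite_colimits[OF assms] fsums_base[OF add S]
      fsums_subset_Ob[of _ C S] by auto
  then show "\<Inter>{T. T \<subseteq> Ob C \<and> closed_iso C T \<and> S \<subseteq> T \<and> closed_finite_colimits C T} \<subseteq> fsums C S"
    by (rule Inter_lower)
  show "fsums C S \<subseteq> \<Inter>{T. T \<subseteq> Ob C \<and> closed_iso C T \<and> S \<subseteq> T \<and> closed_finite_colimits C T}"
    using fsums_least by (intro Inter_greatest) simp
qed

text \<open>
  The equations that define biproducts hold in a full subcategory as soon as the objects lie in it.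
\<close>

lemma fsums_simple_system:
  assumes add: "additive C" and sch: "schur_family C S"
  shows "simple_system (full_subcat C (fsums C S)) S"
proof -
  have S: "S \<subseteq> Ob C" using sch by (simp add: schur_family_def)
  have b: "is_biprod (full_subcat C (fsums C S)) a b y \<longleftrightarrow>
    is_biprod C a b y \<and> a \<in> fsums C S \<and> b \<in> fsums C S \<and> y \<in> fsums C S" for a b y
    using fsums_subset_Ob[of _ C S] by (auto simp: is_biprod_def)
  have n: "null_obj (full_subcat C (fsums C S)) z \<longleftrightarrow> null_obj C z" for z
    using fsums_subset_Ob[of _ C S] fsums.null[of C z S] by (auto simp: null_obj_def)
  have "additive (full_subcat C (fsums C S))"
    unfolding additive_def
  proof (intro conjI ballI)
    show "\<exists>z. null_obj (full_subcat C (fsums C S)) z" using add n by (auto simp: additive_def)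
    fix a b' assume ab: "a \<in> Ob (full_subcat C (fsums C S))" "b' \<in> Ob (full_subcat C (fsums C S))"
    then have ab': "a \<in> fsums C S" "b' \<in> fsums C S" by simp_all
    then obtain y where y: "is_biprod C a b' y"
      using add fsums_subset_Ob[OF ab'(1)] fsums_subset_Ob[OF ab'(2)] unfolding additive_def by blast
    then have "is_biprod (full_subcat C (fsums C S)) a b' y"
      using ab' fsums_biprod[OF add S ab' y] b by simp
    then show "\<exists>y. is_biprod (full_subcat C (fsums C S)) a b' y" ..
  qed
  moreover have "schur_family (full_subcat C (fsums C S)) S"
    using sch fsums_base[OF add S] by (auto simp: schur_family_def is_iso_def)
  moreover have "x \<in> fsums (full_subcat C (fsums C S)) S" if "x \<in> fsums C S" for x
    using that
  proof (induction rule: fsums.induct)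
    case (null z) then show ?case using n fsums.null by metis
  next
    case (add x s y)
    have "y \<in> fsums C S" using add fsums.add by metis
    then have "is_biprod (full_subcat C (fsums C S)) x s y"
      using add b fsums_base[OF \<open>additive C\<close> S] by simp
    then show ?case using add fsums.add by metis
  qed
  ultimately show ?thesis by (auto simp: simple_system_def)
qed

end

section \<open>The category of modules\<close>

text \<open>
  Homs between modules and natural transformations between linear functors both form modules of
  extensional functions with pointwise operations. The additive inverse of a function is its
  multiple by \<open>-1\<close>.
\<close>

lemma module_of_sections:
  fixes K :: "('k, 'r) ring_scheme" and N :: "'i \<Rightarrow> ('k, 'b) module"
  assumes K: "cring K" and N: "\<And>x. x \<in> A \<Longrightarrow> module K (N x)"
    and H: "\<And>f. f \<in> H \<Longrightarrow> f \<in> extensional A" "\<And>f x. \<lbrakk>f \<in> H; x \<in> A\<rbrakk> \<Longrightarrow> f x \<in> carrier (N x)"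
    and zero: "(\<lambda>x\<in>A. \<zero>\<^bsub>N x\<^esub>) \<in> H"
    and add: "\<And>f g. \<lbrakk>f \<in> H; g \<in> H\<rbrakk> \<Longrightarrow> (\<lambda>x\<in>A. f x \<oplus>\<^bsub>N x\<^esub> g x) \<in> H"
    and smult: "\<And>a f. \<lbrakk>a \<in> carrier K; f \<in> H\<rbrakk> \<Longrightarrow> (\<lambda>x\<in>A. a \<odot>\<^bsub>N x\<^esub> f x) \<in> H"
  shows "module K \<lparr>carrier = H, mult = undefined, one = undefined, zero = (\<lambda>x\<in>A. \<zero>\<^bsub>N x\<^esub>),
      add = (\<lambda>f g. \<lambda>x\<in>A. f x \<oplus>\<^bsub>N x\<^esub> g x), smult = (\<lambda>a f. \<lambda>x\<in>A. a \<odot>\<^bsub>N x\<^esub> f x)\<rparr>"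
    (is "module K ?M")
proof -
  interpret K: cring K by (rule K)
  have g: "abelian_group (N x)" if "x \<in> A" for x using N[OF that] by (simp add: module_def)
  have ext: "f = h" if "f \<in> extensional A" "h \<in> extensional A" "\<And>x. x \<in> A \<Longrightarrow> f x = h x" for f h :: "'i \<Rightarrow> 'b"
    using that by (rule extensionalityI)
  show ?thesis
  proof (intro moduleI abelian_groupI)
    fix f assume "f \<in> carrier ?M"
    then have f: "f \<in> H" by simp
    have m1: "\<ominus>\<^bsub>K\<^esub> \<one>\<^bsub>K\<^esub> \<in> carrier K" by simp
    have "(\<lambda>x\<in>A. (\<ominus>\<^bsub>K\<^esub> \<one>\<^bsub>K\<^esub>) \<odot>\<^bsub>N x\<^esub> f x) \<in> H" using smult[OF m1 f] .
    moreover have "(\<ominus>\<^bsub>K\<^esub> \<one>\<^bsub>K\<^esub>) \<odot>\<^bsub>N x\<^esub> f x \<oplus>\<^bsub>N x\<^esub> f x = \<zero>\<^bsub>N x\<^esub>" if "x \<in> A" for x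
      using H(2)[OF f that] module.smult_l_minus[OF N[OF that], of "\<one>\<^bsub>K\<^esub>" "f x"]
        module.smult_one[OF N[OF that]] abelian_group.l_neg[OF g[OF that]] by simp
    ultimately show "\<exists>y\<in>carrier ?M. y \<oplus>\<^bsub>?M\<^esub> f = \<zero>\<^bsub>?M\<^esub>"
      by (intro bexI[of _ "\<lambda>x\<in>A. (\<ominus>\<^bsub>K\<^esub> \<one>\<^bsub>K\<^esub>) \<odot>\<^bsub>N x\<^esub> f x"]) (auto intro!: ext)
    show "\<zero>\<^bsub>?M\<^esub> \<oplus>\<^bsub>?M\<^esub> f = f"
      using f H abelian_group.axioms(1)[OF g] by (auto intro!: ext simp: abelian_monoid.l_zero)
    show "\<one>\<^bsub>K\<^esub> \<odot>\<^bsub>?M\<^esub> f = f"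
      using f H module.smult_one[OF N] by (auto intro!: ext)
  next
    fix f h assume fh: "f \<in> carrier ?M" "h \<in> carrier ?M"
    show "f \<oplus>\<^bsub>?M\<^esub> h = h \<oplus>\<^bsub>?M\<^esub> f"
      using fh H abelian_group.axioms(1)[OF g] by (auto intro!: ext simp: abelian_monoid.a_comm)
    fix a assume "a \<in> carrier K"
    then show "a \<odot>\<^bsub>?M\<^esub> (f \<oplus>\<^bsub>?M\<^esub> h) = (a \<odot>\<^bsub>?M\<^esub> f) \<oplus>\<^bsub>?M\<^esub> (a \<odot>\<^bsub>?M\<^esub> h)"
      using fh H module.smult_r_distr[OF N] by (auto intro!: ext)
  next
    fix f h k assume "f \<in> carrier ?M" "h \<in> carrier ?M" "k \<in> carrier ?M"
    then show "f \<oplus>\<^bsub>?M\<^esub> h \<oplus>\<^bsub>?M\<^esub> k = f \<oplus>\<^bsub>?M\<^esub> (h \<oplus>\<^bsub>?M\<^esub> k)"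
      using H abelian_group.axioms(1)[OF g] by (auto intro!: ext simp: abelian_monoid.a_assoc)
  next
    fix a b f assume "a \<in> carrier K" "b \<in> carrier K" "f \<in> carrier ?M"
    then show "(a \<oplus>\<^bsub>K\<^esub> b) \<odot>\<^bsub>?M\<^esub> f = (a \<odot>\<^bsub>?M\<^esub> f) \<oplus>\<^bsub>?M\<^esub> (b \<odot>\<^bsub>?M\<^esub> f)"
      "(a \<otimes>\<^bsub>K\<^esub> b) \<odot>\<^bsub>?M\<^esub> f = a \<odot>\<^bsub>?M\<^esub> (b \<odot>\<^bsub>?M\<^esub> f)"
      using H module.smult_l_distr[OF N] module.smult_assoc1[OF N] by (auto intro!: ext)
  qed (use zero add smult K in auto)
qed

lemma linear_mapI:
  assumes "\<And>u. u \<in> carrier M \<Longrightarrow> f u \<in> carrier N"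
    and "\<And>u v. \<lbrakk>u \<in> carrier M; v \<in> carrier M\<rbrakk> \<Longrightarrow> f (u \<oplus>\<^bsub>M\<^esub> v) = f u \<oplus>\<^bsub>N\<^esub> f v"
    and "\<And>a u. \<lbrakk>a \<in> carrier K; u \<in> carrier M\<rbrakk> \<Longrightarrow> f (a \<odot>\<^bsub>M\<^esub> u) = a \<odot>\<^bsub>N\<^esub> f u"
  shows "linear_map K M N f"
  using assms by (simp add: linear_map_def)

lemma linear_mapD:
  assumes "linear_map K M N f"
  shows "\<And>u. u \<in> carrier M \<Longrightarrow> f u \<in> carrier N"
    and "\<And>u v. \<lbrakk>u \<in> carrier M; v \<in> carrier M\<rbrakk> \<Longrightarrow> f (u \<oplus>\<^bsub>M\<^esub> v) = f u \<oplus>\<^bsub>N\<^esub> f v"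
    and "\<And>a u. \<lbrakk>a \<in> carrier K; u \<in> carrier M\<rbrakk> \<Longrightarrow> f (a \<odot>\<^bsub>M\<^esub> u) = a \<odot>\<^bsub>N\<^esub> f u"
  using assms by (auto simp: linear_map_def)

lemma moduleD:
  assumes "module K M"
  shows "\<zero>\<^bsub>M\<^esub> \<in> carrier M"
    and "\<And>u v. \<lbrakk>u \<in> carrier M; v \<in> carrier M\<rbrakk> \<Longrightarrow> u \<oplus>\<^bsub>M\<^esub> v \<in> carrier M"
    and "\<And>a u. \<lbrakk>a \<in> carrier K; u \<in> carrier M\<rbrakk> \<Longrightarrow> a \<odot>\<^bsub>M\<^esub> u \<in> carrier M"
    and "\<And>u. u \<in> carrier M \<Longrightarrow> u \<oplus>\<^bsub>M\<^esub> \<zero>\<^bsub>M\<^esub> = u"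
    and "\<And>u. u \<in> carrier M \<Longrightarrow> \<zero>\<^bsub>M\<^esub> \<oplus>\<^bsub>M\<^esub> u = u"
    and "\<And>a. a \<in> carrier K \<Longrightarrow> a \<odot>\<^bsub>M\<^esub> \<zero>\<^bsub>M\<^esub> = \<zero>\<^bsub>M\<^esub>"
    and "\<And>a u v. \<lbrakk>a \<in> carrier K; u \<in> carrier M; v \<in> carrier M\<rbrakk> \<Longrightarrow>
      a \<odot>\<^bsub>M\<^esub> (u \<oplus>\<^bsub>M\<^esub> v) = a \<odot>\<^bsub>M\<^esub> u \<oplus>\<^bsub>M\<^esub> a \<odot>\<^bsub>M\<^esub> v"
    and "\<And>u v w x. \<lbrakk>u \<in> carrier M; v \<in> carrier M; w \<in> carrier M; x \<in> carrier M\<rbrakk> \<Longrightarrow>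
      (u \<oplus>\<^bsub>M\<^esub> v) \<oplus>\<^bsub>M\<^esub> (w \<oplus>\<^bsub>M\<^esub> x) = (u \<oplus>\<^bsub>M\<^esub> w) \<oplus>\<^bsub>M\<^esub> (v \<oplus>\<^bsub>M\<^esub> x)"
    and "\<And>a b u. \<lbrakk>a \<in> carrier K; b \<in> carrier K; u \<in> carrier M\<rbrakk> \<Longrightarrow>
      a \<odot>\<^bsub>M\<^esub> (b \<odot>\<^bsub>M\<^esub> u) = b \<odot>\<^bsub>M\<^esub> (a \<odot>\<^bsub>M\<^esub> u)"
  using assms abelian_group.axioms(1)[OF module.axioms(2)[OF assms]] cring.cring_simprules(14)[OF module.axioms(1)[OF assms]]
  by (simp_all add: abelian_monoid.zero_closed abelian_monoid.a_closed module.smult_closed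
      abelian_monoid.r_zero abelian_monoid.l_zero module.smult_r_null module.smult_r_distr
      abelian_monoid.a_ac flip: module.smult_assoc1)

lemma kMod_simps [simp]:
  "Ob (kMod K) = {M. module K M}"
  "Hom (kMod K) M N = {f \<in> extensional (carrier M). linear_map K M N f}"
  "Cmp (kMod K) M N P g f = compose (carrier M) g f"
  "Idn (kMod K) M = (\<lambda>u\<in>carrier M. u)"
  "carrier (HMod (kMod K) M N) = {f \<in> extensional (carrier M). linear_map K M N f}"
  "zero_arr (kMod K) M N = (\<lambda>u\<in>carrier M. \<zero>\<^bsub>N\<^esub>)"
  "f \<oplus>\<^bsub>HMod (kMod K) M N\<^esub> g = (\<lambda>u\<in>carrier M. f u \<oplus>\<^bsub>N\<^esub> g u)"
  "a \<odot>\<^bsub>HMod (kMod K) M N\<^esub> f = (\<lambda>u\<in>carrier M. a \<odot>\<^bsub>N\<^esub> f u)"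
  by (simp_all add: kMod_def)

lemma k_linear_kMod:
  assumes K: "cring K"
  shows "k_linear_category K (kMod K :: ('k, ('k, 'u) module, 'u \<Rightarrow> 'u) lcat)"
proof -
  interpret K: cring K by (rule K)
  note ext = extensionalityI[where A = "carrier _"]
  show ?thesis
  proof (intro k_linear_category.intro k_linear_category_axioms.intro category.intro K)
    fix M N :: "('k, 'u) module"
    assume M: "M \<in> Ob (kMod K)" "N \<in> Ob (kMod K)"
    show "module K (HMod (kMod K) M N)"
      unfolding kMod_def lcat.simps
      by (rule module_of_sections[OF K])
        (use M in \<open>auto intro!: linear_mapI simp: moduleD linear_mapD\<close>)
  qed (auto intro!: ext linear_mapI simp: moduleD compose_def linear_mapD)
qed

definition trivial_module :: "('k, 'u) module"
  where "trivial_module = \<lparr>carrier = {undefined}, mult = undefined, one = undefined,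
    zero = undefined, add = (\<lambda>_ _. undefined), smult = (\<lambda>_ _. undefined)\<rparr>"

lemma module_trivial: "cring K \<Longrightarrow> module K trivial_module"
  by (intro moduleI abelian_groupI) (auto simp: trivial_module_def)

lemma inj_pair_exists:
  assumes "infinite (UNIV :: 'u set)"
  shows "\<exists>e :: 'u \<times> 'u \<Rightarrow> 'u. inj e"
proof -
  have "\<exists>e :: 'u \<times> 'u \<Rightarrow> 'u. bij_betw e (UNIV \<times> UNIV) UNIV"
    using card_of_Times_same_infinite[OF assms] card_of_ordIso[of "UNIV \<times> UNIV :: ('u \<times> 'u) set" "UNIV :: 'u set"]
    by blast
  then show ?thesis by (auto simp: bij_betw_def)
qed

text \<open>
  The direct sum of two modules, with carrier moved into the universe along an injection \<open>e\<close> of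
  pairs. This is where the universe has to be infinite.
\<close>

definition module_sum ::
  "('u \<times> 'u \<Rightarrow> 'u) \<Rightarrow> ('k, 'u) module \<Rightarrow> ('k, 'u) module \<Rightarrow> ('k, 'u) module"
  where "module_sum e M N = \<lparr>carrier = e ` (carrier M \<times> carrier N), mult = undefined, one = undefined,
    zero = e (\<zero>\<^bsub>M\<^esub>, \<zero>\<^bsub>N\<^esub>),
    add = (\<lambda>p q. e (fst (inv_into UNIV e p) \<oplus>\<^bsub>M\<^esub> fst (inv_into UNIV e q), snd (inv_into UNIV e p) \<oplus>\<^bsub>N\<^esub> snd (inv_into UNIV e q))),
    smult = (\<lambda>a p. e (a \<odot>\<^bsub>M\<^esub> fst (inv_into UNIV e p), a \<odot>\<^bsub>N\<^esub> snd (inv_into UNIV e p)))\<rparr>"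

lemma module_module_sum:
  assumes e: "inj e" and M: "module K M" and N: "module K N"
  shows "module K (module_sum e M N)" (is "module K ?P")
proof -
  interpret M: module K M by (rule M)
  interpret N: module K N by (rule N)
  note [simp] = inv_f_f[OF e]
  show ?thesis
  proof (intro moduleI abelian_groupI M.is_cring)
    fix p assume "p \<in> carrier ?P"
    then obtain u v where p: "p = e (u, v)" "u \<in> carrier M" "v \<in> carrier N" by (auto simp: module_sum_def)
    then show "\<exists>q\<in>carrier ?P. q \<oplus>\<^bsub>?P\<^esub> p = \<zero>\<^bsub>?P\<^esub>"
      by (intro bexI[of _ "e (\<ominus>\<^bsub>M\<^esub> u, \<ominus>\<^bsub>N\<^esub> v)"]) (auto simp: module_sum_def M.l_neg N.l_neg)
  qed (auto simp: module_sum_def M.a_ac N.a_ac M.smult_l_distr N.smult_l_distr M.smult_r_distr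
      N.smult_r_distr M.smult_assoc1 N.smult_assoc1)
qed

lemma additive_kMod:
  assumes K: "cring K" and inf: "infinite (UNIV :: 'u set)"
  shows "additive (kMod K :: ('k, ('k, 'u) module, 'u \<Rightarrow> 'u) lcat)"
  unfolding additive_def
proof (intro conjI ballI)
  interpret K: cring K by (rule K)
  interpret V: k_linear_category K "kMod K :: ('k, ('k, 'u) module, 'u \<Rightarrow> 'u) lcat"
    by (rule k_linear_kMod[OF K])
  note ext = extensionalityI[where A = "carrier _"]
  have "null_obj (kMod K) (trivial_module :: ('k, 'u) module)"
    using module_trivial[OF K] by (auto simp: null_obj_def trivial_module_def restrict_def)
  then show "\<exists>Z :: ('k, 'u) module. null_obj (kMod K) Z" ..
  obtain e :: "'u \<times> 'u \<Rightarrow> 'u" where e: "inj e" using inj_pair_exists[OF inf] by blast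
  note [simp] = inv_f_f[OF e]
  fix M N :: "('k, 'u) module" assume "M \<in> Ob (kMod K)" "N \<in> Ob (kMod K)"
  then have M: "module K M" "module K N" by simp_all
  let ?P = "module_sum e M N"
  have P: "module K ?P" by (rule module_module_sum[OF e M])
  have c: "carrier ?P = e ` (carrier M \<times> carrier N)" by (simp add: module_sum_def)
  have a: "u \<oplus>\<^bsub>?P\<^esub> v = e (fst (inv_into UNIV e u) \<oplus>\<^bsub>M\<^esub> fst (inv_into UNIV e v), snd (inv_into UNIV e u) \<oplus>\<^bsub>N\<^esub> snd (inv_into UNIV e v))" for u v
    by (simp add: module_sum_def)
  have s: "b \<odot>\<^bsub>?P\<^esub> u = e (b \<odot>\<^bsub>M\<^esub> fst (inv_into UNIV e u), b \<odot>\<^bsub>N\<^esub> snd (inv_into UNIV e u))" for b u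
    by (simp add: module_sum_def)
  have "biprod_maps K (kMod K) M N ?P (\<lambda>u\<in>carrier M. e (u, \<zero>\<^bsub>N\<^esub>)) (\<lambda>v\<in>carrier N. e (\<zero>\<^bsub>M\<^esub>, v))
    (\<lambda>p\<in>carrier ?P. fst (inv_into UNIV e p)) (\<lambda>p\<in>carrier ?P. snd (inv_into UNIV e p))"
    by (rule V.biprod_mapsI)
      (use M P in \<open>auto intro!: linear_mapI restrict_ext simp: moduleD c a s compose_def\<close>)
  then show "\<exists>P. is_biprod (kMod K) M N P" using V.is_biprodI by blast
qed

section \<open>Linear functor categories\<close>

lemma functor_cat_simps [simp]:
  "Ob (functor_cat K C D) = {F. linear_functor K C D F}"
  "Hom (functor_cat K C D) F G = {t \<in> extensional (Ob C). nat_trans C D F G t}"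
  "Cmp (functor_cat K C D) F G H s t =
    (\<lambda>x\<in>Ob C. Cmp D (OMap F x) (OMap G x) (OMap H x) (s x) (t x))"
  "Idn (functor_cat K C D) F = (\<lambda>x\<in>Ob C. Idn D (OMap F x))"
  "carrier (HMod (functor_cat K C D) F G) = {t \<in> extensional (Ob C). nat_trans C D F G t}"
  "zero_arr (functor_cat K C D) F G = (\<lambda>x\<in>Ob C. zero_arr D (OMap F x) (OMap G x))"
  "s \<oplus>\<^bsub>HMod (functor_cat K C D) F G\<^esub> t = (\<lambda>x\<in>Ob C. s x \<oplus>\<^bsub>HMod D (OMap F x) (OMap G x)\<^esub> t x)"
  "a \<odot>\<^bsub>HMod (functor_cat K C D) F G\<^esub> t = (\<lambda>x\<in>Ob C. a \<odot>\<^bsub>HMod D (OMap F x) (OMap G x)\<^esub> t x)"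
  by (simp_all add: functor_cat_def)

lemma nat_transI:
  assumes "\<And>x. x \<in> Ob C \<Longrightarrow> t x \<in> Hom D (OMap F x) (OMap G x)"
    and "\<And>x y f. \<lbrakk>x \<in> Ob C; y \<in> Ob C; f \<in> Hom C x y\<rbrakk> \<Longrightarrow>
      Cmp D (OMap F x) (OMap F y) (OMap G y) (t y) (AMap F x y f) =
      Cmp D (OMap F x) (OMap G x) (OMap G y) (AMap G x y f) (t x)"
  shows "nat_trans C D F G t"
  using assms by (simp add: nat_trans_def)

lemma nat_transD:
  assumes "nat_trans C D F G t"
  shows "\<And>x. x \<in> Ob C \<Longrightarrow> t x \<in> Hom D (OMap F x) (OMap G x)"
    and "\<And>x y f. \<lbrakk>x \<in> Ob C; y \<in> Ob C; f \<in> Hom C x y\<rbrakk> \<Longrightarrow>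
      Cmp D (OMap F x) (OMap F y) (OMap G y) (t y) (AMap F x y f) =
      Cmp D (OMap F x) (OMap G x) (OMap G y) (AMap G x y f) (t x)"
  using assms by (simp_all add: nat_trans_def)

locale linear_functors = C: k_linear_category K C + D: k_linear_category K D
  for K :: "('k, 'r) ring_scheme" and C :: "('k, 'o, 'a) lcat" and D :: "('k, 'p, 'b) lcat"
begin

lemma lin_functor: "linear_functor K C D F \<Longrightarrow> lin_functor K C D F"
  by (intro lin_functorI C.k_linear_category_axioms D.k_linear_category_axioms)

lemmas functor_facts = lin_functor.F_Ob[OF lin_functor] lin_functor.F_Hom[OF lin_functor]
  lin_functor.F_Idn[OF lin_functor] lin_functor.F_Cmp[OF lin_functor]
  lin_functor.F_add[OF lin_functor] lin_functor.F_smult[OF lin_functor]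

lemma natural_reassoc:
  assumes "nat_trans C D F G t" "linear_functor K C D F" "linear_functor K C D G"
    "x \<in> Ob C" "y \<in> Ob C" "f \<in> Hom C x y" "w \<in> Ob D" "k \<in> Hom D w (OMap F x)"
  shows "Cmp D w (OMap F y) (OMap G y) (t y) (Cmp D w (OMap F x) (OMap F y) (AMap F x y f) k) =
      Cmp D w (OMap G x) (OMap G y) (AMap G x y f) (Cmp D w (OMap F x) (OMap G x) (t x) k)"
  using assms nat_transD[OF assms(1)] by (simp add: D.Cmp_assoc functor_facts)

lemma nat_trans_Cmp:
  assumes t: "nat_trans C D F G t" and s: "nat_trans C D G H s"
    and F: "linear_functor K C D F" "linear_functor K C D G" "linear_functor K C D H"
  shows "nat_trans C D F H (\<lambda>x\<in>Ob C. Cmp D (OMap F x) (OMap G x) (OMap H x) (s x) (t x))"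
  by (rule nat_transI)
    (use nat_transD[OF t] nat_transD[OF s] F in
      \<open>simp_all add: functor_facts D.Cmp_assoc' natural_reassoc[OF s]\<close>)

lemma nat_trans_zero:
  assumes "linear_functor K C D F" "linear_functor K C D G"
  shows "nat_trans C D F G (\<lambda>x\<in>Ob C. zero_arr D (OMap F x) (OMap G x))"
  by (rule nat_transI) (use assms in \<open>simp_all add: functor_facts\<close>)

lemma nat_trans_add:
  assumes "nat_trans C D F G t" "nat_trans C D F G s"
    and "linear_functor K C D F" "linear_functor K C D G"
  shows "nat_trans C D F G (\<lambda>x\<in>Ob C. t x \<oplus>\<^bsub>HMod D (OMap F x) (OMap G x)\<^esub> s x)"
  by (rule nat_transI)
    (use nat_transD[OF assms(1)] nat_transD[OF assms(2)] assms(3,4) in \<open>simp_all add: functor_facts\<close>)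

lemma nat_trans_smult:
  assumes "nat_trans C D F G t" "a \<in> carrier K"
    and "linear_functor K C D F" "linear_functor K C D G"
  shows "nat_trans C D F G (\<lambda>x\<in>Ob C. a \<odot>\<^bsub>HMod D (OMap F x) (OMap G x)\<^esub> t x)"
  by (rule nat_transI)
    (use nat_transD[OF assms(1)] assms(2-4) in
      \<open>simp_all add: functor_facts D.Cmp_smult_left D.Cmp_smult_right\<close>)

lemma k_linear_functor_cat: "k_linear_category K (functor_cat K C D)"
proof (intro k_linear_category.intro k_linear_category_axioms.intro category.intro C.K.is_cring)
  note ext = extensionalityI[where A = "Ob C"]
  let ?P = "functor_cat K C D"
  fix F G H I t s r
  show "Cmp ?P F G G (Idn ?P G) t = t" "Cmp ?P F F G t (Idn ?P F) = t"
    if "F \<in> Ob ?P" "G \<in> Ob ?P" "t \<in> Hom ?P F G"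
    using that by (auto intro!: ext simp: functor_facts nat_transD)
  show "Cmp ?P I G H r (Cmp ?P I F G s t) = Cmp ?P I F H (Cmp ?P F G H r s) t"
    if "I \<in> Ob ?P" "F \<in> Ob ?P" "G \<in> Ob ?P" "H \<in> Ob ?P" "t \<in> Hom ?P I F" "s \<in> Hom ?P F G" "r \<in> Hom ?P G H"
    using that nat_transD(1)[of C D I F t] nat_transD(1)[of C D F G s] nat_transD(1)[of C D G H r]
    by (auto intro!: ext D.Cmp_assoc simp: functor_facts)
  show "module K (HMod ?P F G)" if "F \<in> Ob ?P" "G \<in> Ob ?P"
    unfolding functor_cat_def lcat.simps
    by (rule module_of_sections[OF C.K.is_cring])
      (use that in \<open>auto simp: functor_facts D.HMod_module D.carrier_HMod nat_transD nat_trans_zero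
        nat_trans_add nat_trans_smult\<close>)
qed (auto intro!: ext linear_mapI nat_transI simp: functor_facts nat_transD nat_trans_Cmp
    D.Cmp_smult_left D.Cmp_smult_right)

text \<open>
  Biproducts of functors are formed objectwise, from a choice of biproducts in \<open>D\<close>.
\<close>

lemma additive_functor_cat:
  assumes add: "additive D"
  shows "additive (functor_cat K C D)"
  unfolding additive_def
proof (intro conjI ballI)
  interpret P: k_linear_category K "functor_cat K C D" by (rule k_linear_functor_cat)
  obtain z where z: "null_obj D z" using add by (auto simp: additive_def)
  then have [simp]: "z \<in> Ob D" and Iz: "Idn D z = zero_arr D z z" by (auto simp: null_obj_def)
  define Z :: "('o, 'a, 'p, 'b) fnctr" where "Z = \<lparr>OMap = (\<lambda>_. z), AMap = (\<lambda>_ _ _. Idn D z)\<rparr>"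
  have "linear_functor K C D Z"
  proof (rule C.linear_functorI[OF D.k_linear_category_axioms])
    fix x y f a assume "a \<in> carrier K"
    then show "AMap Z x y (a \<odot>\<^bsub>HMod C x y\<^esub> f) = a \<odot>\<^bsub>HMod D (OMap Z x) (OMap Z y)\<^esub> AMap Z x y f"
      using D.null_obj_into[OF z, of z "a \<odot>\<^bsub>HMod D z z\<^esub> Idn D z"] Iz by (simp add: Z_def)
  qed (simp_all add: Z_def, simp add: Iz)
  then have "null_obj (functor_cat K C D) Z" by (simp add: null_obj_def Z_def Iz)
  then show "\<exists>Z. null_obj (functor_cat K C D) Z" ..
  fix F G assume "F \<in> Ob (functor_cat K C D)" "G \<in> Ob (functor_cat K C D)"
  then have F: "linear_functor K C D F" "linear_functor K C D G" by simp_all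
  note [simp] = functor_facts[OF F(1)] functor_facts[OF F(2)]
  have "\<forall>x\<in>Ob C. \<exists>y j1 j2 q1 q2. biprod_maps K D (OMap F x) (OMap G x) y j1 j2 q1 q2"
    using add unfolding additive_def D.is_biprod_iff by simp
  then obtain y j1 j2 q1 q2 where b:
    "\<And>x. x \<in> Ob C \<Longrightarrow> biprod_maps K D (OMap F x) (OMap G x) (y x) (j1 x) (j2 x) (q1 x) (q2 x)"
    by metis
  note [simp] = biprod_maps.obs(3)[OF b] biprod_maps.maps[OF b] biprod_maps.retract[OF b]
    biprod_maps.orth[OF b] biprod_maps.sum_Idn[OF b] biprod_maps.retract'[OF b]
  define S where "S = \<lparr>OMap = y, AMap = (\<lambda>x x' f. Cmp D (y x) (OMap F x') (y x') (j1 x')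
      (Cmp D (y x) (OMap F x) (OMap F x') (AMap F x x' f) (q1 x)) \<oplus>\<^bsub>HMod D (y x) (y x')\<^esub>
    Cmp D (y x) (OMap G x') (y x') (j2 x') (Cmp D (y x) (OMap G x) (OMap G x') (AMap G x x' f) (q2 x)))\<rparr>"
  have S: "linear_functor K C D S"
    by (rule C.linear_functorI[OF D.k_linear_category_axioms])
      (simp_all add: S_def D.Cmp_assoc' D.Cmp_smult_left D.Cmp_smult_right D.add_ac
        module.smult_r_distr[OF D.HMod_module] D.carrier_HMod)
  have "biprod_maps K (functor_cat K C D) F G S (\<lambda>x\<in>Ob C. j1 x) (\<lambda>x\<in>Ob C. j2 x)
    (\<lambda>x\<in>Ob C. q1 x) (\<lambda>x\<in>Ob C. q2 x)"
    by (rule P.biprod_mapsI)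
      (use F S in \<open>auto intro!: restrict_ext nat_transI simp: S_def D.Cmp_assoc'\<close>)
  then show "\<exists>S. is_biprod (functor_cat K C D) F G S" using P.is_biprodI by blast
qed

end

section \<open>Restricted Yoneda functors\<close>

lemma representable_simps [simp]:
  "OMap (representable X x) y = HMod X y x"
  "AMap (representable X x) y z f = (\<lambda>g\<in>Hom X y x. Cmp X z y x g f)"
  by (simp_all add: representable_def)

lemma yoneda_simps [simp]:
  "OMap (yoneda X) = representable X"
  "AMap (yoneda X) x x' f = (\<lambda>y\<in>Ob X. \<lambda>g\<in>Hom X y x. Cmp X y x x' f g)"
  by (simp_all add: yoneda_def)

text \<open>
  A full subcategory \<open>X\<close> of \<open>C\<close> with set of objects \<open>T\<close>. The presheaf \<open>representable X a\<close> and the maps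
  given by \<open>yoneda X\<close> make sense for all objects \<open>a\<close> of \<open>C\<close>, so \<open>yoneda X\<close> is also the restricted Yoneda
  functor from \<open>C\<close> to presheaves on \<open>X\<close>.
\<close>

locale full_subcategory = k_linear_category K C
  for K :: "('k, 'r) ring_scheme" and C :: "('k, 'u, 'u) lcat" +
  fixes T :: "'u set"
  assumes T_sub: "T \<subseteq> Ob C"
begin

abbreviation "X \<equiv> full_subcat C T"
abbreviation "V \<equiv> kMod K :: ('k, ('k, 'u) module, 'u \<Rightarrow> 'u) lcat"

lemma T_Ob [simp]: "x \<in> T \<Longrightarrow> x \<in> Ob C"
  using T_sub by blast

sublocale X: k_linear_category K X
  by (rule k_linear_full_subcat[OF T_sub])

sublocale Xop: k_linear_category K "opcat X"
  by (rule X.k_linear_opcat)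

sublocale V: k_linear_category K V
  by (rule k_linear_kMod[OF K.is_cring])

sublocale P: linear_functors K "opcat X" V ..

lemma k_linear_Psh: "k_linear_category K (Psh K X)"
  unfolding Psh_def by (rule P.k_linear_functor_cat)

lemma additive_Psh: "infinite (UNIV :: 'u set) \<Longrightarrow> additive (Psh K X)"
  unfolding Psh_def by (intro P.additive_functor_cat additive_kMod K.is_cring)

lemma representable_linear:
  assumes [simp]: "a \<in> Ob C"
  shows "linear_functor K (opcat X) V (representable X a)"
  by (rule Xop.linear_functorI[OF V.k_linear_category_axioms])
    (auto intro!: linear_mapI restrict_ext
      simp: HMod_module carrier_HMod Cmp_smult_left Cmp_smult_right compose_def Cmp_assoc)

lemma yoneda_linear: "linear_functor K C (Psh K X) (yoneda X)"
  unfolding Psh_def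
  by (rule linear_functorI[OF P.k_linear_functor_cat])
    (auto intro!: linear_mapI restrict_ext nat_transI
      simp: representable_linear carrier_HMod Cmp_smult_left Cmp_smult_right compose_def Cmp_assoc)

text \<open>
  A transformation out of the presheaf represented by \<open>t\<close> is determined by the image of the identity
  of \<open>t\<close>, by naturality.
\<close>

lemma yoneda_lemma:
  assumes t: "t \<in> T" and a [simp]: "a \<in> Ob C"
  shows "ff_pair C (Psh K X) (yoneda X) t a"
  unfolding ff_pair_def
proof (rule bij_betwI')
  have [simp]: "t \<in> Ob C" using t by simp
  fix f g assume f: "f \<in> Hom C t a" "g \<in> Hom C t a"
  have "f = g" if "AMap (yoneda X) t a f = AMap (yoneda X) t a g"
  proof -
    have "AMap (yoneda X) t a f t (Idn C t) = AMap (yoneda X) t a g t (Idn C t)" using that by simp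
    then show ?thesis using t f by simp
  qed
  then show "AMap (yoneda X) t a f = AMap (yoneda X) t a g \<longleftrightarrow> f = g" by blast
next
  fix f assume "f \<in> Hom C t a"
  then show "AMap (yoneda X) t a f \<in> Hom (Psh K X) (OMap (yoneda X) t) (OMap (yoneda X) a)"
    using yoneda_linear t by (simp add: linear_functor_def is_functor_def)
next
  have [simp]: "t \<in> Ob C" using t by simp
  fix s assume "s \<in> Hom (Psh K X) (OMap (yoneda X) t) (OMap (yoneda X) a)"
  then have se: "s \<in> extensional T" and sn: "nat_trans (opcat X) V (representable X t) (representable X a) s"
    by (simp_all add: Psh_def)
  have lin: "s y \<in> extensional (Hom C y t)" "linear_map K (HMod C y t) (HMod C y a) (s y)" if "y \<in> T" for y
    using nat_transD(1)[OF sn, of y] that by (simp_all add: carrier_HMod)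
  define f where "f = s t (Idn C t)"
  have f: "f \<in> Hom C t a" using linear_mapD(1)[OF lin(2)[OF t], of "Idn C t"] by (simp add: f_def carrier_HMod)
  have sg: "s y g = Cmp C y t a f g" if y: "y \<in> T" and g: "g \<in> Hom C y t" for y g
  proof -
    have "compose (Hom C t t) (s y) (\<lambda>h\<in>Hom C t t. Cmp C y t t h g) (Idn C t) =
      compose (Hom C t t) (\<lambda>h\<in>Hom C t a. Cmp C y t a h g) (s t) (Idn C t)"
      using nat_transD(2)[OF sn, of t y g] y g t by (simp add: carrier_HMod)
    then show ?thesis using y g t f by (simp add: compose_def f_def)
  qed
  have "s y = (\<lambda>g\<in>Hom C y t. Cmp C y t a f g)" if "y \<in> T" for y
    by (rule extensionalityI[where A = "Hom C y t"]) (use that lin sg in auto)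
  then have "s = AMap (yoneda X) t a f"
    using se by (simp add: extensional_def fun_eq_iff)
  then show "\<exists>f\<in>Hom C t a. s = AMap (yoneda X) t a f" using f by blast
qed

end

section \<open>Coproducts of division algebras\<close>

lemma end_ring_simps [simp]:
  "carrier (end_ring C x) = Hom C x x" "mult (end_ring C x) = Cmp C x x x"
  "one (end_ring C x) = Idn C x" "zero (end_ring C x) = zero_arr C x x"
  "add (end_ring C x) = add (HMod C x x)"
  by (simp_all add: end_ring_def)

lemma end_ring_full_subcat [simp]: "end_ring (full_subcat C S) x = end_ring C x"
  by (simp add: end_ring_def)

context k_linear_category
begin

lemma ring_end_ring:
  assumes [simp]: "x \<in> Ob C"
  shows "ring (end_ring C x)"
proof (intro ringI abelian_groupI monoidI)
  fix f assume "f \<in> carrier (end_ring C x)"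
  then show "\<exists>g\<in>carrier (end_ring C x). g \<oplus>\<^bsub>end_ring C x\<^esub> f = \<zero>\<^bsub>end_ring C x\<^esub>"
    by (intro bexI[of _ "\<ominus>\<^bsub>HMod C x x\<^esub> f"]) simp_all
next
  fix f g assume "f \<in> carrier (end_ring C x)" "g \<in> carrier (end_ring C x)"
  then show "f \<oplus>\<^bsub>end_ring C x\<^esub> g = g \<oplus>\<^bsub>end_ring C x\<^esub> f" by (simp add: add_comm)
qed (simp_all add: add_assoc Cmp_assoc)

lemma division_end_ring_iff:
  assumes [simp]: "x \<in> Ob C"
  shows "division_ring (end_ring C x) \<longleftrightarrow> Idn C x \<noteq> zero_arr C x x \<and>
    (\<forall>f\<in>Hom C x x. f \<noteq> zero_arr C x x \<longrightarrow> is_iso C x x f)"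
proof -
  have u: "f \<in> Units (end_ring C x) \<longleftrightarrow> is_iso C x x f" for f
    unfolding Units_def is_iso_def by auto
  have "\<not> is_iso C x x (zero_arr C x x)" if "Idn C x \<noteq> zero_arr C x x"
    using that by (auto simp: is_iso_def)
  then show ?thesis
    using ring_end_ring[OF assms] u
    unfolding division_ring_def set_eq_iff by (auto simp: is_iso_def)
qed

end

text \<open>
  A model of the coproduct of one-object categories \<open>D i\<close> with objects \<open>b i\<close>. The indices serve as
  objects; between distinct objects there is one arrow, which is the zero arrow.
\<close>

definition disjoint_union ::
  "'u set \<Rightarrow> ('u \<Rightarrow> ('k, 'u, 'u) lcat) \<Rightarrow> ('u \<Rightarrow> 'u) \<Rightarrow> ('k, 'u, 'u) lcat"
  where "disjoint_union I D b = \<lparr>Ob = I,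
    Hom = (\<lambda>i j. if i = j then Hom (D i) (b i) (b i) else {undefined}),
    Cmp = (\<lambda>i j k g f. if i = j \<and> j = k then Cmp (D i) (b i) (b i) (b i) g f
      else if i = k then zero_arr (D i) (b i) (b i) else undefined),
    Idn = (\<lambda>i. Idn (D i) (b i)),
    HMod = (\<lambda>i j. if i = j then HMod (D i) (b i) (b i) else trivial_module)\<rparr>"

lemma trivial_module_simps [simp]:
  "carrier trivial_module = {undefined}" "zero trivial_module = undefined"
  "u \<oplus>\<^bsub>trivial_module\<^esub> v = undefined" "a \<odot>\<^bsub>trivial_module\<^esub> v = undefined"
  by (simp_all add: trivial_module_def)

lemma k_linear_disjoint_union:
  assumes K: "cring K" and D: "\<And>i. i \<in> I \<Longrightarrow> k_linear_category K (D i)" and b: "\<And>i. i \<in> I \<Longrightarrow> b i \<in> Ob (D i)"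
  shows "k_linear_category K (disjoint_union I D b)" (is "k_linear_category K ?Y")
proof -
  have o [simp]: "Ob ?Y = I" by (simp add: disjoint_union_def)
  have h: "Hom ?Y i j = (if i = j then Hom (D i) (b i) (b i) else {undefined})" for i j
    by (simp add: disjoint_union_def)
  have c: "Cmp ?Y i j k g f = (if i = j \<and> j = k then Cmp (D i) (b i) (b i) (b i) g f
      else if i = k then zero_arr (D i) (b i) (b i) else undefined)" for i j k g f
    by (simp add: disjoint_union_def)
  have m: "HMod ?Y i j = (if i = j then HMod (D i) (b i) (b i) else trivial_module)" for i j
    by (simp add: disjoint_union_def)
  have d [simp]: "Idn ?Y i = Idn (D i) (b i)" for i by (simp add: disjoint_union_def)
  note [simp] = b k_linear_category.zero_in_Hom[OF D] k_linear_category.add_in_Hom[OF D]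
    k_linear_category.add_zero_left[OF D] k_linear_category.add_zero_right[OF D]
    k_linear_category.Cmp_zero_left[OF D] k_linear_category.Cmp_zero_right[OF D]
    category.Cmp_in_Hom[OF k_linear_category.axioms(2)[OF D]]
    category.Idn_in_Hom[OF k_linear_category.axioms(2)[OF D]]
    category.Cmp_Idn_left[OF k_linear_category.axioms(2)[OF D]]
    category.Cmp_Idn_right[OF k_linear_category.axioms(2)[OF D]]
    k_linear_category.carrier_HMod[OF D]
    k_linear_category.Cmp_add_left[OF D] k_linear_category.Cmp_add_right[OF D]
    k_linear_category.Cmp_smult_left[OF D] k_linear_category.Cmp_smult_right[OF D]
    k_linear_category.smult_in_Hom[OF D]
  show ?thesis
  proof (intro k_linear_category.intro k_linear_category_axioms.intro category.intro K)
    fix i j k l f g r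
    show "i \<in> Ob ?Y \<Longrightarrow> Idn ?Y i \<in> Hom ?Y i i" by (simp add: h)
    show "\<lbrakk>i \<in> Ob ?Y; j \<in> Ob ?Y; k \<in> Ob ?Y; f \<in> Hom ?Y i j; g \<in> Hom ?Y j k\<rbrakk> \<Longrightarrow> Cmp ?Y i j k g f \<in> Hom ?Y i k"
      by (cases "i = j"; cases "j = k") (simp_all add: h c)
    show "\<lbrakk>i \<in> Ob ?Y; j \<in> Ob ?Y; f \<in> Hom ?Y i j\<rbrakk> \<Longrightarrow> Cmp ?Y i j j (Idn ?Y j) f = f"
      by (cases "i = j") (simp_all add: h c)
    show "\<lbrakk>i \<in> Ob ?Y; j \<in> Ob ?Y; f \<in> Hom ?Y i j\<rbrakk> \<Longrightarrow> Cmp ?Y i i j f (Idn ?Y i) = f"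
      by (cases "i = j") (simp_all add: h c)
    show "\<lbrakk>l \<in> Ob ?Y; i \<in> Ob ?Y; j \<in> Ob ?Y; k \<in> Ob ?Y; f \<in> Hom ?Y l i; g \<in> Hom ?Y i j; r \<in> Hom ?Y j k\<rbrakk>
      \<Longrightarrow> Cmp ?Y l j k r (Cmp ?Y l i j g f) = Cmp ?Y l i k (Cmp ?Y i j k r g) f"
      by (cases "l = i"; cases "i = j"; cases "j = k")
        (auto simp: h c category.Cmp_assoc[OF k_linear_category.axioms(2)[OF D]])
    show "\<lbrakk>i \<in> Ob ?Y; j \<in> Ob ?Y\<rbrakk> \<Longrightarrow> module K (HMod ?Y i j)"
      by (simp add: m module_trivial[OF K] k_linear_category.HMod_module[OF D])
    show "\<lbrakk>i \<in> Ob ?Y; j \<in> Ob ?Y\<rbrakk> \<Longrightarrow> carrier (HMod ?Y i j) = Hom ?Y i j"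
      by (simp add: m h)
    show "\<lbrakk>i \<in> Ob ?Y; j \<in> Ob ?Y; k \<in> Ob ?Y; f \<in> Hom ?Y i j\<rbrakk>
      \<Longrightarrow> linear_map K (HMod ?Y j k) (HMod ?Y i k) (\<lambda>g. Cmp ?Y i j k g f)"
      by (cases "i = j"; cases "j = k"; rule linear_mapI)
        (simp_all add: h c m module.smult_r_null[OF k_linear_category.HMod_module[OF D]])
    show "\<lbrakk>i \<in> Ob ?Y; j \<in> Ob ?Y; k \<in> Ob ?Y; g \<in> Hom ?Y j k\<rbrakk>
      \<Longrightarrow> linear_map K (HMod ?Y i j) (HMod ?Y i k) (\<lambda>f. Cmp ?Y i j k g f)"
      by (cases "i = j"; cases "j = k"; rule linear_mapI)
        (simp_all add: h c m module.smult_r_null[OF k_linear_category.HMod_module[OF D]])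
  qed
qed

text \<open>
  The universal property yields mutually inverse functors between \<open>X\<close> and the disjoint union of the
  algebras. The objects of the latter form a Schur family by construction.
\<close>

lemma coproduct_schur:
  assumes K: "cring K" and cp: "coproduct_of_division_algebras K (X :: ('k, 'u, 'u) lcat)"
  shows "schur_family X (Ob X)"
proof -
  obtain I and D :: "'u \<Rightarrow> ('k, 'u, 'u) lcat" and \<iota> where Dd: "\<And>i. i \<in> I \<Longrightarrow> is_division_algebra K (D i)"
    and co: "is_coproduct K I D X \<iota>"
    using cp unfolding coproduct_of_division_algebras_def by blast
  have Dk: "\<And>i. i \<in> I \<Longrightarrow> k_linear_category K (D i)" and Xk: "k_linear_category K X"
    and \<iota>: "\<And>i. i \<in> I \<Longrightarrow> linear_functor K (D i) X (\<iota> i)"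
    using co by (auto simp: is_coproduct_def)
  have uni: "\<exists>H. linear_functor K X Y H \<and> (\<forall>i\<in>I. functor_eq (D i) (comp_functor H (\<iota> i)) (G i)) \<and>
        (\<forall>H'. linear_functor K X Y H' \<and> (\<forall>i\<in>I. functor_eq (D i) (comp_functor H' (\<iota> i)) (G i))
          \<longrightarrow> functor_eq X H' H)"
    if "k_linear_category K Y" "\<And>i. i \<in> I \<Longrightarrow> linear_functor K (D i) Y (G i)" for Y :: "('k, 'u, 'u) lcat" and G
    using co that unfolding is_coproduct_def by blast
  have "\<forall>i\<in>I. \<exists>b. Ob (D i) = {b}" using Dd by (auto simp: is_division_algebra_def is_algebra_def)
  then obtain b where b: "\<And>i. i \<in> I \<Longrightarrow> Ob (D i) = {b i}" by metis
  let ?Y = "disjoint_union I D b"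
  have o [simp]: "Ob ?Y = I" by (simp add: disjoint_union_def)
  have h: "Hom ?Y i j = (if i = j then Hom (D i) (b i) (b i) else {undefined})" for i j
    by (simp add: disjoint_union_def)
  have c: "Cmp ?Y i j k g f = (if i = j \<and> j = k then Cmp (D i) (b i) (b i) (b i) g f
      else if i = k then zero_arr (D i) (b i) (b i) else undefined)" for i j k g f
    by (simp add: disjoint_union_def)
  have m: "HMod ?Y i j = (if i = j then HMod (D i) (b i) (b i) else trivial_module)" for i j
    by (simp add: disjoint_union_def)
  have d [simp]: "Idn ?Y i = Idn (D i) (b i)" for i by (simp add: disjoint_union_def)
  have Yk: "k_linear_category K ?Y" by (rule k_linear_disjoint_union[OF K Dk]) (simp_all add: b)
  interpret X: k_linear_category K X by (rule Xk)
  interpret Y: k_linear_category K ?Y by (rule Yk)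
  have \<iota>f: "lin_functor K (D i) X (\<iota> i)" if "i \<in> I" for i using lin_functorI Dk Xk \<iota> that by blast
  note [simp] = lin_functor.F_Ob[OF \<iota>f] lin_functor.F_Hom[OF \<iota>f] lin_functor.F_Idn[OF \<iota>f]
    lin_functor.F_Cmp[OF \<iota>f] lin_functor.F_add[OF \<iota>f] lin_functor.F_smult[OF \<iota>f] lin_functor.F_zero[OF \<iota>f]
  define G :: "'u \<Rightarrow> ('u, 'u, 'u, 'u) fnctr" where "G i = \<lparr>OMap = (\<lambda>_. i), AMap = (\<lambda>_ _ f. f)\<rparr>" for i
  have G: "linear_functor K (D i) ?Y (G i)" if i: "i \<in> I" for i
    by (rule k_linear_category.linear_functorI[OF Dk[OF i] Yk]) (use i in \<open>simp_all add: G_def b h c m\<close>)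
  define P :: "('u, 'u, 'u, 'u) fnctr" where "P = \<lparr>OMap = (\<lambda>i. OMap (\<iota> i) (b i)),
    AMap = (\<lambda>i j f. if i = j then AMap (\<iota> i) (b i) (b i) f
      else zero_arr X (OMap (\<iota> i) (b i)) (OMap (\<iota> j) (b j)))\<rparr>"
  have P: "linear_functor K ?Y X P"
  proof (rule Y.linear_functorI[OF Xk])
    fix i j f a assume "i \<in> Ob ?Y" "j \<in> Ob ?Y" "f \<in> Hom ?Y i j" "a \<in> carrier K"
    then show "AMap P i j (a \<odot>\<^bsub>HMod ?Y i j\<^esub> f) = a \<odot>\<^bsub>HMod X (OMap P i) (OMap P j)\<^esub> AMap P i j f"
      by (auto simp: P_def b h m module.smult_r_null[OF X.HMod_module] split: if_splits)
  qed (auto simp: P_def b h c m split: if_splits)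
  interpret P: lin_functor K ?Y X P using lin_functorI Yk Xk P by blast
  obtain H where H: "linear_functor K X ?Y H" and HG: "\<And>i. i \<in> I \<Longrightarrow> functor_eq (D i) (comp_functor H (\<iota> i)) (G i)"
    using uni[OF Yk, of G] G by blast
  interpret H: lin_functor K X ?Y H using lin_functorI Yk Xk H by blast
  obtain H0 where H0: "\<And>H'. \<lbrakk>linear_functor K X X H'; \<And>i. i \<in> I \<Longrightarrow> functor_eq (D i) (comp_functor H' (\<iota> i)) (\<iota> i)\<rbrakk>
      \<Longrightarrow> functor_eq X H' H0"
    using uni[OF Xk, of \<iota>] \<iota> by blast
  have HO: "OMap H (OMap (\<iota> i) (b i)) = i" if "i \<in> I" for i
    using HG[OF that] that by (simp add: functor_eq_def b G_def)
  have HA: "AMap H (OMap (\<iota> i) (b i)) (OMap (\<iota> i) (b i)) (AMap (\<iota> i) (b i) (b i) f) = f"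
    if "i \<in> I" "f \<in> Hom (D i) (b i) (b i)" for i f
    using HG[OF that(1)] that by (simp add: functor_eq_def b G_def)
  have "functor_eq X (comp_functor P H) H0"
    by (rule H0[OF linear_functor_comp[OF H P]]) (simp add: functor_eq_def b HO HA, simp add: P_def)
  moreover have "functor_eq X id_functor H0"
    by (rule H0[OF linear_functor_id]) (simp add: functor_eq_def)
  ultimately have PHo: "\<And>x. x \<in> Ob X \<Longrightarrow> OMap P (OMap H x) = x"
    and PHa: "\<And>x y f. \<lbrakk>x \<in> Ob X; y \<in> Ob X; f \<in> Hom X x y\<rbrakk> \<Longrightarrow> AMap P (OMap H x) (OMap H y) (AMap H x y f) = f"
    by (simp_all add: functor_eq_def)
  have HPo: "OMap H (OMap P i) = i" if "i \<in> I" for i using HO[OF that] by (simp add: P_def)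
  have HPa: "AMap H (OMap P i) (OMap P j) (AMap P i j f) = f" if "i \<in> I" "j \<in> I" "f \<in> Hom ?Y i j" for i j f
  proof (cases "i = j")
    case True
    then show ?thesis using HA[of i f] that by (simp add: P_def h)
  next
    case False
    have "AMap H (OMap P i) (OMap P j) (AMap P i j f) \<in> Hom ?Y (OMap H (OMap P i)) (OMap H (OMap P j))"
      using that by (intro H.F_Hom) simp_all
    then show ?thesis using that False by (simp add: HPo h)
  qed
  have "bij_betw (AMap P i j) (Hom ?Y i j) (Hom X (OMap P i) (OMap P j))" if "i \<in> I" "j \<in> I" for i j
  proof (rule bij_betw_byWitness[where f' = "AMap H (OMap P i) (OMap P j)"])
    show "\<forall>f\<in>Hom ?Y i j. AMap H (OMap P i) (OMap P j) (AMap P i j f) = f" using HPa that by blast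
    show "\<forall>f\<in>Hom X (OMap P i) (OMap P j). AMap P i j (AMap H (OMap P i) (OMap P j) f) = f"
      using PHa[of "OMap P i" "OMap P j"] that by (simp add: HPo)
    show "AMap P i j ` Hom ?Y i j \<subseteq> Hom X (OMap P i) (OMap P j)" using that by auto
    show "AMap H (OMap P i) (OMap P j) ` Hom X (OMap P i) (OMap P j) \<subseteq> Hom ?Y i j"
      using H.F_Hom[of "OMap P i" "OMap P j"] that by (auto simp: HPo)
  qed
  then interpret P: ff_functor K ?Y X P
    by unfold_locales (simp add: fully_faithful_def ff_pair_def)
  have "schur_family ?Y I"
    unfolding schur_family_def
  proof (intro conjI ballI impI)
    have dv: "Idn (D i) (b i) \<noteq> zero_arr (D i) (b i) (b i) \<and>
      (\<forall>f\<in>Hom (D i) (b i) (b i). f \<noteq> zero_arr (D i) (b i) (b i) \<longrightarrow> is_iso (D i) (b i) (b i) f)"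
      if i: "i \<in> I" for i
      using Dd[OF i] k_linear_category.division_end_ring_iff[OF Dk[OF i], of "b i"]
      by (simp add: is_division_algebra_def b[OF i])
    show "Idn ?Y i \<noteq> zero_arr ?Y i i" if "i \<in> I" for i using dv[OF that] by (simp add: m)
    fix i j f assume ij: "i \<in> I" "j \<in> I" "f \<in> Hom ?Y i j" "f \<noteq> zero_arr ?Y i j"
    then show "i = j" by (auto simp: h m split: if_splits)
    then show "is_iso ?Y i j f" using ij dv[of i] by (simp add: h m c is_iso_def)
  qed simp
  then have "schur_family X (OMap P ` I)" by (rule P.schur_family_image)
  moreover have "OMap P ` I = Ob X"
  proof
    show "OMap P ` I \<subseteq> Ob X" using P.F_Ob by auto
    show "Ob X \<subseteq> OMap P ` I" using PHo H.F_Ob by (metis imageI o subsetI)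
  qed
  ultimately show ?thesis by simp
qed

text \<open>
  \<open>X\<close> is the coproduct of the endomorphism algebras of its objects. On maps between distinct objects a
  linear functor out of \<open>X\<close> has to be zero, since these maps are zero.
\<close>

lemma schur_coproduct:
  fixes X :: "('k, 'u, 'u) lcat"
  assumes Xk: "k_linear_category K X" and sch: "schur_family X (Ob X)"
  shows "coproduct_of_division_algebras K X"
proof -
  interpret X: k_linear_category K X by (rule Xk)
  let ?D = "\<lambda>x. full_subcat X {x}"
  have Dk: "k_linear_category K (?D x)" if "x \<in> Ob X" for x
    using that by (intro X.k_linear_full_subcat) simp
  have off: "f = zero_arr X x y" if "x \<in> Ob X" "y \<in> Ob X" "f \<in> Hom X x y" "x \<noteq> y" for f x y
    using schur_familyD[OF sch that(1-3)] that(4) by blast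
  have "is_division_algebra K (?D x)" if x: "x \<in> Ob X" for x
    using Dk[OF x] X.division_end_ring_iff[OF x] sch x
    by (simp add: is_division_algebra_def is_algebra_def schur_family_def)
  moreover have "is_coproduct K (Ob X) ?D X (\<lambda>_. id_functor)"
    unfolding is_coproduct_def
  proof (intro conjI ballI allI impI)
    show "linear_functor K (?D x) X id_functor" if "x \<in> Ob X" for x
      using that by (auto simp: linear_functor_def is_functor_def linear_map_def)
    fix Y :: "('k, 'u, 'u) lcat" and G
    assume "k_linear_category K Y \<and> (\<forall>x\<in>Ob X. linear_functor K (?D x) Y (G x))"
    then have Yk: "k_linear_category K Y" and G: "\<And>x. x \<in> Ob X \<Longrightarrow> linear_functor K (?D x) Y (G x)" by auto
    interpret Y: k_linear_category K Y by (rule Yk)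
    have Gf: "lin_functor K (?D x) Y (G x)" if "x \<in> Ob X" for x using lin_functorI Dk Yk G that by blast
    note [simp] = lin_functor.F_Ob[OF Gf, simplified] lin_functor.F_Hom[OF Gf, simplified]
      lin_functor.F_Idn[OF Gf, simplified] lin_functor.F_Cmp[OF Gf, simplified]
      lin_functor.F_add[OF Gf, simplified] lin_functor.F_smult[OF Gf, simplified]
      lin_functor.F_zero[OF Gf, simplified]
    define H :: "('u, 'u, 'u, 'u) fnctr" where "H = \<lparr>OMap = (\<lambda>x. OMap (G x) x),
      AMap = (\<lambda>x y f. if x = y then AMap (G x) x x f else zero_arr Y (OMap (G x) x) (OMap (G y) y))\<rparr>"
    have H: "linear_functor K X Y H"
    proof (rule X.linear_functorI[OF Yk])
      fix x y f a assume "x \<in> Ob X" "y \<in> Ob X" "f \<in> Hom X x y" "a \<in> carrier K"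
      then show "AMap H x y (a \<odot>\<^bsub>HMod X x y\<^esub> f) = a \<odot>\<^bsub>HMod Y (OMap H x) (OMap H y)\<^esub> AMap H x y f"
        by (auto simp: H_def module.smult_r_null[OF Y.HMod_module])
    next
      fix x y z f g assume xy: "x \<in> Ob X" "y \<in> Ob X" "z \<in> Ob X" "f \<in> Hom X x y" "g \<in> Hom X y z"
      have "Cmp X x y x g f = zero_arr X x x" if "x \<noteq> y" "x = z"
        using xy off[OF xy(1,2,4) that(1)] that(2) by simp
      then show "AMap H x z (Cmp X x y z g f) =
          Cmp Y (OMap H x) (OMap H y) (OMap H z) (AMap H y z g) (AMap H x y f)"
        using xy by (auto simp: H_def)
    qed (auto simp: H_def)
    have HG: "functor_eq (?D x) (comp_functor H id_functor) (G x)" if "x \<in> Ob X" for x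
      by (simp add: functor_eq_def H_def)
    have "functor_eq X H' H"
      if H': "linear_functor K X Y H'" "\<forall>x\<in>Ob X. functor_eq (?D x) (comp_functor H' id_functor) (G x)" for H'
    proof -
      interpret H': lin_functor K X Y H' using lin_functorI Xk Yk H'(1) by blast
      have o: "OMap H' x = OMap (G x) x" if "x \<in> Ob X" for x
        using H'(2) that by (simp add: functor_eq_def)
      have a: "AMap H' x x f = AMap (G x) x x f" if "x \<in> Ob X" "f \<in> Hom X x x" for x f
        using H'(2) that by (simp add: functor_eq_def)
      have "AMap H' x y f = AMap H x y f" if xy: "x \<in> Ob X" "y \<in> Ob X" "f \<in> Hom X x y" for x y f
        using a xy off[OF xy] by (cases "x = y") (auto simp: H_def o)
      then show ?thesis using o by (simp add: functor_eq_def H_def)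
    qed
    then show "\<exists>H. linear_functor K X Y H \<and> (\<forall>i\<in>Ob X. functor_eq (?D i) (comp_functor H id_functor) (G i)) \<and>
        (\<forall>H'. linear_functor K X Y H' \<and> (\<forall>i\<in>Ob X. functor_eq (?D i) (comp_functor H' id_functor) (G i))
          \<longrightarrow> functor_eq X H' H)"
      using H HG by blast
  qed (use Dk Xk in auto)
  ultimately have "(\<forall>x\<in>Ob X. is_division_algebra K (?D x)) \<and> is_coproduct K (Ob X) ?D X (\<lambda>_. id_functor)"
    by simp
  then show ?thesis
    unfolding coproduct_of_division_algebras_def
    by (intro exI[of _ "Ob X"] exI[of _ ?D] exI[of _ "\<lambda>_. id_functor"])
qed

lemma coproduct_of_division_algebras_iff:
  assumes "cring K"
  shows "coproduct_of_division_algebras K (X :: ('k, 'u, 'u) lcat) \<longleftrightarrow>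
    k_linear_category K X \<and> schur_family X (Ob X)"
proof
  assume X: "coproduct_of_division_algebras K X"
  then have "k_linear_category K X"
    unfolding coproduct_of_division_algebras_def is_coproduct_def by blast
  then show "k_linear_category K X \<and> schur_family X (Ob X)" using coproduct_schur[OF assms X] by blast
qed (use schur_coproduct in blast)

section \<open>Semisimple abelian categories as free completions\<close>

lemma ff_pair_full_subcat [simp]: "ff_pair C (full_subcat D S) F x y \<longleftrightarrow> ff_pair C D F x y"
  by (simp add: ff_pair_def)

lemma linear_functor_full_subcat:
  assumes "linear_functor K C D F" "\<And>x. x \<in> Ob C \<Longrightarrow> OMap F x \<in> S"
  shows "linear_functor K C (full_subcat D S) F"
  using assms by (simp add: linear_functor_def is_functor_def)

context full_subcategory
begin

lemma schur_family_representables: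
  assumes "schur_family C T"
  shows "schur_family (Psh K X) (representable X ` T)"
proof -
  interpret P: k_linear_category K "Psh K X" by (rule k_linear_Psh)
  have "linear_functor K X (Psh K X) (yoneda X)"
    using yoneda_linear T_sub by (auto simp: linear_functor_def is_functor_def subset_iff)
  then interpret Y: ff_functor K X "Psh K X" "yoneda X"
    by unfold_locales (use yoneda_lemma in \<open>auto simp: fully_faithful_def ff_pair_def\<close>)
  have "schur_family X T" using assms by (simp add: schur_family_def is_iso_def)
  then show ?thesis using Y.schur_family_image[of T] by simp
qed

lemma Fin_eq_fsums:
  assumes "infinite (UNIV :: 'u set)" "schur_family C T"
  shows "Fin K X = full_subcat (Psh K X) (fsums (Psh K X) (representable X ` T))"
  using k_linear_category.least_colimit_closed_eq_fsums[OF k_linear_Psh additive_Psh[OF assms(1)]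
      schur_family_representables[OF assms(2)]]
  by (simp add: Fin_def)

lemma k_linear_Fin:
  assumes "infinite (UNIV :: 'u set)" "schur_family C T"
  shows "k_linear_category K (Fin K X)"
  unfolding Fin_eq_fsums[OF assms]
  by (rule k_linear_category.k_linear_full_subcat[OF k_linear_Psh]) (auto dest: fsums_subset_Ob)

lemma Fin_simple_system:
  assumes "infinite (UNIV :: 'u set)" "schur_family C T"
  shows "simple_system (Fin K X) (representable X ` T)"
  unfolding Fin_eq_fsums[OF assms]
  by (rule k_linear_category.fsums_simple_system[OF k_linear_Psh additive_Psh[OF assms(1)]
        schur_family_representables[OF assms(2)]])

theorem yoneda_equivalence:
  assumes inf: "infinite (UNIV :: 'u set)" and sys: "simple_system C T"
  shows "is_equivalence K C (Fin K X) (yoneda X)"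
proof -
  have sch: "schur_family C T" and fs: "Ob C \<subseteq> fsums C T" using sys by (auto simp: simple_system_def)
  interpret Y: lin_functor K C "Psh K X" "yoneda X"
    by (intro lin_functorI k_linear_category_axioms k_linear_Psh yoneda_linear)
  have "OMap (yoneda X) x \<in> fsums (Psh K X) (representable X ` T)" if "x \<in> Ob C" for x
    using Y.preserves_fsums[of x T] fs that by auto
  then have "linear_functor K C (Fin K X) (yoneda X)"
    unfolding Fin_eq_fsums[OF inf sch] by (rule linear_functor_full_subcat[OF yoneda_linear])
  then interpret F: lin_functor K C "Fin K X" "yoneda X"
    by (intro lin_functorI k_linear_category_axioms k_linear_Fin[OF inf sch])
  show ?thesis
  proof (rule F.equivalence_of_ff_on_simples[OF sys])
    show "Ob (Fin K X) \<subseteq> fsums (Fin K X) (OMap (yoneda X) ` T)"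
      using Fin_simple_system[OF inf sch] by (simp add: simple_system_def)
    show "ff_pair C (Fin K X) (yoneda X) s t" if "s \<in> T" "t \<in> T" for s t
      using yoneda_lemma[OF that(1)] that(2) by (simp add: Fin_eq_fsums[OF inf sch])
  qed
qed

end

text \<open>
  The objects and arrows of \<open>X\<close> must be elements of the universe, so \<open>X\<close> is found inside a small
  category equivalent to \<open>A\<close>.
\<close>

theorem semisimple_iff_Fin:
  fixes K :: "('k, 'r) ring_scheme" and A :: "('k, 'o, 'a) lcat"
  assumes K: "cring K" and inf: "infinite (UNIV :: 'u set)" and A: "k_linear_category K A"
    and small: "essentially_small TYPE('u) K A"
  shows "semisimple_abelian_finite_length K A \<longleftrightarrow>
    (\<exists>X :: ('k, 'u, 'u) lcat. coproduct_of_division_algebras K X \<and> equivalent_cats K A (Fin K X))"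
proof
  interpret A: k_linear_category K A by (rule A)
  assume "semisimple_abelian_finite_length K A"
  then obtain T where T: "simple_system A T" using A.semisimple_simple_system by blast
  obtain S :: "('k, 'u, 'u) lcat" and F where S: "k_linear_category K S" and F: "is_equivalence K A S F"
    using small by (auto simp: essentially_small_def equivalent_cats_def)
  interpret S: k_linear_category K S by (rule S)
  interpret F: ff_functor K A S F by (rule ff_functor_of_equivalence[OF A S F])
  have sys: "simple_system S (OMap F ` T)" (is "simple_system S ?T")
    by (rule F.simple_system_transport[OF F.equivalence_ff_ess_surj(2)[OF F] T])
  then have sch: "schur_family S ?T" and sub: "?T \<subseteq> Ob S" by (auto simp: simple_system_def schur_family_def)
  interpret full_subcategory K S ?T by unfold_locales (rule sub)
  have "schur_family X ?T" using sch by (simp add: schur_family_def is_iso_def)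
  then have "coproduct_of_division_algebras K X"
    using coproduct_of_division_algebras_iff[OF K, of X] X.k_linear_category_axioms by simp
  moreover have "is_equivalence K A (Fin K X) (comp_functor (yoneda X) F)"
    by (rule equivalence_trans[OF A S k_linear_Fin[OF inf sch] F yoneda_equivalence[OF inf sys]])
  ultimately show "\<exists>X :: ('k, 'u, 'u) lcat. coproduct_of_division_algebras K X \<and> equivalent_cats K A (Fin K X)"
    unfolding equivalent_cats_def by blast
next
  interpret A: k_linear_category K A by (rule A)
  assume "\<exists>X :: ('k, 'u, 'u) lcat. coproduct_of_division_algebras K X \<and> equivalent_cats K A (Fin K X)"
  then obtain X :: "('k, 'u, 'u) lcat" and F where X: "k_linear_category K X" "schur_family X (Ob X)"
    and F: "is_equivalence K A (Fin K X) F"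
    unfolding equivalent_cats_def coproduct_of_division_algebras_iff[OF K] by blast
  interpret X: k_linear_category K X by (rule X)
  interpret P: full_subcategory K X "Ob X" by unfold_locales simp
  have Fk: "k_linear_category K (Fin K X)" using P.k_linear_Fin[OF inf X(2)] by simp
  obtain G where G: "is_equivalence K (Fin K X) A G" using A.equivalence_inverse[OF Fk F] by blast
  interpret G: ff_functor K "Fin K X" A G by (rule ff_functor_of_equivalence[OF Fk A G])
  have "simple_system (Fin K X) (representable X ` Ob X)" using P.Fin_simple_system[OF inf X(2)] by simp
  then have "simple_system A (OMap G ` representable X ` Ob X)"
    by (rule G.simple_system_transport[OF G.equivalence_ff_ess_surj(2)[OF G]])
  then show "semisimple_abelian_finite_length K A" by (rule A.simple_system_semisimple)
qed

theorem skeleton_of_simples: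
  fixes K :: "('k, 'r) ring_scheme" and A :: "('k, 'o, 'a) lcat" and X :: "('k, 'u, 'u) lcat"
  assumes K: "cring K" and inf: "infinite (UNIV :: 'u set)" and A: "k_linear_category K A"
    and cop: "coproduct_of_division_algebras K X" and F: "is_equivalence K (Fin K X) A F"
  defines "E \<equiv> comp_functor F (yoneda X)"
  shows "is_skeleton (simples A) (OMap E ` Ob X)"
    and "is_isomorphism K X (full_subcat (simples A) (OMap E ` Ob X)) E"
proof -
  let ?S = "OMap E ` Ob X"
  have Xk: "k_linear_category K X" and sch: "schur_family X (Ob X)"
    using cop unfolding coproduct_of_division_algebras_iff[OF K] by auto
  interpret A: k_linear_category K A by (rule A)
  interpret X: k_linear_category K X by (rule Xk)
  interpret P: full_subcategory K X "Ob X" by unfold_locales simp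
  have Fk: "k_linear_category K (Fin K X)" using P.k_linear_Fin[OF inf sch] by simp
  interpret F: ff_functor K "Fin K X" A F by (rule ff_functor_of_equivalence[OF Fk A F])
  have Fsys: "simple_system (Fin K X) (representable X ` Ob X)" using P.Fin_simple_system[OF inf sch] by simp
  have S: "?S = OMap F ` representable X ` Ob X" by (auto simp: E_def)
  have sys: "simple_system A ?S"
    unfolding S by (rule F.simple_system_transport[OF F.equivalence_ff_ess_surj(2)[OF F] Fsys])
  then show "is_skeleton (simples A) ?S" by (rule A.simple_system_skeleton)
  have sub: "?S \<subseteq> Ob A" using sys by (auto simp: simple_system_def schur_family_def)
  have Fin: "Fin K X = full_subcat (Psh K X) (fsums (Psh K X) (representable X ` Ob X))"
    using P.Fin_eq_fsums[OF inf sch] by simp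
  have Yl: "linear_functor K X (Fin K X) (yoneda X)"
    unfolding Fin
  proof (rule linear_functor_full_subcat)
    show "linear_functor K X (Psh K X) (yoneda X)" using P.yoneda_linear by simp
    fix x assume "x \<in> Ob X"
    then have "representable X x \<in> Ob (Fin K X)"
      using Fsys by (auto simp: simple_system_def schur_family_def)
    then show "OMap (yoneda X) x \<in> fsums (Psh K X) (representable X ` Ob X)" by (simp add: Fin)
  qed
  have Yff: "fully_faithful X (Fin K X) (yoneda X)"
    unfolding fully_faithful_def Fin using P.yoneda_lemma by simp
  have El: "linear_functor K X A E"
    unfolding E_def by (rule linear_functor_comp[OF Yl F.linear])
  have Eff: "fully_faithful X A E"
    unfolding E_def by (rule fully_faithful_comp[OF _ Yff F.ff]) (use Yl in \<open>simp add: linear_functor_def\<close>)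
  interpret EA: ff_functor K X A E by unfold_locales (rule El, rule Eff)
  interpret B: k_linear_category K "full_subcat A ?S" by (rule A.k_linear_full_subcat[OF sub])
  interpret E: ff_functor K X "full_subcat A ?S" E
    by unfold_locales
      (use Eff in \<open>auto intro: linear_functor_full_subcat[OF El] simp: fully_faithful_def\<close>)
  have "inj_on (OMap E) (Ob X)"
  proof (rule inj_onI)
    fix x y assume xy: "x \<in> Ob X" "y \<in> Ob X" "OMap E x = OMap E y"
    then have "isomorphic A (OMap E x) (OMap E y)" using A.isomorphic_refl by simp
    then show "x = y" using EA.reflects_iso X.schur_isomorphic_eq[OF sch] xy by blast
  qed
  then have "is_isomorphism K X (full_subcat A ?S) E"
    by (intro E.isomorphism_of_bij) (simp add: bij_betw_def)
  then show "is_isomorphism K X (full_subcat (simples A) ?S) E"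
    by (simp add: simples_def full_subcat_def)
qed

theorem proposition26:
  fixes K :: "('k, 'r) ring_scheme"
    and A :: "('k, 'o, 'a) lcat"
  assumes "cring K"
    and "infinite (UNIV :: 'u set)"
    and "k_linear_category K A"
    and "essentially_small TYPE('u) K A"
  shows "(semisimple_abelian_finite_length K A \<longleftrightarrow>
      (\<exists>X :: ('k, 'u, 'u) lcat. coproduct_of_division_algebras K X \<and> equivalent_cats K A (Fin K X)))
    \<and> (\<forall>X :: ('k, 'u, 'u) lcat. \<forall>F.
      coproduct_of_division_algebras K X \<and> is_equivalence K (Fin K X) A F \<longrightarrow>
      (let E = comp_functor F (yoneda X); S = OMap E ` Ob X in
        is_skeleton (simples A) S \<and> is_isomorphism K X (full_subcat (simples A) S) E))"
  using semisimple_iff_Fin[OF assms] skeleton_of_simples[OF assms(1-3)] by (simp add: Let_def)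

end
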